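(* Let $R$ be a finite commutative ring in which $2$ is a unit, let $\mathbb{K}$ be a Noetherian ring, let $\mathcal{A}=\mathbf{OrI}(R)$, and let $M$ be a finitely generated $\mathcal{A}$-module over $\mathbb{K}$. Then there exists an integer $N$ such that for every morphism $f:V\to W$ in $\mathcal{A}$ with $\operatorname{rk}V\ge N$, the map $M(f):M(V)\to M(W)$ is injective.
   Context: An orthogonal $R$-module is a pair $(V,B)$ with $V$ a free $R$-module of finite rank $\operatorname{rk}V$ and $B:V\times V\to R$ a symmetric bilinear form that is non-degenerate, i.e. induces an isomorphism $V\to \mathrm{Hom}_R(V,R)$. An isometry $(V,B_V)\to(W,B_W)$ is an $R$-linear map $\phi$ with $B_V(v,w)=B_W(\phi(v),\phi(w))$ for all $v,w$ (not necessarily bijective). $\mathbf{OrI}(R)$ is the category of orthogonal $R$-modules and isometries. An $\mathcal{A}$-module over $\mathbb{K}$ is a functor $M:\mathcal{A}\to\mathbf{Mod}_{\mathbb{K}}$; submodules are defined pointwise. $M$ is finitely generated if there are finitely many objects $V_1,\dots,V_m$ and elements $x_i\in M(V_i)$ such that any submodule $N\subseteq M$ with $x_i\in N(V_i)$ for all $i$ equals $M$. *)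

theory Defs
  imports "HOL-Algebra.Ideal" "HOL-Algebra.Module"
begin

section \<open>Left modules over a not necessarily commutative ring\<close>

text \<open>The library locale \<^locale>\<open>module\<close> requires a commutative ring of scalars, and its
  notion of Noetherian ring refers to two-sided ideals. Here the coefficient ring
  is not assumed to be commutative, so we use left modules and left ideals. For commutative
  rings both notions agree with those of the library. As in the library, the multiplicative
  fields of a record of type \<^typ>\<open>('k, 'm) module\<close> carry no meaning.\<close>

locale left_module = K?: ring K + M?: abelian_group M for K (structure) and M (structure) +
  assumes smult_closed:
      "\<lbrakk>a \<in> carrier K; x \<in> carrier M\<rbrakk> \<Longrightarrow> a \<odot>\<^bsub>M\<^esub> x \<in> carrier M"
    and smult_l_distr:
      "\<lbrakk>a \<in> carrier K; b \<in> carrier K; x \<in> carrier M\<rbrakk> \<Longrightarrow>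
       (a \<oplus> b) \<odot>\<^bsub>M\<^esub> x = a \<odot>\<^bsub>M\<^esub> x \<oplus>\<^bsub>M\<^esub> b \<odot>\<^bsub>M\<^esub> x"
    and smult_r_distr:
      "\<lbrakk>a \<in> carrier K; x \<in> carrier M; y \<in> carrier M\<rbrakk> \<Longrightarrow>
       a \<odot>\<^bsub>M\<^esub> (x \<oplus>\<^bsub>M\<^esub> y) = a \<odot>\<^bsub>M\<^esub> x \<oplus>\<^bsub>M\<^esub> a \<odot>\<^bsub>M\<^esub> y"
    and smult_assoc:
      "\<lbrakk>a \<in> carrier K; b \<in> carrier K; x \<in> carrier M\<rbrakk> \<Longrightarrow>
       (a \<otimes> b) \<odot>\<^bsub>M\<^esub> x = a \<odot>\<^bsub>M\<^esub> (b \<odot>\<^bsub>M\<^esub> x)"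
    and smult_one:
      "x \<in> carrier M \<Longrightarrow> \<one> \<odot>\<^bsub>M\<^esub> x = x"

definition left_ideal :: "'k set \<Rightarrow> ('k, 's) ring_scheme \<Rightarrow> bool" where
  "left_ideal I K \<longleftrightarrow>
     additive_subgroup I K \<and> (\<forall>a\<in>carrier K. \<forall>x\<in>I. a \<otimes>\<^bsub>K\<^esub> x \<in> I)"

locale left_noetherian_ring = ring K for K (structure) +
  assumes left_ideal_finitely_generated:
    "left_ideal I K \<Longrightarrow>
       \<exists>A. finite A \<and> A \<subseteq> I \<and> (\<forall>J. left_ideal J K \<and> A \<subseteq> J \<longrightarrow> I \<subseteq> J)"

text \<open>Morphisms are represented by extensional functions, i.e. functions with a fixed dummy
  value outside the carrier of their domain. Thus equality of morphisms is equality of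
  functions, the identity is \<^term>\<open>\<lambda>v\<in>carrier V. v\<close>, and composition is \<^const>\<open>compose\<close>.\<close>

definition linear_maps ::
  "('r, 's) ring_scheme \<Rightarrow> ('r, 'v, 't) module_scheme \<Rightarrow> ('r, 'w, 'u) module_scheme
    \<Rightarrow> ('v \<Rightarrow> 'w) set" where
  "linear_maps R V W =
     {f \<in> carrier V \<rightarrow>\<^sub>E carrier W.
        (\<forall>v\<in>carrier V. \<forall>w\<in>carrier V. f (v \<oplus>\<^bsub>V\<^esub> w) = f v \<oplus>\<^bsub>W\<^esub> f w) \<and>
        (\<forall>a\<in>carrier R. \<forall>v\<in>carrier V. f (a \<odot>\<^bsub>V\<^esub> v) = a \<odot>\<^bsub>W\<^esub> f v)}"


section \<open>Orthogonal modules and isometries\<close>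

definition self_module :: "('r, 's) ring_scheme \<Rightarrow> ('r, 'r) module" where
  "self_module R =
     \<lparr>carrier = carrier R, mult = mult R, one = one R, zero = zero R, add = add R,
      smult = mult R\<rparr>"

definition free_of_rank ::
  "('r, 's) ring_scheme \<Rightarrow> ('r, 'v, 't) module_scheme \<Rightarrow> nat \<Rightarrow> bool" where
  "free_of_rank R V n \<longleftrightarrow>
     (\<exists>b \<in> {..<n} \<rightarrow> carrier V. \<forall>v\<in>carrier V. \<exists>!a.
        a \<in> {..<n} \<rightarrow>\<^sub>E carrier R \<and> v = (\<Oplus>\<^bsub>V\<^esub>i\<in>{..<n}. a i \<odot>\<^bsub>V\<^esub> b i))"

text \<open>Over a nontrivial commutative ring at most one \<^term>\<open>n\<close> satisfies
  \<^const>\<open>free_of_rank\<close>; over the zero ring every \<^term>\<open>n\<close> does, and the convention below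
  assigns rank 0 to every module.\<close>

definition rk :: "('r, 's) ring_scheme \<Rightarrow> ('r, 'v, 't) module_scheme \<Rightarrow> nat" where
  "rk R V = (LEAST n. free_of_rank R V n)"

record ('r, 'v) orth_module = "('r, 'v) module" +
  form :: "'v \<Rightarrow> 'v \<Rightarrow> 'r"

text \<open>The map \<open>v \<mapsto> B(v, -)\<close> from \<open>V\<close> to its dual is linear by bilinearity, so it is an
  isomorphism as soon as it is bijective.\<close>

locale orthogonal_module = module R V
  for R :: "('r, 's) ring_scheme" and V :: "('r, 'v) orth_module" +
  assumes free: "\<exists>n. free_of_rank R V n"
    and form_closed:
      "\<lbrakk>v \<in> carrier V; w \<in> carrier V\<rbrakk> \<Longrightarrow> form V v w \<in> carrier R"
    and form_sym:
      "\<lbrakk>v \<in> carrier V; w \<in> carrier V\<rbrakk> \<Longrightarrow> form V v w = form V w v"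
    and form_add:
      "\<lbrakk>v \<in> carrier V; v' \<in> carrier V; w \<in> carrier V\<rbrakk> \<Longrightarrow>
       form V (v \<oplus>\<^bsub>V\<^esub> v') w = form V v w \<oplus>\<^bsub>R\<^esub> form V v' w"
    and form_smult:
      "\<lbrakk>a \<in> carrier R; v \<in> carrier V; w \<in> carrier V\<rbrakk> \<Longrightarrow>
       form V (a \<odot>\<^bsub>V\<^esub> v) w = a \<otimes>\<^bsub>R\<^esub> form V v w"
    and nondegenerate:
      "bij_betw (\<lambda>v. \<lambda>w\<in>carrier V. form V v w) (carrier V) (linear_maps R V (self_module R))"

definition isometries ::
  "('r, 's) ring_scheme \<Rightarrow> ('r, 'v) orth_module \<Rightarrow> ('r, 'w) orth_module \<Rightarrow> ('v \<Rightarrow> 'w) set" where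
  "isometries R V W =
     {\<phi> \<in> linear_maps R V W.
        \<forall>v\<in>carrier V. \<forall>w\<in>carrier V. form V v w = form W (\<phi> v) (\<phi> w)}"


section \<open>Modules over the category of orthogonal modules and isometries\<close>

text \<open>The objects of \<open>OrI(R)\<close> are the orthogonal \<open>R\<close>-modules whose carrier is a subset of a
  fixed type \<^typ>\<open>'v\<close>. If \<open>R\<close> is finite, then so is every object, and any infinite type
  \<^typ>\<open>'v\<close> contains an isometric copy of each orthogonal \<open>R\<close>-module. A functor to left
  \<open>K\<close>-modules is given by its action \<open>Fo\<close> on objects and its action \<open>Fm\<close> on morphisms; as
  a function does not determine its codomain, \<open>Fm\<close> also takes the source and the target.\<close>

locale OrI_module = R: cring R + K: ring K
  for R :: "('r, 's) ring_scheme" and K :: "('k, 't) ring_scheme"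
    and Fo :: "('r, 'v) orth_module \<Rightarrow> ('k, 'm) module"
    and Fm :: "('r, 'v) orth_module \<Rightarrow> ('r, 'v) orth_module \<Rightarrow> ('v \<Rightarrow> 'v) \<Rightarrow> 'm \<Rightarrow> 'm" +
  assumes obj: "orthogonal_module R V \<Longrightarrow> left_module K (Fo V)"
    and mor:
      "\<lbrakk>orthogonal_module R V; orthogonal_module R W; f \<in> isometries R V W\<rbrakk> \<Longrightarrow>
       Fm V W f \<in> linear_maps K (Fo V) (Fo W)"
    and mor_id:
      "orthogonal_module R V \<Longrightarrow> Fm V V (\<lambda>v\<in>carrier V. v) = (\<lambda>x\<in>carrier (Fo V). x)"
    and mor_comp:
      "\<lbrakk>orthogonal_module R U; orthogonal_module R V; orthogonal_module R W;
        f \<in> isometries R U V; g \<in> isometries R V W\<rbrakk> \<Longrightarrow>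
       Fm U W (compose (carrier U) g f) = compose (carrier (Fo U)) (Fm V W g) (Fm U V f)"

definition OrI_submodule ::
  "('r, 's) ring_scheme \<Rightarrow> ('k, 't) ring_scheme
    \<Rightarrow> (('r, 'v) orth_module \<Rightarrow> ('k, 'm) module)
    \<Rightarrow> (('r, 'v) orth_module \<Rightarrow> ('r, 'v) orth_module \<Rightarrow> ('v \<Rightarrow> 'v) \<Rightarrow> 'm \<Rightarrow> 'm)
    \<Rightarrow> (('r, 'v) orth_module \<Rightarrow> 'm set) \<Rightarrow> bool" where
  "OrI_submodule R K Fo Fm N \<longleftrightarrow>
     (\<forall>V. orthogonal_module R V \<longrightarrow> submodule (N V) K (Fo V)) \<and>
     (\<forall>V W f. orthogonal_module R V \<and> orthogonal_module R W \<and> f \<in> isometries R V W \<longrightarrow>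
        Fm V W f ` N V \<subseteq> N W)"

definition OrI_finitely_generated ::
  "('r, 's) ring_scheme \<Rightarrow> ('k, 't) ring_scheme
    \<Rightarrow> (('r, 'v) orth_module \<Rightarrow> ('k, 'm) module)
    \<Rightarrow> (('r, 'v) orth_module \<Rightarrow> ('r, 'v) orth_module \<Rightarrow> ('v \<Rightarrow> 'v) \<Rightarrow> 'm \<Rightarrow> 'm) \<Rightarrow> bool" where
  "OrI_finitely_generated R K Fo Fm \<longleftrightarrow>
     (\<exists>S. finite S \<and>
        (\<forall>(V, x)\<in>S. orthogonal_module R V \<and> x \<in> carrier (Fo V)) \<and>
        (\<forall>N. OrI_submodule R K Fo Fm N \<and> (\<forall>(V, x)\<in>S. x \<in> N V) \<longrightarrow>
           (\<forall>V. orthogonal_module R V \<longrightarrow> N V = carrier (Fo V))))"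

end

theory Submission
  imports Defs "HOL-Algebra.Multiplicative_Group" "HOL-Library.Sublist" "HOL-Library.Ramsey"
    "HOL-Library.List_Lexorder"
begin

text \<open>
  Let \<open>n = |R|\<close>. Every orthogonal module has an orthogonal frame whose norms are units.
  Relative to a frame of \<open>W\<close>, an isometry \<open>g : V \<rightarrow> W\<close> is a word over the finite alphabet of
  pairs (norm of \<open>b\<close>, functional \<open>v \<mapsto> B(g v, b)\<close>). If a word \<open>Y = X \<circ> p\<close> with compatible norms
  repeats each position of \<open>X\<close> a number of times congruent to 1 modulo \<open>n\<close>, then mapping the
  \<open>j\<close>-th frame vector to the sum of the frame vectors with indices in the fibre of \<open>p\<close> over \<open>j\<close>
  is an isometry carrying \<open>X\<close> to \<open>Y\<close>, because \<open>n\<close> vanishes in \<open>R\<close>. It is strictly monotone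
  for the lexicographic order if the first occurrences stay in order. By Higman's lemma for words
  with marked first occurrences this divisibility admits no bad sequence, so a Groebner basis
  argument shows that submodules of finitely generated modules are finitely generated.

  Apply this to the submodule of elements killed in all sufficiently large ranks: its finitely
  many generators are killed beyond a common rank, so it vanishes beyond that rank. Over a finite
  ring in which 2 is a unit, forms of large rank represent everything, so every isometry
  \<open>V \<rightarrow> W'\<close> with \<open>W'\<close> of large rank factors through a given \<open>f : V \<rightarrow> W\<close>. Therefore the
  kernel of \<open>M(f)\<close> lies in that submodule.
\<close>

section \<open>Higman's lemma and pullbacks of words\<close>

text \<open>An orthogonal vector of norm \<open>q\<close>, replaced by the sum of \<open>m\<close>
  orthogonal copies, acquires norm \<open>m q\<close>; this is why fibre sizes have to be controlled
  modulo \<open>n\<close>, while Higman's lemma says nothing about counts. The remedy is to compare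
  only words with the same letter counts modulo \<open>n\<close>, and to send every letter of
  \<open>Y\<close> outside the embedded copy of \<open>X\<close> to the first occurrence of that
  letter in \<open>X\<close>. All fibres are then singletons except over first occurrences, where
  the size is 1 plus a difference of counts. The marks keep the first occurrences of both words
  aligned, so that they can be taken in increasing order.

  Frames are neither canonical nor of norm one, because a unit need not be a square. Hence a frame
  is carried along with each object, and its norms are part of the letters.

  Invertibility of 2 enters twice: polarization yields vectors of unit norm, and every scalar is a
  difference of two squares. As \<open>R\<close> may be a product of local rings, unit norms are
  assembled with idempotents, and many dimension arguments are replaced by counting
  elements.\<close>

lemma infinite_chain_of_good:
  fixes P :: "'a \<Rightarrow> 'a \<Rightarrow> bool" and f :: "nat \<Rightarrow> 'a"
  assumes good: "\<And>g :: nat \<Rightarrow> 'a. range g \<subseteq> A \<Longrightarrow> \<exists>i j. i < j \<and> P (g i) (g j)"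
    and f: "range f \<subseteq> A"
  shows "\<exists>Y. infinite Y \<and> (\<forall>i\<in>Y. \<forall>j\<in>Y. i < j \<longrightarrow> P (f i) (f j))"
proof -
  \<comment> \<open>The colour of a pair tells whether \<open>P\<close> holds from its smaller to
    its larger index. An infinite set of constant colour 1 is impossible, since \<open>good\<close>
    applied to its enumeration finds a pair of colour 0.\<close>
  define c where "c S = (if P (f (Min S)) (f (Max S)) then 0 else 1::nat)" for S
  have "\<forall>x\<in>UNIV. \<forall>y\<in>UNIV. x \<noteq> y \<longrightarrow> c {x, y} < 2"
    by (simp add: c_def)
  then obtain Y t where Y: "infinite Y" and t: "\<forall>x\<in>Y. \<forall>y\<in>Y. x \<noteq> y \<longrightarrow> c {x, y} = t"
    using Ramsey2[of "UNIV :: nat set" c 2] by auto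
  define e where "e = enumerate Y"
  have e: "e i \<in> Y" for i
    using Y by (simp add: e_def enumerate_in_set)
  have e_mono: "e i < e j" if "i < j" for i j
    using Y that by (simp add: e_def)
  obtain i j where ij: "i < j" "P (f (e i)) (f (e j))"
    using good[of "f \<circ> e"] f by fastforce
  have "c {e i, e j} = 0"
    using ij e_mono[OF ij(1)] by (simp add: c_def min_def max_def)
  with t e e_mono[OF ij(1)] have "t = 0"
    by (metis less_irrefl)
  have "P (f i) (f j)" if "i \<in> Y" "j \<in> Y" "i < j" for i j
  proof -
    have "c {i, j} = 0"
      using t \<open>t = 0\<close> that by auto
    then show ?thesis
      using that by (auto simp: c_def min_def max_def split: if_splits)
  qed
  with Y show ?thesis by blast
qed

text \<open>This is the construction of Nash-Williams: \<open>G (Suc n)\<close> agrees with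
  \<open>G n\<close> below \<open>n\<close> and has least measure at \<open>n\<close> among the bad
  sequences that do so. Entries below \<open>n\<close> never change again, so the diagonal
  \<open>G (Suc n) n\<close> is itself bad and inherits minimality at every index.\<close>

lemma minimal_bad_sequence:
  fixes m :: "'a \<Rightarrow> nat" and f :: "nat \<Rightarrow> 'a"
  assumes "\<forall>i. f i \<in> A" and "\<forall>i j. i < j \<longrightarrow> \<not> P (f i) (f j)"
  shows "\<exists>g :: nat \<Rightarrow> 'a. (\<forall>i. g i \<in> A) \<and> (\<forall>i j. i < j \<longrightarrow> \<not> P (g i) (g j)) \<and>
    (\<forall>n h. (\<forall>i. h i \<in> A) \<longrightarrow> (\<forall>i j. i < j \<longrightarrow> \<not> P (h i) (h j)) \<longrightarrow> (\<forall>i<n. h i = g i) \<longrightarrow>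
       m (g n) \<le> m (h n))"
proof -
  define bad where "bad g \<longleftrightarrow> (\<forall>i. g i \<in> A) \<and> (\<forall>i j. i < j \<longrightarrow> \<not> P (g i) (g j))"
    for g :: "nat \<Rightarrow> 'a"
  have "\<exists>G. \<forall>n. bad (G n) \<and> (\<forall>i<n. G (Suc n) i = G n i) \<and>
      (\<forall>h. bad h \<and> (\<forall>i<n. h i = G n i) \<longrightarrow> m (G (Suc n) n) \<le> m (h n))"
  proof (rule dependent_nat_choice[where P = "\<lambda>_. bad" and Q = "\<lambda>n x y. (\<forall>i<n. y i = x i) \<and>
      (\<forall>h. bad h \<and> (\<forall>i<n. h i = x i) \<longrightarrow> m (y n) \<le> m (h n))", simplified])
    show "\<exists>x. bad x"
      using assms by (intro exI[of _ f]) (auto simp: bad_def)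
    fix x :: "nat \<Rightarrow> 'a" and n :: nat
    assume x: "bad x"
    have "\<exists>y. (bad y \<and> (\<forall>i<n. y i = x i)) \<and>
      (\<forall>h. bad h \<and> (\<forall>i<n. h i = x i) \<longrightarrow> m (y n) \<le> m (h n))"
      using x by (rule_tac ex_has_least_nat[of "\<lambda>y. bad y \<and> (\<forall>i<n. y i = x i)" x "\<lambda>y. m (y n)"]) auto
    then show "\<exists>y. bad y \<and> (\<forall>i<n. y i = x i) \<and>
      (\<forall>h. bad h \<and> (\<forall>i<n. h i = x i) \<longrightarrow> m (y n) \<le> m (h n))"
      by blast
  qed
  then obtain G where bad: "\<And>n. bad (G n)" and agree: "\<And>n i. i < n \<Longrightarrow> G (Suc n) i = G n i"
    and least: "\<And>n h. bad h \<Longrightarrow> (\<And>i. i < n \<Longrightarrow> h i = G n i) \<Longrightarrow> m (G (Suc n) n) \<le> m (h n)"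
    by blast
  define g where "g n = G (Suc n) n" for n
  have G_g: "G k i = g i" if "i < k" for i k
    using that
  proof (induction k)
    case (Suc k)
    then show ?case
      by (cases "i = k") (auto simp: g_def agree)
  qed simp
  have 1: "g i \<in> A" for i
    using bad by (simp add: g_def bad_def)
  have 2: "\<not> P (g i) (g j)" if "i < j" for i j
    using bad[of "Suc j"] that by (simp add: bad_def flip: G_g[of i "Suc j"] G_g[of j "Suc j"])
  have 3: "m (g n) \<le> m (h n)"
    if "\<And>i. h i \<in> A" "\<And>i j. i < j \<Longrightarrow> \<not> P (h i) (h j)" "\<And>i. i < n \<Longrightarrow> h i = g i" for n h
    unfolding g_def using that by (intro least) (auto simp: bad_def G_g)
  show ?thesis
    using 1 2 3 by (intro exI[of _ g] conjI allI impI) auto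
qed

text \<open>In a minimal bad sequence \<open>g\<close> all words are nonempty, and as the alphabet
  is finite, infinitely many begin with the same letter. Removing this letter from those words, and
  keeping \<open>g\<close> before the first of them, gives a bad sequence \<open>h\<close> that is
  shorter at that first place, against minimality.\<close>

lemma higman:
  fixes f :: "nat \<Rightarrow> 'a list"
  assumes "finite A" and "\<And>i. set (f i) \<subseteq> A"
  shows "\<exists>i j. i < j \<and> subseq (f i) (f j)"
proof (rule ccontr)
  assume "\<not> ?thesis"
  then have f: "\<forall>i. f i \<in> {xs. set xs \<subseteq> A}" "\<forall>i j. i < j \<longrightarrow> \<not> subseq (f i) (f j)"
    using assms by auto
  from minimal_bad_sequence[where m = length and P = subseq and f = f, OF f]
  obtain g :: "nat \<Rightarrow> 'a list" where g: "\<forall>i. g i \<in> {xs. set xs \<subseteq> A}" and bad': "\<forall>i j. i < j \<longrightarrow> \<not> subseq (g i) (g j)"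
    and least: "\<forall>n h. (\<forall>i. h i \<in> {xs. set xs \<subseteq> A}) \<longrightarrow> (\<forall>i j. i < j \<longrightarrow> \<not> subseq (h i) (h j)) \<longrightarrow>
       (\<forall>i<n. h i = g i) \<longrightarrow> length (g n) \<le> length (h n)"
    by (elim exE conjE)
  have bad: "\<not> subseq (g i) (g j)" if "i < j" for i j
    using bad' that by simp
  have ne: "g i \<noteq> []" for i
    using bad[of i "Suc i"] by auto
  have "(hd \<circ> g) ` UNIV \<subseteq> A"
    using g ne by (auto dest!: hd_in_set)
  then have "finite (range (hd \<circ> g))"
    using assms(1) finite_subset by blast
  then obtain i0 where "infinite {i. (hd \<circ> g) i = (hd \<circ> g) i0}"
    using pigeonhole_infinite[of UNIV "hd \<circ> g"] by auto
  then obtain a Y where Y: "infinite Y" and a: "\<And>i. i \<in> Y \<Longrightarrow> hd (g i) = a"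
    by fastforce
  define s where "s = enumerate Y"
  have s: "s i \<in> Y" for i
    using Y by (simp add: s_def enumerate_in_set)
  have s_mono: "s i < s j" if "i < j" for i j
    using Y that by (simp add: s_def)
  have s_ge: "s 0 \<le> s i" for i
    using s_mono[of 0 i] by (cases "i = 0") auto
  define h where "h i = (if i < s 0 then g i else tl (g (s (i - s 0))))" for i
  have cons: "g (s i) = a # tl (g (s i))" for i
    using ne[of "s i"] a[OF s] by (metis list.collapse)
  have "set (h i) \<subseteq> A" for i
    using g ne by (auto simp: h_def dest: list.set_sel(2)[rotated])
  moreover have "\<not> subseq (h i) (h j)" if "i < j" for i j
  proof
    assume sub: "subseq (h i) (h j)"
    consider "j < s 0" | "i < s 0" "s 0 \<le> j" | "s 0 \<le> i"
      by linarith
    then show False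
    proof cases
      case 1
      with that sub bad show False
        by (simp add: h_def)
    next
      case 2
      with sub have "subseq (g i) (tl (g (s (j - s 0))))"
        by (simp add: h_def)
      then have "subseq (g i) (g (s (j - s 0)))"
        by (subst cons) (rule list_emb_Cons)
      with bad[of i "s (j - s 0)"] s_ge[of "j - s 0"] 2 show False
        by simp
    next
      case 3
      with sub that have "subseq (tl (g (s (i - s 0)))) (tl (g (s (j - s 0))))"
        by (simp add: h_def)
      then have "subseq (a # tl (g (s (i - s 0)))) (a # tl (g (s (j - s 0))))"
        by simp
      then have "subseq (g (s (i - s 0))) (g (s (j - s 0)))"
        by (simp only: cons[symmetric])
      with bad s_mono[of "i - s 0" "j - s 0"] that 3 show False
        by (simp add: diff_less_mono)
    qed
  qed
  ultimately have "length (g (s 0)) \<le> length (h (s 0))"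
    by (intro least[rule_format]) (auto simp: h_def)
  moreover have "length (h (s 0)) < length (g (s 0))"
    using ne by (simp add: h_def)
  ultimately show False
    by simp
qed

section \<open>Marked words and pullbacks along ordered surjections\<close>

definition mark_first :: "'a list \<Rightarrow> ('a \<times> bool) list" where
  "mark_first xs = map (\<lambda>k. (xs ! k, xs ! k \<notin> set (take k xs))) [0..<length xs]"

lemma mark_first_Nil [simp]: "mark_first [] = []"
  by (simp add: mark_first_def)

lemma mark_first_snoc [simp]: "mark_first (xs @ [x]) = mark_first xs @ [(x, x \<notin> set xs)]"
  by (auto simp: mark_first_def nth_append)

lemma map_fst_mark_first [simp]: "map fst (mark_first xs) = xs"
  by (simp add: mark_first_def comp_def map_nth)

text \<open>The last clause of the first conjunct says that the first occurrences of
  \<open>0, 1, \<dots>\<close> in the sequence \<open>p\<close> appear in increasing order; this makes \<open>X \<mapsto> X \<circ> p\<close> strictly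
  monotone for the lexicographic order.\<close>

definition pullback_on :: "nat \<Rightarrow> nat \<Rightarrow> nat \<Rightarrow> (nat \<Rightarrow> nat) \<Rightarrow> bool" where
  "pullback_on n l m p \<longleftrightarrow>
     (\<forall>k<m. p k < l \<and> (\<forall>i<p k. \<exists>k'<k. p k' = i)) \<and>
     (\<forall>j<l. (\<exists>k<m. p k = j) \<and> card {k. k < m \<and> p k = j} mod n = 1 mod n)"

text \<open>Induction removes the last letter \<open>y\<close> of \<open>Y\<close>. If the embedding
  skips \<open>y\<close>, then \<open>y\<close> goes to its first occurrence in \<open>X\<close>, a
  position that is already hit. If the embedding uses \<open>y\<close>, then \<open>y\<close> goes
  to the last position of \<open>X\<close>, and equality of the marks says that \<open>y\<close> is
  new in \<open>X\<close> exactly when it is new in \<open>Y\<close>, so the remaining words again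
  have the same set of letters. Hence only first occurrences can have fibres of more than one point,
  and the excess is the difference of the letter counts; the equation has counts on both sides to
  avoid subtraction of natural numbers.\<close>

lemma subseq_mark_first_pullback:
  assumes "subseq (mark_first X) (mark_first Y)" and "set X = set Y"
  shows "\<exists>p. (\<forall>k<length Y. p k < length X \<and> Y ! k = X ! p k \<and> (\<forall>i<p k. \<exists>k'<k. p k' = i)) \<and>
      (\<forall>j<length X. (\<exists>k<length Y. p k = j) \<and>
         card {k. k < length Y \<and> p k = j} + (if X ! j \<notin> set (take j X) then count_list X (X ! j) else 0)
         = 1 + (if X ! j \<notin> set (take j X) then count_list Y (X ! j) else 0))"
  using assms
proof (induction Y arbitrary: X rule: rev_induct)
  case Nil
  then show ?case by auto
next
  case (snoc y ys)
  let ?m = "length ys"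
  have ext: "{k. k < Suc ?m \<and> (p(?m := l)) k = j} = {k. k < ?m \<and> p k = j} \<union> (if j = l then {?m} else {})"
    for p :: "nat \<Rightarrow> nat" and l j
    by (auto simp: less_Suc_eq)
  have card_ext: "card {k. k < Suc ?m \<and> (p(?m := l)) k = j} =
      card {k. k < ?m \<and> p k = j} + (if j = l then 1 else 0)" for p :: "nat \<Rightarrow> nat" and l j
    unfolding ext by simp
  from snoc.prems(1) obtain us vs where uv: "mark_first X = us @ vs" "subseq us (mark_first ys)"
    "subseq vs [(y, y \<notin> set ys)]"
    by (auto simp: subseq_append_iff)
  from uv(3) have "vs = [] \<or> vs = [(y, y \<notin> set ys)]"
    by (cases vs) (auto split: if_splits)
  then show ?case
  proof
    assume "vs = []"
    with uv have sub: "subseq (mark_first X) (mark_first ys)"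
      by simp
    then have "subseq X ys"
      by (metis map_fst_mark_first subseq_map)
    then have "set X \<subseteq> set ys"
      by (auto elim: list_emb_set)
    with snoc.prems(2) have y: "y \<in> set X" and eq: "set X = set ys"
      by auto
    obtain p where p: "\<And>k. k < ?m \<Longrightarrow> p k < length X \<and> ys ! k = X ! p k \<and> (\<forall>i<p k. \<exists>k'<k. p k' = i)"
      and fib: "\<And>j. j < length X \<Longrightarrow> (\<exists>k<?m. p k = j) \<and>
         card {k. k < ?m \<and> p k = j} + (if X ! j \<notin> set (take j X) then count_list X (X ! j) else 0)
         = 1 + (if X ! j \<notin> set (take j X) then count_list ys (X ! j) else 0)"
      using snoc.IH[OF sub eq] by blast
    obtain us' vs' where X: "X = us' @ y # vs'" "y \<notin> set us'"
      using y by (meson split_list_first)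
    define l where "l = length us'"
    have l: "l < length X" "X ! l = y" "X ! l \<notin> set (take l X)"
      by (auto simp: X l_def)
    \<comment> \<open>Since \<open>l\<close> is the only first occurrence of \<open>y\<close> in
      \<open>X\<close>, the new point of the fibre and the new occurrence of \<open>y\<close> in the
      count enter the same equation and no other.\<close>
    have uniq: "j = l" if "j < length X" "X ! j = y" "X ! j \<notin> set (take j X)" for j
    proof (rule ccontr)
      assume "j \<noteq> l"
      then consider "j < l" | "l < j" by linarith
      then show False
      proof cases
        case 1
        then have "X ! j \<in> set us'"
          by (auto simp: X l_def nth_append)
        with that X show False by simp
      next
        case 2
        then have "X ! l \<in> set (take j X)"
          using that(1) l(1) by (auto simp: in_set_conv_nth intro!: exI[of _ l])
        with that l show False by simp
      qed
    qed
    show ?thesis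
    proof (intro exI[of _ "p(?m := l)"] conjI allI impI)
      fix k assume k: "k < length (ys @ [y])"
      show "(p(?m := l)) k < length X" "(ys @ [y]) ! k = X ! (p(?m := l)) k"
        using k p l by (auto simp: less_Suc_eq nth_append)
      fix i assume i: "i < (p(?m := l)) k"
      show "\<exists>k'<k. (p(?m := l)) k' = i"
      proof (cases "k = ?m")
        case True
        with i l have "i < length X" by simp
        with fib True show ?thesis by fastforce
      next
        case False
        with k have "k < ?m" by simp
        with p i False obtain k' where "k' < k" "p k' = i" by auto
        with \<open>k < ?m\<close> show ?thesis by (intro exI[of _ k']) auto
      qed
    next
      fix j assume j: "j < length X"
      with fib obtain k where "k < ?m" "p k = j" by blast
      then show "\<exists>k<length (ys @ [y]). (p(?m := l)) k = j"
        by (intro exI[of _ k]) auto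
      show "card {k. k < length (ys @ [y]) \<and> (p(?m := l)) k = j} +
          (if X ! j \<notin> set (take j X) then count_list X (X ! j) else 0)
         = 1 + (if X ! j \<notin> set (take j X) then count_list (ys @ [y]) (X ! j) else 0)"
      proof (cases "j = l")
        case True
        then show ?thesis
          using fib[OF j] card_ext[of p l l] l by simp
      next
        case False
        then have "X ! j \<noteq> y \<or> X ! j \<in> set (take j X)"
          using uniq[OF j] by blast
        then show ?thesis
          using fib[OF j] card_ext[of p l j] False by auto
      qed
    qed
  next
    assume vs: "vs = [(y, y \<notin> set ys)]"
    then have "X \<noteq> []"
      using uv by auto
    then obtain xs x where X: "X = xs @ [x]"
      by (metis rev_exhaust)
    with uv vs have xy: "x = y" "us = mark_first xs" "(y \<notin> set xs) = (y \<notin> set ys)"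
      by auto
    then have sub: "subseq (mark_first xs) (mark_first ys)"
      using uv by simp
    have eq: "set xs = set ys"
      using snoc.prems(2) xy X by auto
    let ?l = "length xs"
    obtain p where p: "\<And>k. k < ?m \<Longrightarrow> p k < ?l \<and> ys ! k = xs ! p k \<and> (\<forall>i<p k. \<exists>k'<k. p k' = i)"
      and fib: "\<And>j. j < ?l \<Longrightarrow> (\<exists>k<?m. p k = j) \<and>
         card {k. k < ?m \<and> p k = j} + (if xs ! j \<notin> set (take j xs) then count_list xs (xs ! j) else 0)
         = 1 + (if xs ! j \<notin> set (take j xs) then count_list ys (xs ! j) else 0)"
      using snoc.IH[OF sub eq] by blast
    show ?thesis
    proof (intro exI[of _ "p(?m := ?l)"] conjI allI impI)
      fix k assume k: "k < length (ys @ [y])"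
      show "(p(?m := ?l)) k < length X" "(ys @ [y]) ! k = X ! (p(?m := ?l)) k"
        using k p by (auto simp: less_Suc_eq nth_append X xy)
      fix i assume i: "i < (p(?m := ?l)) k"
      show "\<exists>k'<k. (p(?m := ?l)) k' = i"
      proof (cases "k = ?m")
        case True
        with i have "i < ?l" by simp
        with fib True show ?thesis by fastforce
      next
        case False
        with k have "k < ?m" by simp
        with p i False obtain k' where "k' < k" "p k' = i" by auto
        with \<open>k < ?m\<close> show ?thesis by (intro exI[of _ k']) auto
      qed
    next
      fix j assume j: "j < length X"
      show "\<exists>k<length (ys @ [y]). (p(?m := ?l)) k = j"
      proof (cases "j = ?l")
        case False
        with j X have "j < ?l" by simp
        with fib obtain k where "k < ?m" "p k = j" by blast
        then show ?thesis
          by (intro exI[of _ k]) auto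
      qed (auto intro!: exI[of _ ?m])
      show "card {k. k < length (ys @ [y]) \<and> (p(?m := ?l)) k = j} +
          (if X ! j \<notin> set (take j X) then count_list X (X ! j) else 0)
         = 1 + (if X ! j \<notin> set (take j X) then count_list (ys @ [y]) (X ! j) else 0)"
      proof (cases "j = ?l")
        case True
        have none: "{k. k < ?m \<and> p k = ?l} = {}"
          using p by fastforce
        have "count_list xs y = 0 \<and> count_list ys y = 0" if "y \<notin> set xs"
          using that xy by simp
        then show ?thesis
          using card_ext[of p ?l ?l] xy unfolding none True X by auto
      next
        case False
        with j X have j': "j < ?l" by simp
        then show ?thesis
          using fib[OF j'] card_ext[of p ?l j] False xy unfolding X by (auto simp: nth_append)
      qed
    qed
  qed
qed

text \<open>Infinitely many words agree in their sets of letters and in all letter counts modulo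
  \<open>n\<close>, and Higman's lemma is applied to the marked versions of these. Agreement of the
  counts makes the excess of a fibre over a first occurrence a multiple of \<open>n\<close>.\<close>

lemma higman_pullback:
  fixes f :: "nat \<Rightarrow> 'a list"
  assumes "finite A" and "\<And>i. set (f i) \<subseteq> A" and "0 < n"
  shows "\<exists>i j p. i < j \<and> pullback_on n (length (f i)) (length (f j)) p \<and>
    f j = map (\<lambda>k. f i ! p k) [0..<length (f j)]"
proof -
  define cls where "cls xs = (\<lambda>a\<in>A. (count_list xs a mod n, a \<in> set xs))" for xs :: "'a list"
  have "cls (f i) \<in> A \<rightarrow>\<^sub>E {..<n} \<times> UNIV" for i
    using assms(3) by (auto simp: cls_def)
  then have "finite (range (cls \<circ> f))"
    using assms(1) by (intro finite_subset[OF _ finite_PiE[of A "\<lambda>_. {..<n} \<times> (UNIV :: bool set)"]]) auto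
  then obtain i0 where "infinite {i. (cls \<circ> f) i = (cls \<circ> f) i0}"
    using pigeonhole_infinite[of UNIV "cls \<circ> f"] by auto
  then obtain c Y where Y: "infinite Y" and c: "\<And>i. i \<in> Y \<Longrightarrow> cls (f i) = c"
    by fastforce
  define s where "s = enumerate Y"
  have s: "s i \<in> Y" for i
    using Y by (simp add: s_def enumerate_in_set)
  have s_mono: "s i < s j" if "i < j" for i j
    using Y that by (simp add: s_def)
  have "set (mark_first xs) \<subseteq> A \<times> UNIV" if "set xs \<subseteq> A" for xs :: "'a list"
    using that by (auto simp: mark_first_def)
  then obtain i j where ij: "i < j" "subseq (mark_first (f (s i))) (mark_first (f (s j)))"
    using higman[of "A \<times> (UNIV :: bool set)" "\<lambda>i. mark_first (f (s i))"] assms by auto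
  let ?X = "f (s i)" and ?Y = "f (s j)"
  have cl: "cls ?X = cls ?Y"
    by (simp add: c s)
  then have same: "count_list ?X a mod n = count_list ?Y a mod n \<and> (a \<in> set ?X \<longleftrightarrow> a \<in> set ?Y)"
    if "a \<in> A" for a
  proof -
    have "cls ?X a = cls ?Y a"
      by (simp only: cl)
    with that show ?thesis
      by (simp add: cls_def)
  qed
  have "set ?X = set ?Y"
    using same assms(2) by blast
  from subseq_mark_first_pullback[OF ij(2) this] obtain p
    where p: "\<And>k. k < length ?Y \<Longrightarrow> p k < length ?X \<and> ?Y ! k = ?X ! p k \<and> (\<forall>i<p k. \<exists>k'<k. p k' = i)"
      and fib: "\<And>l. l < length ?X \<Longrightarrow> (\<exists>k<length ?Y. p k = l) \<and>
         card {k. k < length ?Y \<and> p k = l} + (if ?X ! l \<notin> set (take l ?X) then count_list ?X (?X ! l) else 0)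
         = 1 + (if ?X ! l \<notin> set (take l ?X) then count_list ?Y (?X ! l) else 0)"
    by blast
  have "card {k. k < length ?Y \<and> p k = l} mod n = 1 mod n" if "l < length ?X" for l
  proof (cases "?X ! l \<notin> set (take l ?X)")
    case True
    have "?X ! l \<in> A"
      using that assms(2) by (meson nth_mem subsetD)
    then have "int (count_list ?Y (?X ! l)) mod int n = int (count_list ?X (?X ! l)) mod int n"
      using same by (metis of_nat_mod)
    then have "int n dvd int (count_list ?Y (?X ! l)) - int (count_list ?X (?X ! l))"
      by (simp only: mod_eq_dvd_iff)
    moreover have "int (card {k. k < length ?Y \<and> p k = l}) - 1 =
        int (count_list ?Y (?X ! l)) - int (count_list ?X (?X ! l))"
      using fib[OF that] True by simp
    ultimately have "int (card {k. k < length ?Y \<and> p k = l}) mod int n = int 1 mod int n"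
      by (simp add: mod_eq_dvd_iff)
    then show ?thesis
      by (metis of_nat_eq_iff of_nat_mod)
  next
    case False
    then show ?thesis
      using fib[OF that] by simp
  qed
  then have "pullback_on n (length ?X) (length ?Y) p"
    unfolding pullback_on_def using p fib by blast
  moreover have "?Y = map (\<lambda>k. ?X ! p k) [0..<length ?Y]"
    using p by (intro nth_equalityI) auto
  ultimately show ?thesis
    using s_mono[OF ij(1)] by blast
qed

text \<open>Let \<open>i\<close> be the first position where \<open>u\<close> and \<open>v\<close>
  differ and \<open>k\<close> the first place with \<open>p k = i\<close>. Before \<open>k\<close>
  only positions below \<open>i\<close> are hit, because a larger value would require that
  \<open>i\<close> had occurred earlier. So the pulled back words first differ at \<open>k\<close>,
  in the same direction.\<close>

lemma pullback_strict_mono: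
  fixes u v :: "nat list"
  assumes p: "pullback_on n l m p" and uv: "length u = l" "length v = l" "u < v"
  shows "map (\<lambda>k. u ! p k) [0..<m] < map (\<lambda>k. v ! p k) [0..<m]"
proof -
  obtain i where i: "i < l" "take i u = take i v" "u ! i < v ! i"
    using uv by (auto simp: list_less_def lexord_take_index_conv)
  have eq: "u ! j = v ! j" if "j < i" for j
    using i(2) that by (metis nth_take)
  define k where "k = (LEAST k. k < m \<and> p k = i)"
  have "\<exists>k<m. p k = i"
    using p i(1) by (auto simp: pullback_on_def)
  then have k: "k < m \<and> p k = i"
    unfolding k_def by (rule LeastI_ex)
  have small: "p k' < i" if "k' < k" for k'
  proof (rule ccontr)
    assume "\<not> p k' < i"
    moreover have "p k' \<noteq> i"
      using not_less_Least[of k' "\<lambda>k. k < m \<and> p k = i"] that k unfolding k_def by auto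
    ultimately have "i < p k'" by simp
    moreover have "\<forall>i<p k'. \<exists>k''<k'. p k'' = i"
      using p that k by (simp add: pullback_on_def)
    ultimately obtain k'' where "k'' < k'" "p k'' = i"
      by blast
    then show False
      using not_less_Least[of k'' "\<lambda>k. k < m \<and> p k = i"] that k unfolding k_def by auto
  qed
  have "take k (map (\<lambda>k. u ! p k) [0..<m]) = take k (map (\<lambda>k. v ! p k) [0..<m])"
    using k by (auto simp: take_map small eq)
  with k i(3) show ?thesis
    unfolding list_less_def lexord_take_index_conv by (auto intro!: exI[of _ k])
qed

section \<open>Leading coefficients over a left Noetherian ring\<close>

context left_module
begin

lemma smult_l_null: "x \<in> carrier M \<Longrightarrow> \<zero> \<odot>\<^bsub>M\<^esub> x = \<zero>\<^bsub>M\<^esub>"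
  by (metis K.zero_closed K.r_zero M.add.r_cancel_one' smult_closed smult_l_distr)

lemma smult_r_null: "a \<in> carrier K \<Longrightarrow> a \<odot>\<^bsub>M\<^esub> \<zero>\<^bsub>M\<^esub> = \<zero>\<^bsub>M\<^esub>"
  by (metis M.zero_closed M.r_zero M.add.r_cancel_one' smult_closed smult_r_distr)

lemma smult_minus_one: "x \<in> carrier M \<Longrightarrow> (\<ominus> \<one>) \<odot>\<^bsub>M\<^esub> x = \<ominus>\<^bsub>M\<^esub> x"
  by (metis K.add.inv_closed K.l_neg K.one_closed M.minus_equality smult_closed smult_l_distr
      smult_l_null smult_one)

lemma submoduleI:
  assumes "H \<subseteq> carrier M" and "\<zero>\<^bsub>M\<^esub> \<in> H"
    and "\<And>x y. \<lbrakk>x \<in> H; y \<in> H\<rbrakk> \<Longrightarrow> x \<oplus>\<^bsub>M\<^esub> y \<in> H"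
    and "\<And>a x. \<lbrakk>a \<in> carrier K; x \<in> H\<rbrakk> \<Longrightarrow> a \<odot>\<^bsub>M\<^esub> x \<in> H"
  shows "submodule H K M"
proof -
  have "\<ominus>\<^bsub>M\<^esub> x \<in> H" if "x \<in> H" for x
    using that assms(1) assms(4)[of "\<ominus> \<one>" x] smult_minus_one[of x] by auto
  then have "inv\<^bsub>add_monoid M\<^esub> x \<in> H" if "x \<in> H" for x
    using that by (simp add: a_inv_def)
  then show ?thesis
    using assms by (intro submodule.intro subgroup.intro submodule_axioms.intro) auto
qed

end

lemma submoduleD:
  assumes "submodule H K M"
  shows "H \<subseteq> carrier M" "\<zero>\<^bsub>M\<^esub> \<in> H"
    "\<And>x y. \<lbrakk>x \<in> H; y \<in> H\<rbrakk> \<Longrightarrow> x \<oplus>\<^bsub>M\<^esub> y \<in> H"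
    "\<And>a x. \<lbrakk>a \<in> carrier K; x \<in> H\<rbrakk> \<Longrightarrow> a \<odot>\<^bsub>M\<^esub> x \<in> H"
    "\<And>x. x \<in> H \<Longrightarrow> \<ominus>\<^bsub>M\<^esub> x \<in> H"
  using assms unfolding submodule_def submodule_axioms_def subgroup_def
  by (auto simp: a_inv_def)

definition mspan :: "('k, 's) ring_scheme \<Rightarrow> ('k, 'm, 't) module_scheme \<Rightarrow> 'm set \<Rightarrow> 'm set" where
  "mspan K M S = carrier M \<inter> \<Inter>{H. submodule H K M \<and> S \<subseteq> H}"

lemma mspan_superset: "S \<subseteq> carrier M \<Longrightarrow> S \<subseteq> mspan K M S"
  by (auto simp: mspan_def)

lemma mspan_minimal: "\<lbrakk>submodule H K M; S \<subseteq> H\<rbrakk> \<Longrightarrow> mspan K M S \<subseteq> H"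
  by (auto simp: mspan_def)

lemma (in left_module) mspan_submodule: "submodule (mspan K M S) K M"
  by (rule submoduleI)
    (auto simp: mspan_def submoduleD smult_closed dest: submoduleD(3,4))

lemma (in left_module) mspan_insertE:
  assumes "x \<in> mspan K M (insert e S)" "e \<in> carrier M" "S \<subseteq> carrier M"
  obtains a y where "a \<in> carrier K" "y \<in> mspan K M S" "x = a \<odot>\<^bsub>M\<^esub> e \<oplus>\<^bsub>M\<^esub> y"
proof -
  let ?U = "mspan K M S"
  note U = submoduleD[OF mspan_submodule[of S]]
  define H where "H = {a \<odot>\<^bsub>M\<^esub> e \<oplus>\<^bsub>M\<^esub> y | a y. a \<in> carrier K \<and> y \<in> ?U}"
  have "submodule H K M"
  proof (rule submoduleI)
    show "H \<subseteq> carrier M"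
      using U(1) assms(2) by (auto simp: H_def smult_closed)
    have "\<zero>\<^bsub>M\<^esub> = \<zero> \<odot>\<^bsub>M\<^esub> e \<oplus>\<^bsub>M\<^esub> \<zero>\<^bsub>M\<^esub>"
      using assms(2) by (simp add: smult_l_null)
    then show "\<zero>\<^bsub>M\<^esub> \<in> H"
      using U(2) by (auto simp: H_def)
  next
    fix x y assume "x \<in> H" "y \<in> H"
    then obtain a u b v where *: "a \<in> carrier K" "u \<in> ?U" "x = a \<odot>\<^bsub>M\<^esub> e \<oplus>\<^bsub>M\<^esub> u"
      "b \<in> carrier K" "v \<in> ?U" "y = b \<odot>\<^bsub>M\<^esub> e \<oplus>\<^bsub>M\<^esub> v"
      by (auto simp: H_def)
    then have c: "u \<in> carrier M" "v \<in> carrier M" "a \<odot>\<^bsub>M\<^esub> e \<in> carrier M" "b \<odot>\<^bsub>M\<^esub> e \<in> carrier M"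
      using U(1) assms(2) by (auto simp: smult_closed)
    have "x \<oplus>\<^bsub>M\<^esub> y = (a \<oplus> b) \<odot>\<^bsub>M\<^esub> e \<oplus>\<^bsub>M\<^esub> (u \<oplus>\<^bsub>M\<^esub> v)"
      using * c assms(2) by (simp add: smult_l_distr M.a_ac)
    then show "x \<oplus>\<^bsub>M\<^esub> y \<in> H"
      using * U(3) by (auto simp: H_def)
  next
    fix c x assume c: "c \<in> carrier K" and "x \<in> H"
    then obtain a u where *: "a \<in> carrier K" "u \<in> ?U" "x = a \<odot>\<^bsub>M\<^esub> e \<oplus>\<^bsub>M\<^esub> u"
      by (auto simp: H_def)
    then have "c \<odot>\<^bsub>M\<^esub> x = (c \<otimes> a) \<odot>\<^bsub>M\<^esub> e \<oplus>\<^bsub>M\<^esub> c \<odot>\<^bsub>M\<^esub> u"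
      using c U(1) assms(2) by (auto simp: smult_r_distr smult_assoc smult_closed subset_iff)
    then show "c \<odot>\<^bsub>M\<^esub> x \<in> H"
      using * c U(4) by (auto simp: H_def)
  qed
  moreover have "insert e S \<subseteq> H"
  proof -
    have "e = \<one> \<odot>\<^bsub>M\<^esub> e \<oplus>\<^bsub>M\<^esub> \<zero>\<^bsub>M\<^esub>"
      using assms(2) by (simp add: smult_one)
    then have "e \<in> H"
      using U(2) by (auto simp: H_def)
    moreover have "s \<in> H" if "s \<in> S" for s
    proof -
      have "s = \<zero> \<odot>\<^bsub>M\<^esub> e \<oplus>\<^bsub>M\<^esub> s"
        using assms that by (auto simp: smult_l_null)
      moreover have "s \<in> ?U"
        using mspan_superset[OF assms(3)] that by blast
      ultimately show ?thesis
        by (auto simp: H_def)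
    qed
    ultimately show ?thesis by blast
  qed
  ultimately have "x \<in> H"
    using mspan_minimal assms(1) by blast
  then show thesis
    using that by (auto simp: H_def)
qed

lemma (in ring) left_idealI:
  assumes "I \<subseteq> carrier R" "\<zero> \<in> I" "\<And>x y. \<lbrakk>x \<in> I; y \<in> I\<rbrakk> \<Longrightarrow> x \<oplus> y \<in> I"
    and "\<And>a x. \<lbrakk>a \<in> carrier R; x \<in> I\<rbrakk> \<Longrightarrow> a \<otimes> x \<in> I"
  shows "left_ideal I R"
proof -
  have "\<ominus> x \<in> I" if "x \<in> I" for x
  proof -
    have "\<ominus> x = (\<ominus> \<one>) \<otimes> x"
      using that assms(1) by (auto simp: l_minus)
    then show ?thesis
      using assms(4) that by auto
  qed
  then have "inv\<^bsub>add_monoid R\<^esub> x \<in> I" if "x \<in> I" for x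
    using that by (simp add: a_inv_def)
  then show ?thesis
    using assms unfolding left_ideal_def
    by (auto intro!: additive_subgroup.intro subgroup.intro)
qed

lemma left_idealD:
  assumes "left_ideal I K"
  shows "I \<subseteq> carrier K" "\<zero>\<^bsub>K\<^esub> \<in> I" "\<And>x y. \<lbrakk>x \<in> I; y \<in> I\<rbrakk> \<Longrightarrow> x \<oplus>\<^bsub>K\<^esub> y \<in> I"
    "\<And>a x. \<lbrakk>a \<in> carrier K; x \<in> I\<rbrakk> \<Longrightarrow> a \<otimes>\<^bsub>K\<^esub> x \<in> I"
  using assms unfolding left_ideal_def additive_subgroup_def subgroup_def by auto

text \<open>Finitely many generators of the union already lie in one member of the chain. The chain
  is indexed by an infinite set of naturals because Ramsey's theorem supplies it in this
  form.\<close>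

lemma (in left_noetherian_ring) ascending_left_ideals:
  fixes I :: "nat \<Rightarrow> 'a set"
  assumes "infinite Y" and "\<And>i. i \<in> Y \<Longrightarrow> left_ideal (I i) K"
    and "\<And>i j. \<lbrakk>i \<in> Y; j \<in> Y; i < j\<rbrakk> \<Longrightarrow> I i \<subseteq> I j"
  shows "\<exists>i\<in>Y. \<exists>j\<in>Y. i < j \<and> I i = I j"
proof -
  define s where "s = enumerate Y"
  have s: "s i \<in> Y" for i
    using assms(1) by (simp add: s_def enumerate_in_set)
  have s_mono: "s i < s j" if "i < j" for i j
    using assms(1) that by (simp add: s_def)
  have mono: "I (s i) \<subseteq> I (s j)" if "i \<le> j" for i j
    using assms(3)[OF s s s_mono] that by (cases "i = j") auto
  note ideal = assms(2)[OF s]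
  define U where "U = (\<Union>i. I (s i))"
  have "left_ideal U K"
  proof (rule left_idealI)
    show "U \<subseteq> carrier K" "\<zero> \<in> U"
      using left_idealD(1,2)[OF ideal] by (auto simp: U_def)
    show "a \<otimes> x \<in> U" if "a \<in> carrier K" "x \<in> U" for a x
      using left_idealD(4)[OF ideal] that by (auto simp: U_def)
    fix x y assume "x \<in> U" "y \<in> U"
    then obtain i j where "x \<in> I (s i)" "y \<in> I (s j)"
      by (auto simp: U_def)
    then have "x \<in> I (s (max i j))" "y \<in> I (s (max i j))"
      using mono[of i "max i j"] mono[of j "max i j"] by auto
    then show "x \<oplus> y \<in> U"
      using left_idealD(3)[OF ideal] by (auto simp: U_def)
  qed
  then obtain A where A: "finite A" "A \<subseteq> U" "\<And>J. left_ideal J K \<Longrightarrow> A \<subseteq> J \<Longrightarrow> U \<subseteq> J"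
    using left_ideal_finitely_generated by metis
  have "\<exists>n. A \<subseteq> I (s n)"
    using A(1,2)
  proof (induction A rule: finite_induct)
    case (insert x F)
    then obtain n m where "F \<subseteq> I (s n)" "x \<in> I (s m)"
      by (auto simp: U_def)
    then have "insert x F \<subseteq> I (s (max n m))"
      using mono[of n "max n m"] mono[of m "max n m"] by auto
    then show ?case by blast
  qed simp
  then obtain n where "U \<subseteq> I (s n)"
    using A(3)[OF ideal] by blast
  then have "I (s n) = I (s (Suc n))"
    using mono[of n "Suc n"] by (auto simp: U_def)
  then show ?thesis
    using s s_mono[of n "Suc n"] by blast
qed

text \<open>Otherwise elements can be chosen one after the other, each not covered by its
  predecessors. Ramsey's theorem, used in place of transitivity of \<open>P\<close>, gives
  infinitely many indices that are pairwise related; along these the left ideals ascend, so two of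
  them coincide, and the later element was covered after all.\<close>

lemma (in left_noetherian_ring) finite_basis:
  fixes I :: "'z \<Rightarrow> 'a set"
  assumes ideal: "\<And>z. z \<in> Z \<Longrightarrow> left_ideal (I z) K"
    and good: "\<And>g :: nat \<Rightarrow> 'z. range g \<subseteq> Z \<Longrightarrow> \<exists>i j. i < j \<and> P (g i) (g j)"
    and mono: "\<And>z z'. \<lbrakk>z \<in> Z; z' \<in> Z; P z z'\<rbrakk> \<Longrightarrow> I z \<subseteq> I z'"
  shows "\<exists>F. finite F \<and> F \<subseteq> Z \<and> (\<forall>z\<in>Z. \<exists>z'\<in>F. P z' z \<and> I z' = I z)"
proof (rule ccontr)
  assume no: "\<not> ?thesis"
  define bad where "bad F z \<longleftrightarrow> z \<in> Z \<and> (\<forall>z'\<in>F. \<not> (P z' z \<and> I z' = I z))" for F z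
  have ex: "\<exists>z. bad F z" if "finite F" "F \<subseteq> Z" for F
  proof (rule ccontr)
    assume "\<not> ?thesis"
    then have "\<forall>z\<in>Z. \<exists>z'\<in>F. P z' z \<and> I z' = I z"
      by (auto simp: bad_def)
    with no that show False
      by metis
  qed
  define nx where "nx F = (SOME z. bad F z)" for F
  have nx: "bad F (nx F)" if "finite F" "F \<subseteq> Z" for F
    using ex[OF that] unfolding nx_def by (rule someI_ex)
  \<comment> \<open>\<open>S n\<close> is the set of the first \<open>n\<close> choices, so that
    \<open>g n\<close> is uncovered by all earlier values of \<open>g\<close>.\<close>
  define S where "S n = rec_nat {} (\<lambda>_ F. insert (nx F) F) n" for n :: nat
  have S_simps: "S 0 = {}" "S (Suc n) = insert (nx (S n)) (S n)" for n
    by (simp_all add: S_def)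
  have S: "finite (S n) \<and> S n \<subseteq> Z" for n
  proof (induction n)
    case (Suc n)
    then show ?case
      using nx[of "S n"] by (simp add: S_simps bad_def)
  qed (simp add: S_simps)
  define g where "g n = nx (S n)" for n
  have bad: "bad (S n) (g n)" for n
    using nx S by (simp add: g_def)
  have mem: "g i \<in> S j" if "i < j" for i j
    using that by (induction j) (auto simp: S_simps g_def less_Suc_eq)
  have gZ: "range g \<subseteq> Z"
    using bad by (auto simp: bad_def)
  have "\<exists>Y. infinite Y \<and> (\<forall>i\<in>Y. \<forall>j\<in>Y. i < j \<longrightarrow> P (g i) (g j))"
    by (rule infinite_chain_of_good[of Z]) (rule good, assumption, rule gZ)
  then obtain Y where Y: "infinite Y" and PY: "\<And>i j. \<lbrakk>i \<in> Y; j \<in> Y; i < j\<rbrakk> \<Longrightarrow> P (g i) (g j)"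
    by blast
  have "\<exists>i\<in>Y. \<exists>j\<in>Y. i < j \<and> I (g i) = I (g j)"
  proof (rule ascending_left_ideals)
    show "left_ideal (I (g i)) K" for i
      using gZ by (intro ideal) auto
    show "I (g i) \<subseteq> I (g j)" if "i \<in> Y" "j \<in> Y" "i < j" for i j
      using gZ PY[OF that] by (intro mono) auto
  qed (rule Y)
  then obtain i j where "i \<in> Y" "j \<in> Y" "i < j" "I (g i) = I (g j)"
    by blast
  then show False
    using bad[of j] mem[of i j] PY[of i j] by (auto simp: bad_def)
qed

section \<open>Linear maps, spans and Groebner bases\<close>

lemma linear_mapsD:
  assumes "f \<in> linear_maps K V W"
  shows "\<And>v. v \<in> carrier V \<Longrightarrow> f v \<in> carrier W"
    "\<And>v w. \<lbrakk>v \<in> carrier V; w \<in> carrier V\<rbrakk> \<Longrightarrow> f (v \<oplus>\<^bsub>V\<^esub> w) = f v \<oplus>\<^bsub>W\<^esub> f w"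
    "\<And>a v. \<lbrakk>a \<in> carrier K; v \<in> carrier V\<rbrakk> \<Longrightarrow> f (a \<odot>\<^bsub>V\<^esub> v) = a \<odot>\<^bsub>W\<^esub> f v"
    "f \<in> extensional (carrier V)"
  using assms by (auto simp: linear_maps_def PiE_iff)

lemma linear_map_zero:
  assumes "left_module K V" "left_module K W" "f \<in> linear_maps K V W"
  shows "f \<zero>\<^bsub>V\<^esub> = \<zero>\<^bsub>W\<^esub>"
proof -
  interpret V: left_module K V by fact
  interpret W: left_module K W by fact
  show ?thesis
    using linear_mapsD(3)[OF assms(3) V.K.zero_closed V.M.zero_closed]
      linear_mapsD(1)[OF assms(3) V.M.zero_closed]
    by (simp add: V.smult_l_null W.smult_l_null)
qed

lemma linear_map_vimage_submodule:
  assumes "left_module K V" "left_module K W" "f \<in> linear_maps K V W" "submodule H K W"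
  shows "submodule {v \<in> carrier V. f v \<in> H} K V"
proof -
  interpret V: left_module K V by fact
  show ?thesis
    using linear_mapsD[OF assms(3)] submoduleD[OF assms(4)] linear_map_zero[OF assms(1-3)]
    by (intro V.submoduleI) (auto simp: V.smult_closed)
qed

lemma linear_map_mspan:
  assumes "left_module K V" "left_module K W" "f \<in> linear_maps K V W"
    and "S \<subseteq> carrier V" "f ` S \<subseteq> mspan K W S'" "v \<in> mspan K V S"
  shows "f v \<in> mspan K W S'"
proof -
  have "mspan K V S \<subseteq> {v \<in> carrier V. f v \<in> mspan K W S'}"
    using assms by (intro mspan_minimal linear_map_vimage_submodule[OF assms(1-3)]
        left_module.mspan_submodule) auto
  with assms(6) show ?thesis by blast
qed

text \<open>A Groebner basis argument: a submodule \<open>Q\<close> of a family of modules is determined by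
  its left ideals of leading coefficients, which are finitely many up to divisibility.\<close>

lemma (in left_noetherian_ring) finite_groebner_basis:
  fixes Md :: "'z \<Rightarrow> ('a, 'm) module" and T :: "'z \<Rightarrow> 't set" and key :: "'z \<Rightarrow> 't \<Rightarrow> 'w :: linorder"
    and e :: "'z \<Rightarrow> 't \<Rightarrow> 'm" and Q :: "'z \<Rightarrow> 'm set" and H :: "'z \<Rightarrow> 'z \<Rightarrow> ('m \<Rightarrow> 'm) set"
  assumes Md: "\<And>a. a \<in> Ob \<Longrightarrow> left_module K (Md a)"
    and finT: "\<And>a. a \<in> Ob \<Longrightarrow> finite (T a)"
    and inj: "\<And>a. a \<in> Ob \<Longrightarrow> inj_on (key a) (T a)"
    and e: "\<And>a t. \<lbrakk>a \<in> Ob; t \<in> T a\<rbrakk> \<Longrightarrow> e a t \<in> carrier (Md a)"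
    and gen: "\<And>a. a \<in> Ob \<Longrightarrow> carrier (Md a) \<subseteq> mspan K (Md a) (e a ` T a)"
    and Q: "\<And>a. a \<in> Ob \<Longrightarrow> submodule (Q a) K (Md a)"
    and good: "\<And>g :: nat \<Rightarrow> 'z \<times> 't. range g \<subseteq> Sigma Ob T \<Longrightarrow> \<exists>i j. i < j \<and> P (g i) (g j)"
    and transfer: "\<And>a t a' t'. \<lbrakk>a \<in> Ob; t \<in> T a; a' \<in> Ob; t' \<in> T a'; P (a, t) (a', t')\<rbrakk> \<Longrightarrow>
      \<exists>h\<in>H a a'. h \<in> linear_maps K (Md a) (Md a') \<and> h ` Q a \<subseteq> Q a' \<and> h (e a t) = e a' t' \<and>
        (\<forall>s\<in>T a. key a s < key a t \<longrightarrow> (\<exists>s'\<in>T a'. key a' s' < key a' t' \<and> h (e a s) = e a' s'))"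
  shows "\<exists>G. finite G \<and> (\<forall>(a, q)\<in>G. a \<in> Ob \<and> q \<in> Q a) \<and>
    (\<forall>a'\<in>Ob. \<forall>D. submodule D K (Md a') \<longrightarrow> (\<forall>(a, q)\<in>G. \<forall>h\<in>H a a'. h q \<in> D) \<longrightarrow> Q a' \<subseteq> D)"
proof -
  define low where "low a t = mspan K (Md a) (e a ` {s \<in> T a. key a s < key a t})" for a t
  \<comment> \<open>The \<open>e a t\<close> span but need not be independent, so an element can
    have several leading coefficients at \<open>t\<close>. Therefore \<open>rep\<close> is a
    relation, and \<open>lead\<close> collects every coefficient that occurs.\<close>
  define rep where "rep a t l q \<longleftrightarrow> (\<exists>y\<in>low a t. q = l \<odot>\<^bsub>Md a\<^esub> e a t \<oplus>\<^bsub>Md a\<^esub> y)" for a t l q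
  define lead where "lead a t B = {l \<in> carrier K. \<exists>q\<in>B. rep a t l q}" for a t B
  have low: "submodule (low a t) K (Md a)" if "a \<in> Ob" for a t
    unfolding low_def by (rule left_module.mspan_submodule[OF Md[OF that]])
  have lead_ideal: "left_ideal (lead a t B) K"
    if a: "a \<in> Ob" "t \<in> T a" and B: "submodule B K (Md a)" for a t B
  proof -
    interpret M: left_module K "Md a" by (rule Md[OF a(1)])
    note U = submoduleD[OF low[OF a(1), of t]] and B = submoduleD[OF B] and et = e[OF a]
    show ?thesis
    proof (rule left_idealI)
      show "lead a t B \<subseteq> carrier K"
        by (auto simp: lead_def)
      have "\<zero>\<^bsub>Md a\<^esub> = \<zero> \<odot>\<^bsub>Md a\<^esub> e a t \<oplus>\<^bsub>Md a\<^esub> \<zero>\<^bsub>Md a\<^esub>"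
        using et by (simp add: M.smult_l_null)
      then show "\<zero> \<in> lead a t B"
        using U(2) B(2) unfolding lead_def rep_def by blast
    next
      fix l l' assume "l \<in> lead a t B" "l' \<in> lead a t B"
      then obtain y y' where *: "l \<in> carrier K" "l' \<in> carrier K" "y \<in> low a t" "y' \<in> low a t"
        "l \<odot>\<^bsub>Md a\<^esub> e a t \<oplus>\<^bsub>Md a\<^esub> y \<in> B" "l' \<odot>\<^bsub>Md a\<^esub> e a t \<oplus>\<^bsub>Md a\<^esub> y' \<in> B"
        by (auto simp: lead_def rep_def)
      have c: "y \<in> carrier (Md a)" "y' \<in> carrier (Md a)"
        using * U(1) by auto
      have "(l \<odot>\<^bsub>Md a\<^esub> e a t \<oplus>\<^bsub>Md a\<^esub> y) \<oplus>\<^bsub>Md a\<^esub> (l' \<odot>\<^bsub>Md a\<^esub> e a t \<oplus>\<^bsub>Md a\<^esub> y') =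
          (l \<oplus> l') \<odot>\<^bsub>Md a\<^esub> e a t \<oplus>\<^bsub>Md a\<^esub> (y \<oplus>\<^bsub>Md a\<^esub> y')"
        using * c et M.smult_closed by (simp add: M.smult_l_distr M.M.a_ac)
      then show "l \<oplus> l' \<in> lead a t B"
        using * U(3) B(3)[OF *(5,6)] unfolding lead_def rep_def by auto
    next
      fix c l assume c: "c \<in> carrier K" and "l \<in> lead a t B"
      then obtain y where *: "l \<in> carrier K" "y \<in> low a t" "l \<odot>\<^bsub>Md a\<^esub> e a t \<oplus>\<^bsub>Md a\<^esub> y \<in> B"
        by (auto simp: lead_def rep_def)
      have "c \<odot>\<^bsub>Md a\<^esub> (l \<odot>\<^bsub>Md a\<^esub> e a t \<oplus>\<^bsub>Md a\<^esub> y) =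
          (c \<otimes> l) \<odot>\<^bsub>Md a\<^esub> e a t \<oplus>\<^bsub>Md a\<^esub> (c \<odot>\<^bsub>Md a\<^esub> y)"
        using * c et U(1) M.smult_closed by (auto simp: M.smult_r_distr M.smult_assoc subset_iff)
      then show "c \<otimes> l \<in> lead a t B"
        using * c U(4) B(4)[OF c *(3)] unfolding lead_def rep_def by auto
    qed
  qed
  \<comment> \<open>Because \<open>h\<close> sends terms below \<open>t\<close> to terms below
    \<open>t'\<close>, the tail of an element stays in the lower span. Thus a leading coefficient at
    \<open>t\<close> remains one at \<open>t'\<close>, and leading ideals grow along
    \<open>P\<close>.\<close>
  have rep_transfer: "\<exists>h\<in>H a a'. h ` Q a \<subseteq> Q a' \<and>
      (\<forall>l q. l \<in> carrier K \<longrightarrow> rep a t l q \<longrightarrow> rep a' t' l (h q))"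
    if *: "a \<in> Ob" "t \<in> T a" "a' \<in> Ob" "t' \<in> T a'" "P (a, t) (a', t')" for a t a' t'
  proof -
    obtain h where h: "h \<in> H a a'" "h \<in> linear_maps K (Md a) (Md a')" "h ` Q a \<subseteq> Q a'"
      "h (e a t) = e a' t'"
      "\<And>s. \<lbrakk>s \<in> T a; key a s < key a t\<rbrakk> \<Longrightarrow> \<exists>s'\<in>T a'. key a' s' < key a' t' \<and> h (e a s) = e a' s'"
      using transfer[OF *] by blast
    interpret M: left_module K "Md a" by (rule Md[OF *(1)])
    have h_low: "h y \<in> low a' t'" if "y \<in> low a t" for y
    proof -
      have "h ` (e a ` {s \<in> T a. key a s < key a t}) \<subseteq> e a' ` {s \<in> T a'. key a' s < key a' t'}"
        using h(5) by fastforce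
      also have "\<dots> \<subseteq> low a' t'"
        unfolding low_def using e[OF *(3)] by (intro mspan_superset) auto
      finally show ?thesis
        using that e[OF *(1)] unfolding low_def
        by (intro linear_map_mspan[OF Md[OF *(1)] Md[OF *(3)] h(2)]) auto
    qed
    have "rep a' t' l (h q)" if l: "l \<in> carrier K" and "rep a t l q" for l q
    proof -
      obtain y where y: "y \<in> low a t" "q = l \<odot>\<^bsub>Md a\<^esub> e a t \<oplus>\<^bsub>Md a\<^esub> y"
        using \<open>rep a t l q\<close> by (auto simp: rep_def)
      then have "y \<in> carrier (Md a)"
        using submoduleD(1)[OF low[OF *(1)]] by auto
      then have "h q = l \<odot>\<^bsub>Md a'\<^esub> e a' t' \<oplus>\<^bsub>Md a'\<^esub> h y"
        using y l linear_mapsD(2,3)[OF h(2)] e[OF *(1,2)] h(4) M.smult_closed by simp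
      then show ?thesis
        using h_low[OF y(1)] by (auto simp: rep_def)
    qed
    with h show ?thesis by blast
  qed
  define I where "I = (\<lambda>(a, t). lead a t (Q a))"
  have "\<exists>F. finite F \<and> F \<subseteq> Sigma Ob T \<and> (\<forall>z\<in>Sigma Ob T. \<exists>z'\<in>F. P z' z \<and> I z' = I z)"
  proof (rule finite_basis)
    show "left_ideal (I z) K" if "z \<in> Sigma Ob T" for z
      using that lead_ideal Q by (auto simp: I_def)
    show "I z \<subseteq> I z'" if z: "z \<in> Sigma Ob T" "z' \<in> Sigma Ob T" and P: "P z z'" for z z'
    proof -
      obtain a t a' t' where eq: "z = (a, t)" "z' = (a', t')"
        by (cases z, cases z')
      with z P have "a \<in> Ob" "t \<in> T a" "a' \<in> Ob" "t' \<in> T a'" "P (a, t) (a', t')"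
        by auto
      from rep_transfer[OF this] show ?thesis
        by (fastforce simp: eq I_def lead_def)
    qed
  qed (rule good)
  then obtain F where F: "finite F" "F \<subseteq> Sigma Ob T"
    "\<And>z. z \<in> Sigma Ob T \<Longrightarrow> \<exists>z'\<in>F. P z' z \<and> I z' = I z"
    by blast
  have "\<exists>A. finite A \<and> A \<subseteq> I z \<and> (\<forall>J. left_ideal J K \<and> A \<subseteq> J \<longrightarrow> I z \<subseteq> J)" if "z \<in> F" for z
    using that F(2) lead_ideal Q by (intro left_ideal_finitely_generated) (auto simp: I_def)
  then obtain A where A: "\<And>z. z \<in> F \<Longrightarrow> finite (A z)" "\<And>z. z \<in> F \<Longrightarrow> A z \<subseteq> I z"
    "\<And>z J. \<lbrakk>z \<in> F; left_ideal J K; A z \<subseteq> J\<rbrakk> \<Longrightarrow> I z \<subseteq> J"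
    by metis
  have "\<forall>z l. \<exists>q. z \<in> F \<longrightarrow> l \<in> A z \<longrightarrow> q \<in> Q (fst z) \<and> rep (fst z) (snd z) l q"
    using A(2) by (fastforce simp: I_def lead_def)
  then obtain q where q: "\<And>z l. \<lbrakk>z \<in> F; l \<in> A z\<rbrakk> \<Longrightarrow> q z l \<in> Q (fst z) \<and> rep (fst z) (snd z) l (q z l)"
    by metis
  \<comment> \<open>One element of \<open>Q\<close> is kept for each member of the finite generating
    sets of the finitely many leading ideals indexed by \<open>F\<close>.\<close>
  define G where "G = (\<Union>z\<in>F. (\<lambda>l. (fst z, q z l)) ` A z)"
  show ?thesis
  proof (intro exI[of _ G] conjI ballI allI impI)
    show "finite G"
      using F(1) A(1) by (simp add: G_def)
    show "case z of (a, x) \<Rightarrow> a \<in> Ob \<and> x \<in> Q a" if "z \<in> G" for z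
      using that q F(2) by (auto simp: G_def)
    fix a D
    assume a: "a \<in> Ob" and D: "submodule D K (Md a)"
      and "\<forall>(b, x)\<in>G. \<forall>h\<in>H b a. h x \<in> D"
    then have GD: "h x \<in> D" if "(b, x) \<in> G" "h \<in> H b a" for b x h
      using that by auto
    interpret M: left_module K "Md a" by (rule Md[OF a])
    note Qa = submoduleD[OF Q[OF a]] and Da = submoduleD[OF D]
    have QD: "submodule (Q a \<inter> D) K (Md a)"
      using Qa Da by (intro M.submoduleI) auto
    \<comment> \<open>The coefficients realised inside \<open>D\<close> form a left ideal. It
      contains the transferred generators of the leading ideal of some \<open>z\<close> in
      \<open>F\<close> with \<open>I z = I (a, t)\<close>, hence every leading coefficient of
      \<open>Q a\<close> at \<open>t\<close>.\<close>
    have reduce: "\<exists>x\<in>Q a \<inter> D. rep a t l x" if t: "t \<in> T a" and l: "l \<in> lead a t (Q a)" for t l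
    proof -
      obtain z where z: "z \<in> F" "P z (a, t)" "I z = I (a, t)"
        using F(3)[of "(a, t)"] a t by auto
      obtain b s where zeq: "z = (b, s)" by (cases z)
      have bs: "b \<in> Ob" "s \<in> T b"
        using z(1) zeq F(2) by auto
      obtain h where h: "h \<in> H b a" "h ` Q b \<subseteq> Q a"
        "\<And>l q. \<lbrakk>l \<in> carrier K; rep b s l q\<rbrakk> \<Longrightarrow> rep a t l (h q)"
        using rep_transfer[OF bs a t] z zeq by blast
      have "A z \<subseteq> lead a t (Q a \<inter> D)"
      proof
        fix l assume lA: "l \<in> A z"
        then have "l \<in> carrier K"
          using A(2)[OF z(1)] zeq by (auto simp: I_def lead_def)
        moreover have "q z l \<in> Q b" "rep b s l (q z l)"
          using q[OF z(1) lA] zeq by auto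
        moreover have "h (q z l) \<in> D"
          using GD[of b "q z l" h] h(1) z(1) lA zeq by (force simp: G_def)
        ultimately show "l \<in> lead a t (Q a \<inter> D)"
          using h unfolding lead_def by blast
      qed
      then have "I z \<subseteq> lead a t (Q a \<inter> D)"
        using A(3)[OF z(1) lead_ideal[OF a t QD]] by blast
      then show ?thesis
        using l z(3) by (auto simp: I_def lead_def)
    qed
    \<comment> \<open>Induction over initial segments \<open>S\<close> of \<open>T a\<close>: an
      element of \<open>Q a \<inter> D\<close> with the same leading coefficient is subtracted,
      which removes the largest term. Finiteness of \<open>T a\<close> takes the place of a
      well-order on all terms.\<close>
    have main: "x \<in> D"
      if "S \<subseteq> T a" "\<And>t s. \<lbrakk>t \<in> S; s \<in> T a; key a s < key a t\<rbrakk> \<Longrightarrow> s \<in> S"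
        "x \<in> Q a" "x \<in> mspan K (Md a) (e a ` S)" for S x
      using that
    proof (induction "card S" arbitrary: S x)
      case 0
      then have "S = {}"
        using finT[OF a] finite_subset by fastforce
      have "submodule {\<zero>\<^bsub>Md a\<^esub>} K (Md a)"
        by (rule M.submoduleI) (auto simp: M.smult_r_null)
      then have "x = \<zero>\<^bsub>Md a\<^esub>"
        using mspan_minimal[of _ K "Md a" "e a ` S"] 0 \<open>S = {}\<close> by blast
      then show ?case
        using Da by simp
    next
      case (Suc n)
      have fin: "finite S" "S \<noteq> {}"
        using Suc.hyps(2) by (auto intro: card_ge_0_finite)
      define m where "m = Max (key a ` S)"
      have "m \<in> key a ` S"
        unfolding m_def using fin by (intro Max_in) auto
      then obtain t where t: "t \<in> S" "key a t = m"
        by auto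
      have le: "key a s \<le> key a t" if "s \<in> S" for s
        unfolding t(2) m_def using fin that by simp
      have St: "S - {t} = {s \<in> T a. key a s < key a t}"
      proof (intro equalityI subsetI)
        fix s assume "s \<in> S - {t}"
        moreover from this have "key a s \<noteq> key a t"
          using inj[OF a] Suc.prems(1) t(1) by (auto dest: inj_onD)
        ultimately show "s \<in> {s \<in> T a. key a s < key a t}"
          using le[of s] Suc.prems(1) by auto
      next
        fix s assume "s \<in> {s \<in> T a. key a s < key a t}"
        then show "s \<in> S - {t}"
          using Suc.prems(2)[OF t(1), of s] by auto
      qed
      have tT: "t \<in> T a"
        using t Suc.prems(1) by blast
      have "e a ` S = insert (e a t) (e a ` (S - {t}))"
        using t(1) by blast
      with Suc.prems(4) have "x \<in> mspan K (Md a) (insert (e a t) (e a ` (S - {t})))"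
        by (simp only:)
      moreover have "e a ` (S - {t}) \<subseteq> carrier (Md a)"
        using e[OF a] Suc.prems(1) by auto
      ultimately obtain l y where "l \<in> carrier K" "y \<in> mspan K (Md a) (e a ` (S - {t}))"
        "x = l \<odot>\<^bsub>Md a\<^esub> e a t \<oplus>\<^bsub>Md a\<^esub> y"
        using M.mspan_insertE[OF _ e[OF a tT]] by blast
      then have ly: "l \<in> carrier K" "y \<in> low a t" "x = l \<odot>\<^bsub>Md a\<^esub> e a t \<oplus>\<^bsub>Md a\<^esub> y"
        by (simp_all only: low_def St)
      then have "l \<in> lead a t (Q a)"
        using Suc.prems(3) by (auto simp: lead_def rep_def)
      from reduce[OF tT this] obtain x' y' where x': "x' \<in> Q a" "x' \<in> D" "y' \<in> low a t"
        "x' = l \<odot>\<^bsub>Md a\<^esub> e a t \<oplus>\<^bsub>Md a\<^esub> y'"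
        by (auto simp: rep_def)
      note U = submoduleD[OF low[OF a, of t]]
      have car: "x \<in> carrier (Md a)" "x' \<in> carrier (Md a)" "y \<in> carrier (Md a)" "y' \<in> carrier (Md a)"
        "l \<odot>\<^bsub>Md a\<^esub> e a t \<in> carrier (Md a)"
        using Suc.prems(3) x' ly Qa(1) U(1) M.smult_closed e[OF a tT] by auto
      have "x \<oplus>\<^bsub>Md a\<^esub> \<ominus>\<^bsub>Md a\<^esub> x' = y \<oplus>\<^bsub>Md a\<^esub> \<ominus>\<^bsub>Md a\<^esub> y'"
        unfolding ly(3) x'(4) using car(3-5)
        by (simp add: M.M.minus_add M.M.a_ac M.M.r_neg1 M.M.r_neg2 M.M.r_neg)
      then have diff: "x \<oplus>\<^bsub>Md a\<^esub> \<ominus>\<^bsub>Md a\<^esub> x' \<in> low a t"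
        using ly(2) x'(3) U(3,5) by simp
      have "x \<oplus>\<^bsub>Md a\<^esub> \<ominus>\<^bsub>Md a\<^esub> x' \<in> D"
      proof (rule Suc.hyps(1)[of "S - {t}"])
        show "n = card (S - {t})"
          using Suc.hyps(2) t(1) fin by simp
        show "S - {t} \<subseteq> T a"
          using Suc.prems(1) by blast
        show "s \<in> S - {t}" if "u \<in> S - {t}" "s \<in> T a" "key a s < key a u" for u s
          using that unfolding St by auto
        show "x \<oplus>\<^bsub>Md a\<^esub> \<ominus>\<^bsub>Md a\<^esub> x' \<in> Q a"
          using Suc.prems(3) x'(1) Qa(3,5) by blast
        show "x \<oplus>\<^bsub>Md a\<^esub> \<ominus>\<^bsub>Md a\<^esub> x' \<in> mspan K (Md a) (e a ` (S - {t}))"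
          using diff unfolding low_def St .
      qed
      then have "(x \<oplus>\<^bsub>Md a\<^esub> \<ominus>\<^bsub>Md a\<^esub> x') \<oplus>\<^bsub>Md a\<^esub> x' \<in> D"
        using Da(3) x'(2) by blast
      then show ?case
        using car by (simp add: M.M.a_assoc M.M.l_neg)
    qed
    show "Q a \<subseteq> D"
      using main[of "T a"] gen[OF a] Qa(1) by auto
  qed
qed

section \<open>Orthogonal modules over a finite ring\<close>

lemma (in cring) finite_idempotent_power:
  assumes fin: "finite (carrier R)" and b: "b \<in> carrier R"
  shows "\<exists>m::nat. m \<ge> 1 \<and> b [^] m \<otimes> b [^] m = b [^] m"
proof -
  have "\<not> inj (\<lambda>i::nat. b [^] i)"
  proof
    assume "inj (\<lambda>i::nat. b [^] i)"
    moreover have "range (\<lambda>i::nat. b [^] i) \<subseteq> carrier R"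
      using b by auto
    ultimately show False
      using fin finite_subset range_inj_infinite by blast
  qed
  then obtain i j :: nat where ij: "b [^] i = b [^] j" "i < j"
    by (metis injI linorder_neqE_nat)
  define d where "d = j - i"
  have step: "b [^] (l + d) = b [^] l" if "i \<le> l" for l
  proof -
    have "b [^] (l + d) = b [^] j \<otimes> b [^] (l - i)"
      using b that ij(2) by (simp add: nat_pow_mult d_def add.commute)
    also have "\<dots> = b [^] l"
      using b that by (simp add: nat_pow_mult flip: ij(1))
    finally show ?thesis .
  qed
  have steps: "b [^] (l + d * k) = b [^] l" if "i \<le> l" for l k
  proof (induction k)
    case (Suc k)
    have "b [^] (l + d * Suc k) = b [^] (l + d * k + d)"
      by (simp add: algebra_simps)
    also have "\<dots> = b [^] l"
      using step[of "l + d * k"] that Suc by simp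
    finally show ?case .
  qed simp
  \<comment> \<open>From exponent \<open>i\<close> on the powers have period \<open>d\<close>, so
    any multiple \<open>m\<close> of \<open>d\<close> with \<open>i \<le> m\<close> satisfies
    \<open>b [^] (m + m) = b [^] m\<close>. The factor \<open>Suc i\<close> instead of
    \<open>i\<close> keeps \<open>m\<close> positive when \<open>i\<close> is 0.\<close>
  define m where "m = d * Suc i"
  have "d \<ge> 1"
    using ij(2) by (simp add: d_def)
  then have "1 \<le> m" "i \<le> m"
    by (auto simp: m_def intro: trans_le_add2[of i "d * i" d])
  moreover have "b [^] m \<otimes> b [^] m = b [^] m"
    using steps[OF \<open>i \<le> m\<close>, of "Suc i"] b unfolding m_def[symmetric] by (simp only: nat_pow_mult)
  ultimately show ?thesis
    by blast
qed

text \<open>The idempotent splits \<open>R\<close> into the product of \<open>eR\<close> and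
  \<open>(1 - e)R\<close>. The element glued from \<open>b\<close> and \<open>c\<close> has
  component \<open>b\<close> in the first factor and \<open>c\<close> in the second, and powers are
  taken componentwise.\<close>

lemma (in cring) idempotent_split_power:
  assumes c: "e \<in> carrier R" "b \<in> carrier R" "c \<in> carrier R" and e: "e \<otimes> e = e"
  shows "e \<otimes> (e \<otimes> b \<oplus> (\<one> \<ominus> e) \<otimes> c) [^] (m::nat) = e \<otimes> b [^] m"
    and "(\<one> \<ominus> e) \<otimes> (e \<otimes> b \<oplus> (\<one> \<ominus> e) \<otimes> c) [^] (m::nat) = (\<one> \<ominus> e) \<otimes> c [^] m"
proof -
  let ?f = "\<one> \<ominus> e" and ?s = "e \<otimes> b \<oplus> (\<one> \<ominus> e) \<otimes> c"
  have f: "?f \<in> carrier R" and s: "?s \<in> carrier R"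
    using c by auto
  have ef: "e \<otimes> ?f = \<zero>"
    using c e by (simp add: minus_eq r_distr r_minus r_neg)
  have ff: "?f \<otimes> ?f = ?f"
    using c e f ef by (metis l_distr minus_eq a_inv_closed l_minus l_one one_closed m_closed minus_zero r_zero)
  have es: "e \<otimes> ?s = e \<otimes> b"
    using c f by (simp add: r_distr ef e flip: m_assoc)
  have fs: "?f \<otimes> ?s = ?f \<otimes> c"
    using c f ef by (simp add: r_distr ff m_comm[of ?f e] flip: m_assoc)
  show "e \<otimes> ?s [^] m = e \<otimes> b [^] m"
  proof (induction m)
    case (Suc m)
    have "e \<otimes> ?s [^] Suc m = (e \<otimes> ?s [^] m) \<otimes> ?s"
      using c s by (simp add: m_assoc)
    also have "\<dots> = b [^] m \<otimes> (e \<otimes> ?s)"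
      unfolding Suc using c s by (simp add: m_ac)
    also have "\<dots> = e \<otimes> b [^] Suc m"
      unfolding es using c by (simp add: m_ac)
    finally show ?case .
  qed simp
  show "?f \<otimes> ?s [^] m = ?f \<otimes> c [^] m"
  proof (induction m)
    case (Suc m)
    have "?f \<otimes> ?s [^] Suc m = (?f \<otimes> ?s [^] m) \<otimes> ?s"
      using c s f by (simp add: m_assoc)
    also have "\<dots> = c [^] m \<otimes> (?f \<otimes> ?s)"
      unfolding Suc using c s f by (simp add: m_ac)
    also have "\<dots> = ?f \<otimes> c [^] Suc m"
      unfolding fs using c f by (simp add: m_ac)
    finally show ?case .
  qed simp
qed

text \<open>A nonzero element of \<open>fR\<close> generating a minimal ideal is annihilated by every \<open>b\<close> that
  is nilpotent on \<open>fR\<close>.\<close>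

lemma (in cring) annihilates_nilpotent:
  assumes fin: "finite (carrier R)" and f: "f \<in> carrier R" "f \<noteq> \<zero>"
  shows "\<exists>t\<in>carrier R. t \<noteq> \<zero> \<and> (\<forall>b\<in>carrier R. (\<exists>m::nat. f \<otimes> b [^] m = \<zero>) \<longrightarrow> t \<otimes> b = \<zero>)"
proof -
  define ideal_of where "ideal_of s = (\<lambda>r. s \<otimes> r) ` carrier R" for s
  define C where "C = ideal_of f - {\<zero>}"
  have "f \<in> ideal_of f"
    unfolding ideal_of_def using f by (intro image_eqI[of _ _ \<one>]) auto
  then have "f \<in> C"
    using f by (simp add: C_def)
  then obtain t where t: "t \<in> C" and min: "\<And>s. s \<in> C \<Longrightarrow> card (ideal_of t) \<le> card (ideal_of s)"
    using ex_has_least_nat[of "\<lambda>s. s \<in> C" f "\<lambda>s. card (ideal_of s)"] by blast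
  from t obtain r where r: "r \<in> carrier R" "t = f \<otimes> r" "t \<noteq> \<zero>"
    by (auto simp: C_def ideal_of_def)
  have tc: "t \<in> carrier R"
    using r f by simp
  have "t \<otimes> b = \<zero>" if b: "b \<in> carrier R" and m: "f \<otimes> b [^] (m::nat) = \<zero>" for b m
  proof (rule ccontr)
    assume nz: "t \<otimes> b \<noteq> \<zero>"
    have "t \<otimes> b \<in> ideal_of f"
      unfolding ideal_of_def using r f b by (intro image_eqI[of _ _ "r \<otimes> b"]) (auto simp: m_assoc)
    then have le: "card (ideal_of t) \<le> card (ideal_of (t \<otimes> b))"
      using nz by (intro min) (simp add: C_def)
    have sub: "ideal_of (t \<otimes> b) \<subseteq> ideal_of t"
      using tc b by (auto simp: ideal_of_def m_assoc)
    \<comment> \<open>By minimality \<open>t b\<close> generates the same ideal as \<open>t\<close>,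
      so \<open>t = t b c\<close> for some \<open>c\<close>. Iteration makes \<open>t\<close> a
      multiple of \<open>f b^m\<close>, which is zero.\<close>
    have "ideal_of (t \<otimes> b) = ideal_of t"
      using fin sub le by (intro card_seteq) (auto simp: ideal_of_def)
    moreover have "t \<in> ideal_of t"
      unfolding ideal_of_def using tc by (intro image_eqI[of _ _ \<one>]) auto
    ultimately obtain c where c: "c \<in> carrier R" "t = t \<otimes> b \<otimes> c"
      by (auto simp: ideal_of_def)
    have "t = t \<otimes> (b \<otimes> c) [^] k" for k :: nat
    proof (induction k)
      case (Suc k)
      have "t \<otimes> (b \<otimes> c) [^] Suc k = (t \<otimes> (b \<otimes> c) [^] k) \<otimes> (b \<otimes> c)"
        using tc b c(1) by (simp add: m_assoc)
      also have "\<dots> = t \<otimes> b \<otimes> c"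
        using Suc tc b c(1) by (simp add: m_assoc)
      finally show ?case
        using c(2) by simp
    qed (simp add: tc)
    then have "t = t \<otimes> (b \<otimes> c) [^] m" .
    also have "\<dots> = r \<otimes> c [^] m \<otimes> (f \<otimes> b [^] m)"
      using r f b c(1) by (simp add: nat_pow_distrib m_ac)
    also have "\<dots> = \<zero>"
      using r c(1) m by simp
    finally show False
      using r(3) by simp
  qed
  then show ?thesis
    using tc r(3) by blast
qed

section \<open>Orthogonal lists, coordinates and frames\<close>

definition orth_list :: "('r, 's) ring_scheme \<Rightarrow> ('r, 'v) orth_module \<Rightarrow> 'v list \<Rightarrow> bool" where
  "orth_list R V bs \<longleftrightarrow> set bs \<subseteq> carrier V \<and>
     (\<forall>i<length bs. form V (bs ! i) (bs ! i) \<in> Units R) \<and>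
     (\<forall>i<length bs. \<forall>j<length bs. i \<noteq> j \<longrightarrow> form V (bs ! i) (bs ! j) = \<zero>\<^bsub>R\<^esub>)"

locale finite_orthogonal_module = orthogonal_module R V
  for R :: "('r, 's) ring_scheme" (structure) and V :: "('r, 'v) orth_module" +
  assumes finite_R: "finite (carrier R)" and one_not_zero: "\<one> \<noteq> \<zero>"
    and two_unit: "\<one> \<oplus> \<one> \<in> Units R"
begin

lemma form_add_right:
  "\<lbrakk>v \<in> carrier V; w \<in> carrier V; w' \<in> carrier V\<rbrakk> \<Longrightarrow>
    form V v (w \<oplus>\<^bsub>V\<^esub> w') = form V v w \<oplus> form V v w'"
  by (metis form_add form_sym M.a_closed)

lemma form_smult_right:
  "\<lbrakk>a \<in> carrier R; v \<in> carrier V; w \<in> carrier V\<rbrakk> \<Longrightarrow> form V v (a \<odot>\<^bsub>V\<^esub> w) = a \<otimes> form V v w"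
  by (metis form_smult form_sym smult_closed)

lemma form_zero_left [simp]: "w \<in> carrier V \<Longrightarrow> form V \<zero>\<^bsub>V\<^esub> w = \<zero>"
  using form_smult[of \<zero> "\<zero>\<^bsub>V\<^esub>" w] by (simp add: form_closed)

lemma form_minus_left: "\<lbrakk>v \<in> carrier V; w \<in> carrier V\<rbrakk> \<Longrightarrow> form V (\<ominus>\<^bsub>V\<^esub> v) w = \<ominus> form V v w"
  using form_smult[of "\<ominus> \<one>" v w] smult_l_minus[of \<one> v] by (simp add: form_closed R.l_minus)

lemma form_finsum_left:
  assumes "finite A" "f \<in> A \<rightarrow> carrier V" "w \<in> carrier V"
  shows "form V (\<Oplus>\<^bsub>V\<^esub>i\<in>A. f i) w = (\<Oplus>i\<in>A. form V (f i) w)"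
  using assms
proof (induction A rule: finite_induct)
  case (insert x F)
  then have "f \<in> F \<rightarrow> carrier V" "f x \<in> carrier V" by auto
  then show ?case
    using insert by (simp add: form_add form_closed Pi_def M.finsum_closed)
qed simp

lemma form_finsum_single:
  assumes "finite A" "f \<in> A \<rightarrow> carrier V" "w \<in> carrier V" "i \<in> A"
    and "\<And>j. \<lbrakk>j \<in> A; j \<noteq> i\<rbrakk> \<Longrightarrow> form V (f j) w = \<zero>"
  shows "form V (\<Oplus>\<^bsub>V\<^esub>j\<in>A. f j) w = form V (f i) w"
proof -
  have "form V (\<Oplus>\<^bsub>V\<^esub>j\<in>A. f j) w = (\<Oplus>j\<in>A. if i = j then form V (f j) w else \<zero>)"
    unfolding form_finsum_left[OF assms(1-3)]
    using assms by (intro R.finsum_cong') (auto simp: form_closed Pi_iff)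
  also have "\<dots> = form V (f i) w"
    using assms by (intro R.finsum_singleton) (auto simp: form_closed Pi_iff)
  finally show ?thesis .
qed

lemma form_finsum_zero:
  assumes "finite A" "f \<in> A \<rightarrow> carrier V" "w \<in> carrier V"
    and "\<And>j. j \<in> A \<Longrightarrow> form V (f j) w = \<zero>"
  shows "form V (\<Oplus>\<^bsub>V\<^esub>j\<in>A. f j) w = \<zero>"
  unfolding form_finsum_left[OF assms(1-3)]
  using assms(4) by (simp add: R.add.finprod_one_eqI)

lemma nondegenerate_zero:
  assumes "v \<in> carrier V" "\<And>w. w \<in> carrier V \<Longrightarrow> form V v w = \<zero>"
  shows "v = \<zero>\<^bsub>V\<^esub>"
proof -
  have "(\<lambda>w\<in>carrier V. form V v w) = (\<lambda>w\<in>carrier V. form V \<zero>\<^bsub>V\<^esub> w)"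
    using assms by (auto simp: restrict_def)
  then show ?thesis
    using nondegenerate assms(1) by (auto simp: bij_betw_def dest: inj_onD)
qed

lemma card_R_ge_2: "2 \<le> card (carrier R)"
proof -
  have "card {\<zero>, \<one>} \<le> card (carrier R)"
    using finite_R by (intro card_mono) auto
  then show ?thesis
    using one_not_zero by auto
qed

definition lincomb :: "nat \<Rightarrow> (nat \<Rightarrow> 'v) \<Rightarrow> (nat \<Rightarrow> 'r) \<Rightarrow> 'v" where
  "lincomb n b a = (\<Oplus>\<^bsub>V\<^esub>i\<in>{..<n}. a i \<odot>\<^bsub>V\<^esub> b i)"

lemma lincomb_closed:
  "\<lbrakk>b \<in> {..<n} \<rightarrow> carrier V; a \<in> {..<n} \<rightarrow> carrier R\<rbrakk> \<Longrightarrow> lincomb n b a \<in> carrier V"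
  by (auto simp: lincomb_def Pi_iff intro!: M.finsum_closed)

lemma lincomb_smult:
  assumes "b \<in> {..<n} \<rightarrow> carrier V" "a \<in> {..<n} \<rightarrow> carrier R" "t \<in> carrier R"
    and "\<And>i. i < n \<Longrightarrow> a' i = t \<otimes> a i"
  shows "lincomb n b a' = t \<odot>\<^bsub>V\<^esub> lincomb n b a"
proof -
  have "t \<odot>\<^bsub>V\<^esub> lincomb n b a = (\<Oplus>\<^bsub>V\<^esub>i\<in>{..<n}. t \<odot>\<^bsub>V\<^esub> (a i \<odot>\<^bsub>V\<^esub> b i))"
    unfolding lincomb_def using assms by (intro finsum_smult_ldistr) (auto simp: Pi_iff)
  also have "\<dots> = lincomb n b a'"
    unfolding lincomb_def using assms
    by (intro M.finsum_cong') (auto simp: Pi_iff smult_assoc1)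
  finally show ?thesis by simp
qed

lemma basis:
  obtains b where "b \<in> {..<rk R V} \<rightarrow> carrier V"
    "bij_betw (lincomb (rk R V) b) ({..<rk R V} \<rightarrow>\<^sub>E carrier R) (carrier V)"
proof -
  have "free_of_rank R V (rk R V)"
    unfolding rk_def using free by (rule LeastI_ex)
  then obtain b where b: "b \<in> {..<rk R V} \<rightarrow> carrier V"
    and u: "\<And>v. v \<in> carrier V \<Longrightarrow> \<exists>!a. a \<in> {..<rk R V} \<rightarrow>\<^sub>E carrier R \<and> v = lincomb (rk R V) b a"
    by (auto simp: free_of_rank_def lincomb_def)
  have "lincomb (rk R V) b a \<in> carrier V" if "a \<in> {..<rk R V} \<rightarrow>\<^sub>E carrier R" for a
    using that by (intro lincomb_closed[OF b]) auto
  then have "bij_betw (lincomb (rk R V) b) ({..<rk R V} \<rightarrow>\<^sub>E carrier R) (carrier V)"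
    using u by (intro bij_betwI') metis+
  then show thesis
    by (rule that[OF b])
qed

lemma card_carrier: "card (carrier V) = card (carrier R) ^ rk R V"
proof -
  obtain b where "bij_betw (lincomb (rk R V) b) ({..<rk R V} \<rightarrow>\<^sub>E carrier R) (carrier V)"
    using basis .
  then show ?thesis
    using bij_betw_same_card by (fastforce simp: card_funcsetE)
qed

lemma finite_carrier: "finite (carrier V)"
proof -
  obtain b where "bij_betw (lincomb (rk R V) b) ({..<rk R V} \<rightarrow>\<^sub>E carrier R) (carrier V)"
    using basis .
  then show ?thesis
    using bij_betw_finite finite_PiE[of "{..<rk R V}" "\<lambda>_. carrier R"] finite_R by auto
qed

lemma orth_list_nth:
  assumes "orth_list R V bs" "i < length bs"
  shows "bs ! i \<in> carrier V" "form V (bs ! i) (bs ! i) \<in> Units R"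
    "form V (bs ! i) (bs ! i) \<in> carrier R"
  using assms by (auto simp: orth_list_def dest: nth_mem intro: form_closed)

lemma orth_list_orth:
  "\<lbrakk>orth_list R V bs; i < length bs; j < length bs; i \<noteq> j\<rbrakk> \<Longrightarrow> form V (bs ! i) (bs ! j) = \<zero>"
  by (simp add: orth_list_def)

lemma form_lincomb:
  assumes bs: "orth_list R V bs" and a: "a \<in> {..<length bs} \<rightarrow> carrier R" and i: "i < length bs"
  shows "form V (lincomb (length bs) ((!) bs) a) (bs ! i) = a i \<otimes> form V (bs ! i) (bs ! i)"
proof -
  have ai: "a i \<in> carrier R"
    using a i by auto
  have "form V (lincomb (length bs) ((!) bs) a) (bs ! i) = form V (a i \<odot>\<^bsub>V\<^esub> bs ! i) (bs ! i)"
    unfolding lincomb_def using orth_list_nth[OF bs] orth_list_orth[OF bs] a i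
    by (intro form_finsum_single) (auto simp: Pi_iff form_smult)
  also have "\<dots> = a i \<otimes> form V (bs ! i) (bs ! i)"
    using orth_list_nth[OF bs i] ai by (simp add: form_smult)
  finally show ?thesis .
qed

text \<open>These are the Fourier coefficients of \<open>v\<close>; the division is possible because
  the norms in an orthogonal list are units.\<close>

definition coord :: "'v list \<Rightarrow> 'v \<Rightarrow> nat \<Rightarrow> 'r" where
  "coord bs v i = form V v (bs ! i) \<otimes> inv (form V (bs ! i) (bs ! i))"

lemma coord_closed:
  "\<lbrakk>orth_list R V bs; v \<in> carrier V\<rbrakk> \<Longrightarrow> coord bs v \<in> {..<length bs} \<rightarrow> carrier R"
  by (auto simp: coord_def orth_list_nth form_closed)

lemma coord_lincomb:
  assumes bs: "orth_list R V bs" and a: "a \<in> {..<length bs} \<rightarrow> carrier R" and i: "i < length bs"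
  shows "coord bs (lincomb (length bs) ((!) bs) a) i = a i"
proof -
  have "a i \<in> carrier R"
    using a i by auto
  then show ?thesis
    using orth_list_nth[OF bs i] by (simp add: coord_def form_lincomb[OF bs a i] R.m_assoc)
qed

lemma inj_on_lincomb_orth:
  assumes bs: "orth_list R V bs"
  shows "inj_on (lincomb (length bs) ((!) bs)) ({..<length bs} \<rightarrow>\<^sub>E carrier R)"
proof (rule inj_onI)
  fix a a' assume *: "a \<in> {..<length bs} \<rightarrow>\<^sub>E carrier R" "a' \<in> {..<length bs} \<rightarrow>\<^sub>E carrier R"
    "lincomb (length bs) ((!) bs) a = lincomb (length bs) ((!) bs) a'"
  then have "a \<in> {..<length bs} \<rightarrow> carrier R" "a' \<in> {..<length bs} \<rightarrow> carrier R"
    by auto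
  with coord_lincomb[OF bs] *(3) have "a i = a' i" if "i < length bs" for i
    using that by metis
  with *(1,2) show "a = a'"
    by (intro PiE_ext) auto
qed

lemma lincomb_orth_image:
  assumes bs: "orth_list R V bs"
  shows "lincomb (length bs) ((!) bs) ` ({..<length bs} \<rightarrow>\<^sub>E carrier R) \<subseteq> carrier V"
  using orth_list_nth[OF bs] by (auto intro!: lincomb_closed)

text \<open>Coefficients can be recovered from a combination of the list by \<open>coord\<close>, so
  the combinations are \<open>card (carrier R) ^ length bs\<close> distinct elements of a set of
  size \<open>card (carrier R) ^ rk R V\<close>.\<close>

lemma orth_list_length:
  assumes bs: "orth_list R V bs"
  shows "length bs \<le> rk R V"
proof -
  have "card (carrier R) ^ length bs \<le> card (carrier R) ^ rk R V"
    using card_inj_on_le[OF inj_on_lincomb_orth[OF bs] lincomb_orth_image[OF bs] finite_carrier]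
    by (simp add: card_carrier card_funcsetE)
  then show ?thesis
    using card_R_ge_2 by (simp add: power_increasing_iff)
qed

text \<open>At full length, the injective map from coefficients to combinations runs between finite
  sets of equal size, so it is onto; \<open>coord\<close> then reads off the coefficients.\<close>

lemma frame_expand:
  assumes bs: "orth_list R V bs" and len: "length bs = rk R V" and v: "v \<in> carrier V"
  shows "v = lincomb (length bs) ((!) bs) (coord bs v)"
proof -
  have "lincomb (length bs) ((!) bs) ` ({..<length bs} \<rightarrow>\<^sub>E carrier R) = carrier V"
    using lincomb_orth_image[OF bs] finite_carrier card_image[OF inj_on_lincomb_orth[OF bs]]
    by (intro card_subset_eq) (auto simp: card_carrier card_funcsetE len)
  then obtain a where a: "a \<in> {..<length bs} \<rightarrow>\<^sub>E carrier R" "v = lincomb (length bs) ((!) bs) a"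
    using v by blast
  then have "coord bs v i = a i" if "i < length bs" for i
    using coord_lincomb[OF bs _ that] by (auto simp: PiE_iff)
  then have "lincomb (length bs) ((!) bs) (coord bs v) = lincomb (length bs) ((!) bs) a"
    unfolding lincomb_def using a orth_list_nth[OF bs]
    by (intro M.finsum_cong') (auto simp: PiE_iff)
  with a show ?thesis by simp
qed

section \<open>Orthogonal complements and the existence of frames\<close>

definition perp :: "'v list \<Rightarrow> 'v set" where
  "perp bs = {x \<in> carrier V. \<forall>i<length bs. form V x (bs ! i) = \<zero>}"

lemma perp_add: "\<lbrakk>orth_list R V bs; x \<in> perp bs; y \<in> perp bs\<rbrakk> \<Longrightarrow> x \<oplus>\<^bsub>V\<^esub> y \<in> perp bs"
  by (auto simp: perp_def form_add orth_list_nth)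

lemma perp_smult: "\<lbrakk>orth_list R V bs; a \<in> carrier R; x \<in> perp bs\<rbrakk> \<Longrightarrow> a \<odot>\<^bsub>V\<^esub> x \<in> perp bs"
  by (auto simp: perp_def form_smult orth_list_nth)

lemma perp_form_lincomb:
  assumes "orth_list R V bs" "x \<in> perp bs" "a \<in> {..<length bs} \<rightarrow> carrier R"
  shows "form V (lincomb (length bs) ((!) bs) a) x = \<zero>"
  unfolding lincomb_def using assms orth_list_nth[OF assms(1)]
  by (intro form_finsum_zero) (auto simp: perp_def Pi_iff form_smult form_sym[of "bs ! _" x])

lemma perp_decomp:
  assumes bs: "orth_list R V bs" and x: "x \<in> carrier V"
  obtains p where "p \<in> perp bs" "x = lincomb (length bs) ((!) bs) (coord bs x) \<oplus>\<^bsub>V\<^esub> p"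
proof -
  let ?l = "lincomb (length bs) ((!) bs) (coord bs x)"
  let ?p = "\<ominus>\<^bsub>V\<^esub> ?l \<oplus>\<^bsub>V\<^esub> x"
  have l: "?l \<in> carrier V"
    using coord_closed[OF bs x] orth_list_nth[OF bs] by (intro lincomb_closed) auto
  have "form V ?p (bs ! i) = \<zero>" if "i < length bs" for i
  proof -
    have "form V ?l (bs ! i) = form V x (bs ! i)"
      using form_lincomb[OF bs coord_closed[OF bs x] that] orth_list_nth[OF bs that] x
      by (simp add: coord_def R.m_assoc form_closed)
    then show ?thesis
      using orth_list_nth[OF bs that] l x
      by (simp add: form_add form_minus_left form_closed R.l_neg)
  qed
  then have "?p \<in> perp bs"
    using l x by (simp add: perp_def)
  moreover have "x = ?l \<oplus>\<^bsub>V\<^esub> ?p"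
    using l x by (simp add: M.r_neg2)
  ultimately show thesis
    using that by blast
qed

text \<open>If \<open>t\<close> annihilates the form on the complement, then \<open>t x\<close> is
  determined by its pairings with the \<open>length bs\<close> vectors of the list: when these
  vanish, \<open>t x\<close> pairs to zero with everything. The pairings lie in \<open>tR\<close>,
  while the elements \<open>t x\<close> correspond to all families of \<open>rk R V\<close>
  coefficients in \<open>tR\<close>. For nonzero \<open>t\<close> the set \<open>tR\<close> has at
  least two elements, so such an injection contradicts \<open>length bs < rk R V\<close>.\<close>

lemma perp_faithful:
  assumes bs: "orth_list R V bs" and len: "length bs < rk R V" and t: "t \<in> carrier R"
    and kill: "\<And>p p'. \<lbrakk>p \<in> perp bs; p' \<in> perp bs\<rbrakk> \<Longrightarrow> t \<otimes> form V p p' = \<zero>"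
  shows "t = \<zero>"
proof (rule ccontr)
  assume nz: "t \<noteq> \<zero>"
  define tR where "tR = (\<lambda>r. t \<otimes> r) ` carrier R"
  let ?n = "rk R V" and ?k = "length bs"
  have smult_zero: "t \<odot>\<^bsub>V\<^esub> x = \<zero>\<^bsub>V\<^esub>"
    if x: "x \<in> carrier V" and 0: "\<And>i. i < ?k \<Longrightarrow> t \<otimes> form V x (bs ! i) = \<zero>" for x
  proof (rule nondegenerate_zero)
    fix y assume y: "y \<in> carrier V"
    obtain p where p: "p \<in> perp bs" "x = lincomb ?k ((!) bs) (coord bs x) \<oplus>\<^bsub>V\<^esub> p"
      using perp_decomp[OF bs x] .
    obtain q where q: "q \<in> perp bs" "y = lincomb ?k ((!) bs) (coord bs y) \<oplus>\<^bsub>V\<^esub> q"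
      using perp_decomp[OF bs y] .
    let ?lx = "lincomb ?k ((!) bs) (coord bs x)" and ?ly = "lincomb ?k ((!) bs) (coord bs y)"
    have c: "?lx \<in> carrier V" "?ly \<in> carrier V" "p \<in> carrier V" "q \<in> carrier V"
      using coord_closed[OF bs x] coord_closed[OF bs y] orth_list_nth[OF bs] p(1) q(1)
      by (auto simp: perp_def intro!: lincomb_closed)
    have tx: "t \<odot>\<^bsub>V\<^esub> x \<in> perp bs"
      using x 0 t orth_list_nth[OF bs] by (simp add: perp_def form_smult)
    have "form V (t \<odot>\<^bsub>V\<^esub> x) y = form V (t \<odot>\<^bsub>V\<^esub> x) ?ly \<oplus> form V (t \<odot>\<^bsub>V\<^esub> x) q"
      using c x t by (subst q(2)) (simp add: form_add_right)
    also have "form V (t \<odot>\<^bsub>V\<^esub> x) ?ly = \<zero>"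
      using perp_form_lincomb[OF bs tx coord_closed[OF bs y]] c x t
      by (simp add: form_sym[of _ ?ly])
    also have "form V (t \<odot>\<^bsub>V\<^esub> x) q = t \<otimes> (form V ?lx q \<oplus> form V p q)"
      using c t x by (subst p(2)) (simp add: form_smult form_add)
    also have "\<dots> = \<zero>"
      using perp_form_lincomb[OF bs q(1) coord_closed[OF bs x]] kill[OF p(1) q(1)] c
      by (simp add: form_closed)
    finally show "form V (t \<odot>\<^bsub>V\<^esub> x) y = \<zero>"
      by simp
  qed (use t x in simp)
  obtain b where b: "b \<in> {..<?n} \<rightarrow> carrier V"
    and bij: "bij_betw (lincomb ?n b) ({..<?n} \<rightarrow>\<^sub>E carrier R) (carrier V)"
    using basis .
  have tR: "tR \<subseteq> carrier R" "finite tR"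
    using t finite_R by (auto simp: tR_def)
  have ex: "\<exists>x\<in>carrier V. lincomb ?n b a = t \<odot>\<^bsub>V\<^esub> x" if "a \<in> {..<?n} \<rightarrow>\<^sub>E tR" for a
  proof -
    have "\<forall>i\<in>{..<?n}. \<exists>r\<in>carrier R. a i = t \<otimes> r"
      using that by (auto simp: tR_def PiE_iff)
    then obtain r where r: "\<And>i. i < ?n \<Longrightarrow> r i \<in> carrier R" "\<And>i. i < ?n \<Longrightarrow> a i = t \<otimes> r i"
      by (metis lessThan_iff)
    then show ?thesis
      using b t by (intro bexI[of _ "lincomb ?n b r"] lincomb_smult lincomb_closed) auto
  qed
  define F where "F a = (\<lambda>i\<in>{..<?k}. form V (lincomb ?n b a) (bs ! i))" for a
  have "F \<in> ({..<?n} \<rightarrow>\<^sub>E tR) \<rightarrow> ({..<?k} \<rightarrow>\<^sub>E tR)"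
  proof
    fix a assume "a \<in> {..<?n} \<rightarrow>\<^sub>E tR"
    then obtain x where "x \<in> carrier V" "lincomb ?n b a = t \<odot>\<^bsub>V\<^esub> x"
      using ex by blast
    then show "F a \<in> {..<?k} \<rightarrow>\<^sub>E tR"
      using t orth_list_nth[OF bs] by (auto simp: F_def tR_def form_smult form_closed)
  qed
  moreover have "inj_on F ({..<?n} \<rightarrow>\<^sub>E tR)"
  proof (rule inj_onI)
    fix a a' assume a: "a \<in> {..<?n} \<rightarrow>\<^sub>E tR" "a' \<in> {..<?n} \<rightarrow>\<^sub>E tR" and eq: "F a = F a'"
    obtain x x' where x: "x \<in> carrier V" "lincomb ?n b a = t \<odot>\<^bsub>V\<^esub> x"
      "x' \<in> carrier V" "lincomb ?n b a' = t \<odot>\<^bsub>V\<^esub> x'"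
      using ex a by metis
    let ?d = "x \<oplus>\<^bsub>V\<^esub> \<ominus>\<^bsub>V\<^esub> x'"
    have "t \<otimes> form V ?d (bs ! i) = \<zero>" if "i < ?k" for i
    proof -
      have "F a i = F a' i"
        by (simp only: eq)
      then have "t \<otimes> form V x (bs ! i) = t \<otimes> form V x' (bs ! i)"
        using that x t orth_list_nth[OF bs] by (simp add: F_def form_smult)
      then show ?thesis
        using that x t orth_list_nth[OF bs that]
        by (simp add: form_add form_minus_left form_closed R.r_distr R.r_minus R.r_neg)
    qed
    then have "t \<odot>\<^bsub>V\<^esub> ?d = \<zero>\<^bsub>V\<^esub>"
      using x by (intro smult_zero) auto
    then have "t \<odot>\<^bsub>V\<^esub> x \<oplus>\<^bsub>V\<^esub> \<ominus>\<^bsub>V\<^esub> (t \<odot>\<^bsub>V\<^esub> x') = \<zero>\<^bsub>V\<^esub>"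
      using x t by (simp add: smult_r_distr smult_r_minus)
    then have "lincomb ?n b a = lincomb ?n b a'"
      using x t by (metis M.minus_equality M.minus_minus M.a_inv_closed smult_closed M.a_comm)
    moreover have "a \<in> {..<?n} \<rightarrow>\<^sub>E carrier R" "a' \<in> {..<?n} \<rightarrow>\<^sub>E carrier R"
      using a tR by auto
    ultimately show "a = a'"
      using bij by (auto simp: bij_betw_def dest: inj_onD)
  qed
  ultimately have "card ({..<?n} \<rightarrow>\<^sub>E tR) \<le> card ({..<?k} \<rightarrow>\<^sub>E tR)"
    using tR(2) by (intro card_inj_on_le[of F]) (auto intro: finite_PiE)
  then have "card tR ^ ?n \<le> card tR ^ ?k"
    by (simp add: card_funcsetE)
  moreover have "2 \<le> card tR"
  proof -
    have "t \<in> tR" "\<zero> \<in> tR"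
      unfolding tR_def using t by (auto intro: image_eqI[of _ _ \<one>] image_eqI[of _ _ \<zero>])
    then have "card {\<zero>, t} \<le> card tR"
      using tR(2) by (intro card_mono) auto
    then show ?thesis
      using nz by auto
  qed
  ultimately show False
    using len by (simp add: power_increasing_iff)
qed

text \<open>If all norms on the complement were nilpotent on \<open>fR\<close>, a single nonzero
  \<open>t\<close> would annihilate all of them. Polarization, with 2 invertible, shows that
  \<open>t\<close> annihilates the whole form on the complement, which \<open>perp_faithful\<close>
  forbids.\<close>

lemma perp_non_nilpotent:
  assumes bs: "orth_list R V bs" and len: "length bs < rk R V" and f: "f \<in> carrier R" "f \<noteq> \<zero>"
  shows "\<exists>p\<in>perp bs. \<forall>m::nat. f \<otimes> form V p p [^] m \<noteq> \<zero>"
proof (rule ccontr)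
  assume no: "\<not> ?thesis"
  obtain t where t: "t \<in> carrier R" "t \<noteq> \<zero>"
    "\<And>b m. \<lbrakk>b \<in> carrier R; f \<otimes> b [^] (m::nat) = \<zero>\<rbrakk> \<Longrightarrow> t \<otimes> b = \<zero>"
    using annihilates_nilpotent[OF finite_R f] by blast
  have perp: "p \<in> carrier V" if "p \<in> perp bs" for p
    using that by (simp add: perp_def)
  have diag: "t \<otimes> form V p p = \<zero>" if "p \<in> perp bs" for p
    using no that t(3) form_closed perp by blast
  have "t \<otimes> form V p p' = \<zero>" if p: "p \<in> perp bs" "p' \<in> perp bs" for p p'
  proof -
    have c: "form V p p' \<in> carrier R" "form V p p \<in> carrier R" "form V p' p' \<in> carrier R"
      using p perp form_closed by auto
    have "\<zero> = t \<otimes> form V (p \<oplus>\<^bsub>V\<^esub> p') (p \<oplus>\<^bsub>V\<^esub> p')"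
      using diag perp_add[OF bs p] by simp
    also have "\<dots> = t \<otimes> form V p p \<oplus> t \<otimes> form V p' p' \<oplus> (\<one> \<oplus> \<one>) \<otimes> (t \<otimes> form V p p')"
      using p perp t c by (simp add: form_add form_add_right form_sym[of p' p] R.r_distr R.l_distr R.a_ac)
    also have "\<dots> = (\<one> \<oplus> \<one>) \<otimes> (t \<otimes> form V p p')"
      using diag p t c by simp
    finally have "(\<one> \<oplus> \<one>) \<otimes> (t \<otimes> form V p p') = (\<one> \<oplus> \<one>) \<otimes> \<zero>"
      by (metis R.r_null R.Units_closed two_unit)
    then show ?thesis
      using R.Units_l_cancel[OF two_unit, of "t \<otimes> form V p p'" \<zero>] t c
      by (metis R.m_closed R.zero_closed)
  qed
  then show False
    using perp_faithful[OF bs len t(1)] t(2) by blast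
qed

text \<open>A vector whose norm is non-nilpotent on one factor of \<open>R\<close> need not have
  unit norm, so vectors must be glued along idempotents. Instead of decomposing \<open>R\<close>
  into local factors, \<open>w\<close> is chosen such that its norm is nilpotent on as little of
  \<open>R\<close> as possible, and any defect is repaired by one gluing step.\<close>

lemma orth_list_extend1:
  assumes bs: "orth_list R V bs" and len: "length bs < rk R V"
  shows "\<exists>w\<in>perp bs. form V w w \<in> Units R"
proof -
  \<comment> \<open>\<open>Z w\<close> is the kernel of the localization of \<open>R\<close> at the
    norm of \<open>w\<close>; it is \<open>{\<zero>}\<close> exactly when that norm is a unit,
    \<open>R\<close> being finite.\<close>
  define Z where "Z w = {s \<in> carrier R. \<exists>m::nat. s \<otimes> form V w w [^] m = \<zero>}" for w
  have "\<zero>\<^bsub>V\<^esub> \<in> perp bs"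
    using orth_list_nth[OF bs] by (simp add: perp_def)
  then obtain w where w: "w \<in> perp bs" and min: "\<And>w'. w' \<in> perp bs \<Longrightarrow> card (Z w) \<le> card (Z w')"
    using ex_has_least_nat[of "\<lambda>w. w \<in> perp bs" "\<zero>\<^bsub>V\<^esub>" "\<lambda>w. card (Z w)"] by blast
  have wc: "w \<in> carrier V"
    using w by (simp add: perp_def)
  let ?b = "form V w w"
  have b: "?b \<in> carrier R"
    using wc form_closed by simp
  obtain M :: nat where M: "M \<ge> 1" "?b [^] M \<otimes> ?b [^] M = ?b [^] M"
    using R.finite_idempotent_power[OF finite_R b] by blast
  define e where "e = ?b [^] M"
  define f where "f = \<one> \<ominus> e"
  have e: "e \<in> carrier R" "e \<otimes> e = e" and fc: "f \<in> carrier R"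
    using b M by (auto simp: e_def f_def)
  have ef: "e \<otimes> f = \<zero>"
    using e by (simp add: f_def R.minus_eq R.r_distr R.r_minus R.r_neg)
  have ff: "f \<otimes> f = f"
  proof -
    have "f \<otimes> f = f \<otimes> \<one> \<oplus> \<ominus> (f \<otimes> e)"
      using fc e(1) by (subst (2) f_def) (simp add: R.minus_eq R.r_distr R.r_minus)
    then show ?thesis
      using fc e(1) ef by (simp add: R.m_comm)
  qed
  have "f = \<zero>"
  proof (rule ccontr)
    assume "f \<noteq> \<zero>"
    then obtain p where p: "p \<in> perp bs" "\<And>m::nat. f \<otimes> form V p p [^] m \<noteq> \<zero>"
      using perp_non_nilpotent[OF bs len fc] by blast
    have pc: "p \<in> carrier V"
      using p by (simp add: perp_def)
    \<comment> \<open>On \<open>eR\<close> the vector \<open>w'\<close> keeps the norm of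
      \<open>w\<close>, and on \<open>fR\<close> it has the norm of \<open>p\<close>. Hence
      \<open>Z w'\<close> is contained in \<open>Z w\<close> but loses \<open>f\<close>, contrary to
      the choice of \<open>w\<close>.\<close>
    define w' where "w' = e \<odot>\<^bsub>V\<^esub> w \<oplus>\<^bsub>V\<^esub> f \<odot>\<^bsub>V\<^esub> p"
    have w': "w' \<in> perp bs"
      unfolding w'_def using bs w p(1) e fc by (intro perp_add perp_smult)
    have c: "form V w p \<in> carrier R" "form V p p \<in> carrier R"
      using wc pc form_closed by auto
    have "form V w' w' = e \<otimes> e \<otimes> ?b \<oplus> (e \<otimes> f) \<otimes> form V w p \<oplus> ((e \<otimes> f) \<otimes> form V w p \<oplus> f \<otimes> f \<otimes> form V p p)"
      unfolding w'_def using wc pc e(1) fc b c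
      by (simp add: form_add form_add_right form_smult form_smult_right form_sym[of p w] R.m_ac R.r_distr)
    also have "\<dots> = e \<otimes> ?b \<oplus> (\<one> \<ominus> e) \<otimes> form V p p"
      using e b c fc by (simp add: ef ff flip: f_def)
    finally have ww: "form V w' w' = e \<otimes> ?b \<oplus> (\<one> \<ominus> e) \<otimes> form V p p" .
    note split = R.idempotent_split_power[OF e(1) b c(2) e(2), folded ww]
    have w'c: "form V w' w' \<in> carrier R"
      using w' form_closed by (simp add: perp_def)
    have "Z w' \<subseteq> Z w"
    proof
      fix s assume "s \<in> Z w'"
      then obtain m :: nat where s: "s \<in> carrier R" "s \<otimes> form V w' w' [^] m = \<zero>"
        by (auto simp: Z_def)
      have "s \<otimes> ?b [^] (M + m) = s \<otimes> (e \<otimes> ?b [^] m)"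
        using b by (simp add: e_def R.nat_pow_mult)
      also have "\<dots> = e \<otimes> (s \<otimes> form V w' w' [^] m)"
        unfolding split(1)[symmetric] using s(1) e(1) w'c by (simp add: R.m_lcomm)
      also have "\<dots> = \<zero>"
        using s e by simp
      finally show "s \<in> Z w"
        using s(1) unfolding Z_def by blast
    qed
    moreover have "f \<in> Z w"
    proof -
      have "f \<otimes> ?b [^] M = \<zero>"
        using ef e(1) fc by (simp add: R.m_comm flip: e_def)
      then show ?thesis
        using fc unfolding Z_def by blast
    qed
    moreover have "f \<notin> Z w'"
      using p(2) split(2) by (simp add: Z_def f_def)
    ultimately have "Z w' \<subset> Z w"
      by blast
    moreover have "finite (Z w)"
      using finite_R by (simp add: Z_def)
    ultimately show False
      using min[OF w'] psubset_card_mono by (metis leD)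
  qed
  then have "e = \<one>"
    using e(1) unfolding f_def by (metis R.minus_eq R.minus_equality R.minus_minus R.one_closed R.a_inv_closed R.r_neg R.add.inv_solve_right' R.l_zero)
  moreover have "e = ?b [^] (M - 1) \<otimes> ?b"
    using M(1) b by (metis e_def Suc_pred' R.nat_pow_Suc less_eq_Suc_le One_nat_def)
  ultimately have "?b \<in> Units R"
    using b unfolding Units_def by (auto simp: R.m_comm intro!: bexI[of _ "?b [^] (M - 1)"])
  with w show ?thesis by blast
qed

lemma orth_list_snoc:
  assumes bs: "orth_list R V bs" and w: "w \<in> perp bs" and unit: "form V w w \<in> Units R"
  shows "orth_list R V (bs @ [w])"
proof -
  have wc: "w \<in> carrier V"
    using w by (simp add: perp_def)
  have 0: "form V w (bs ! i) = \<zero>" "form V (bs ! i) w = \<zero>" if "i < length bs" for i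
    using w that orth_list_nth(1)[OF bs that] form_sym[of w "bs ! i"] by (auto simp: perp_def)
  show ?thesis
    using bs unit wc 0 unfolding orth_list_def by (auto simp: nth_append less_Suc_eq)
qed

lemma orth_list_extend:
  assumes "orth_list R V bs"
  shows "\<exists>cs. orth_list R V (bs @ cs) \<and> length (bs @ cs) = rk R V"
  using assms
proof (induction "rk R V - length bs" arbitrary: bs)
  case 0
  then show ?case
    using orth_list_length[of bs] by (intro exI[of _ "[]"]) auto
next
  case (Suc n)
  then have "length bs < rk R V"
    by linarith
  then obtain w where w: "w \<in> perp bs" "form V w w \<in> Units R"
    using orth_list_extend1[OF Suc.prems] by blast
  have "\<exists>cs. orth_list R V ((bs @ [w]) @ cs) \<and> length ((bs @ [w]) @ cs) = rk R V"
    using Suc.hyps(2) orth_list_snoc[OF Suc.prems w] by (intro Suc.hyps(1)) auto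
  then show ?case
    by (metis append_assoc)
qed

end

section \<open>Isometries\<close>

lemma (in cring) difference_of_squares:
  assumes "\<one> \<oplus> \<one> \<in> Units R" "c \<in> carrier R"
  shows "\<exists>x\<in>carrier R. \<exists>y\<in>carrier R. x \<otimes> x \<ominus> y \<otimes> y = c"
proof -
  \<comment> \<open>With \<open>x = y + 1\<close> the difference of squares is
    \<open>2 y + 1\<close>, which is solved for \<open>y\<close>.\<close>
  define y where "y = inv (\<one> \<oplus> \<one>) \<otimes> (c \<ominus> \<one>)"
  have y: "y \<in> carrier R"
    using assms by (simp add: y_def)
  have "(\<one> \<oplus> \<one>) \<otimes> y = c \<ominus> \<one>"
    using assms by (simp add: y_def flip: m_assoc)
  then have "y \<oplus> y = c \<ominus> \<one>"
    using y by (simp add: l_distr)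
  moreover have "(y \<oplus> \<one>) \<otimes> (y \<oplus> \<one>) \<ominus> y \<otimes> y = (y \<oplus> y) \<oplus> \<one>"
    using y by algebra
  moreover have "(c \<ominus> \<one>) \<oplus> \<one> = c"
    using assms(2) by algebra
  ultimately show ?thesis
    using y by (intro bexI[of _ "y \<oplus> \<one>"] bexI[of _ y]) auto
qed

lemma card_fibre_pigeonhole:
  assumes "finite U" "f ` L \<subseteq> U" "card U * n \<le> card L" "finite L" "U \<noteq> {}"
  shows "\<exists>u\<in>U. n \<le> card {k \<in> L. f k = u}"
proof (rule ccontr)
  assume "\<not> ?thesis"
  then have lt: "card {k \<in> L. f k = u} < n" if "u \<in> U" for u
    using that by auto
  have "card L = card (\<Union>u\<in>U. {k \<in> L. f k = u})"
    using assms(2) by (intro arg_cong[of _ _ card]) auto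
  also have "\<dots> \<le> (\<Sum>u\<in>U. card {k \<in> L. f k = u})"
    using assms(1) by (rule card_UN_le)
  also have "\<dots> < (\<Sum>u\<in>U. n)"
    using assms(1,5) lt by (intro sum_strict_mono) auto
  also have "\<dots> \<le> card L"
    using assms(3) by simp
  finally show False by simp
qed

section \<open>Sums of orthogonal vectors and representation of scalars\<close>

context finite_orthogonal_module
begin

lemma add_pow_card: "q \<in> carrier R \<Longrightarrow> [card (carrier R)] \<cdot> q = \<zero>"
  using R.add.pow_order_eq_1[of q] by (simp add: order_def)

lemma add_pow_mod_card:
  assumes "q \<in> carrier R" "m mod card (carrier R) = 1 mod card (carrier R)"
  shows "[m] \<cdot> q = q"
proof -
  let ?n = "card (carrier R)"
  have "m = ?n * (m div ?n) + 1"
    using assms(2) card_R_ge_2 mult_div_mod_eq[of ?n m] by simp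
  moreover have "[(?n * (m div ?n))] \<cdot> q = \<zero>"
    using assms(1) add_pow_card by (simp flip: R.add.nat_pow_pow)
  ultimately show ?thesis
    using assms(1) R.add.nat_pow_mult[of q "?n * (m div ?n)" 1]
    by (metis R.add.nat_pow_eone R.l_zero)
qed

lemma sum_closed:
  "\<lbrakk>orth_list R V bs; A \<subseteq> {..<length bs}\<rbrakk> \<Longrightarrow> (\<Oplus>\<^bsub>V\<^esub>k\<in>A. bs ! k) \<in> carrier V"
  using orth_list_nth[of bs] by (intro M.finsum_closed) auto

lemma form_sum_nth:
  assumes bs: "orth_list R V bs" and A: "A \<subseteq> {..<length bs}" and i: "i < length bs"
  shows "form V (\<Oplus>\<^bsub>V\<^esub>k\<in>A. bs ! k) (bs ! i) = (if i \<in> A then form V (bs ! i) (bs ! i) else \<zero>)"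
proof -
  have "finite A" "(!) bs \<in> A \<rightarrow> carrier V"
    using A orth_list_nth[OF bs] finite_subset[OF A] by auto
  moreover have "form V (bs ! j) (bs ! i) = \<zero>" if "j \<in> A" "j \<noteq> i" for j
    using orth_list_orth[OF bs _ i] A that by auto
  ultimately show ?thesis
    using form_finsum_single[of A "(!) bs" "bs ! i" i] form_finsum_zero[of A "(!) bs" "bs ! i"]
      orth_list_nth(1)[OF bs i] by metis
qed

lemma form_sum_sum:
  assumes bs: "orth_list R V bs" and A: "A \<subseteq> {..<length bs}" "B \<subseteq> {..<length bs}"
  shows "A \<inter> B = {} \<Longrightarrow> form V (\<Oplus>\<^bsub>V\<^esub>k\<in>A. bs ! k) (\<Oplus>\<^bsub>V\<^esub>k\<in>B. bs ! k) = \<zero>"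
    and "(\<And>k. k \<in> A \<Longrightarrow> form V (bs ! k) (bs ! k) = q) \<Longrightarrow> q \<in> carrier R \<Longrightarrow>
      form V (\<Oplus>\<^bsub>V\<^esub>k\<in>A. bs ! k) (\<Oplus>\<^bsub>V\<^esub>k\<in>A. bs ! k) = [card A] \<cdot> q"
proof -
  have fin: "finite A" "(!) bs \<in> A \<rightarrow> carrier V"
    using A(1) orth_list_nth[OF bs] finite_subset[OF A(1)] by auto
  have swap: "form V (bs ! k) (\<Oplus>\<^bsub>V\<^esub>l\<in>C. bs ! l) = (if k \<in> C then form V (bs ! k) (bs ! k) else \<zero>)"
    if "C \<subseteq> {..<length bs}" "k \<in> A" for C k
  proof -
    have k: "k < length bs"
      using A that by auto
    show ?thesis
      using form_sum_nth[OF bs that(1) k] form_sym[OF orth_list_nth(1)[OF bs k] sum_closed[OF bs that(1)]]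
      by simp
  qed
  show "form V (\<Oplus>\<^bsub>V\<^esub>k\<in>A. bs ! k) (\<Oplus>\<^bsub>V\<^esub>k\<in>B. bs ! k) = \<zero>" if "A \<inter> B = {}"
    using fin sum_closed[OF bs A(2)] swap[OF A(2)] that by (intro form_finsum_zero) auto
  assume q: "\<And>k. k \<in> A \<Longrightarrow> form V (bs ! k) (bs ! k) = q" "q \<in> carrier R"
  have "form V (\<Oplus>\<^bsub>V\<^esub>k\<in>A. bs ! k) (\<Oplus>\<^bsub>V\<^esub>k\<in>A. bs ! k) = (\<Oplus>k\<in>A. q)"
    unfolding form_finsum_left[OF fin sum_closed[OF bs A(1)]]
    using swap[OF A(1)] q by (intro R.finsum_cong') auto
  also have "\<dots> = [card A] \<cdot> q"
    using q(2) by (rule R.add.finprod_const)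
  finally show "form V (\<Oplus>\<^bsub>V\<^esub>k\<in>A. bs ! k) (\<Oplus>\<^bsub>V\<^esub>k\<in>A. bs ! k) = [card A] \<cdot> q" .
qed

text \<open>Among many orthogonal vectors there are \<open>n = |R|\<close> of the same norm \<open>u\<close>. The sum of
  \<open>n - 1\<close> of them has norm \<open>-u\<close>, so together with the last one they span a hyperbolic
  plane, which represents everything.\<close>

lemma represent_unit:
  assumes bs: "orth_list R V bs" and a: "a \<in> carrier R"
    and len: "length bs + card (carrier R) * card (carrier R) \<le> rk R V"
  shows "\<exists>z\<in>perp bs. form V z z = a"
proof -
  let ?n = "card (carrier R)"
  obtain cs where fs: "orth_list R V (bs @ cs)" and lfs: "length (bs @ cs) = rk R V"
    using orth_list_extend[OF bs] by blast
  define fs where "fs = bs @ cs"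
  define L where "L = {length bs..<length fs}"
  note fs = fs[folded fs_def]
  \<comment> \<open>There are at most \<open>?n\<close> possible norms, so \<open>?n * ?n\<close>
    vectors beyond \<open>bs\<close> force \<open>?n\<close> of them to have equal norm.\<close>
  have "(\<lambda>k. form V (fs ! k) (fs ! k)) ` L \<subseteq> carrier R" "?n * ?n \<le> card L"
    using orth_list_nth[OF fs] len lfs by (auto simp: L_def fs_def)
  then obtain u where u: "u \<in> carrier R" "?n \<le> card {k \<in> L. form V (fs ! k) (fs ! k) = u}"
    using card_fibre_pigeonhole[OF finite_R, of "\<lambda>k. form V (fs ! k) (fs ! k)" L ?n]
    by (auto simp: L_def)
  obtain A' where A': "A' \<subseteq> {k \<in> L. form V (fs ! k) (fs ! k) = u}" "card A' = ?n" "finite A'"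
    using obtain_subset_with_card_n[OF u(2)] .
  moreover have "?n \<noteq> 0"
    using card_R_ge_2 by simp
  ultimately obtain k where k: "k \<in> A'"
    by fastforce
  define A where "A = A' - {k}"
  have A: "A \<subseteq> {..<length fs}" "k < length fs" "k \<notin> A" "length bs \<le> k" "\<And>i. i < length bs \<Longrightarrow> i \<notin> A"
    "form V (fs ! k) (fs ! k) = u" "\<And>i. i \<in> A \<Longrightarrow> form V (fs ! i) (fs ! i) = u"
    using A'(1) k by (auto simp: A_def L_def)
  have "Suc (card A) = ?n"
    using card_Suc_Diff1[OF A'(3) k] A'(2) by (simp only: A_def)
  have uu: "u \<in> Units R"
    using orth_list_nth(2)[OF fs A(2)] A(6) by simp
  define w where "w = (\<Oplus>\<^bsub>V\<^esub>i\<in>A. fs ! i)"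
  have w: "w \<in> carrier V"
    unfolding w_def by (rule sum_closed[OF fs A(1)])
  have "form V w w = [card A] \<cdot> u"
    unfolding w_def using A(7) u(1) by (rule form_sum_sum(2)[OF fs A(1) A(1)])
  moreover have "[card A] \<cdot> u \<oplus> u = \<zero>"
    using add_pow_card[OF u(1)] \<open>Suc (card A) = ?n\<close> by (metis R.add.nat_pow_Suc)
  ultimately have ww: "form V w w = \<ominus> u"
    using u(1) by (metis R.minus_equality R.add.nat_pow_closed)
  have wk: "form V w (fs ! k) = \<zero>"
    unfolding w_def using form_sum_nth[OF fs A(1,2)] A(3) by simp
  \<comment> \<open>The orthogonal vectors \<open>fs ! k\<close> and \<open>w\<close> have norms
    \<open>u\<close> and \<open>-u\<close>, so their combination with coefficients \<open>x\<close>
    and \<open>y\<close> has norm \<open>(x^2 - y^2) u\<close>.\<close>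
  obtain x y where xy: "x \<in> carrier R" "y \<in> carrier R" "x \<otimes> x \<ominus> y \<otimes> y = a \<otimes> inv u"
    using R.difference_of_squares[OF two_unit, of "a \<otimes> inv u"] a uu by auto
  have fk: "fs ! k \<in> carrier V"
    by (rule orth_list_nth(1)[OF fs A(2)])
  define z where "z = x \<odot>\<^bsub>V\<^esub> (fs ! k) \<oplus>\<^bsub>V\<^esub> y \<odot>\<^bsub>V\<^esub> w"
  have "form V z z = x \<otimes> (x \<otimes> u) \<oplus> y \<otimes> (y \<otimes> (\<ominus> u))"
    unfolding z_def using xy(1,2) fk w u(1) wk form_sym[OF w fk]
    by (simp add: form_add form_add_right form_smult form_smult_right A(6) ww)
  also have "\<dots> = (x \<otimes> x \<ominus> y \<otimes> y) \<otimes> u"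
    using xy(1,2) u(1) by algebra
  also have "\<dots> = a"
    unfolding xy(3) using a uu u(1) by (simp add: R.m_assoc)
  finally have "form V z z = a" .
  moreover have "form V z (bs ! i) = \<zero>" if "i < length bs" for i
  proof -
    have bi: "bs ! i = fs ! i" "i < length fs" "i \<noteq> k"
      using that A(4) by (auto simp: fs_def nth_append)
    have "form V (fs ! k) (fs ! i) = \<zero>" "form V w (fs ! i) = \<zero>"
      using orth_list_orth[OF fs A(2) bi(2)] bi form_sum_nth[OF fs A(1) bi(2)] A(5)[OF that]
      by (auto simp: w_def)
    then show ?thesis
      using xy(1,2) fk w orth_list_nth(1)[OF fs bi(2)] by (simp add: z_def bi(1) form_add form_smult)
  qed
  moreover have "z \<in> carrier V"
    using xy fk w by (simp add: z_def)
  ultimately show ?thesis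
    by (auto simp: perp_def)
qed

lemma represent_units:
  assumes "orth_list R V bs" and "set us \<subseteq> Units R"
    and "length bs + card (carrier R) * card (carrier R) + length us \<le> rk R V"
  shows "\<exists>zs. length zs = length us \<and> orth_list R V (bs @ zs) \<and>
    (\<forall>i<length us. form V (zs ! i) (zs ! i) = us ! i)"
  using assms
proof (induction us arbitrary: bs)
  case Nil
  then show ?case by auto
next
  case (Cons u us)
  then have "length bs + card (carrier R) * card (carrier R) \<le> rk R V" "u \<in> carrier R" "u \<in> Units R"
    by auto
  with Cons.prems obtain z where z: "z \<in> perp bs" "form V z z = u"
    using represent_unit by metis
  then have "orth_list R V (bs @ [z])"
    using Cons.prems(1) \<open>u \<in> Units R\<close> by (intro orth_list_snoc) auto
  then have "\<exists>zs. length zs = length us \<and> orth_list R V ((bs @ [z]) @ zs) \<and>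
      (\<forall>i<length us. form V (zs ! i) (zs ! i) = us ! i)"
    using Cons.prems by (intro Cons.IH) auto
  then obtain zs where "length zs = length us" "orth_list R V ((bs @ [z]) @ zs)"
    "\<forall>i<length us. form V (zs ! i) (zs ! i) = us ! i"
    by blast
  with z(2) show ?case
    by (intro exI[of _ "z # zs"]) (auto simp: nth_Cons split: nat.split)
qed

lemma lincomb_add:
  assumes "b \<in> {..<n} \<rightarrow> carrier V" "a \<in> {..<n} \<rightarrow> carrier R" "a' \<in> {..<n} \<rightarrow> carrier R"
    and "\<And>i. i < n \<Longrightarrow> c i = a i \<oplus> a' i"
  shows "lincomb n b c = lincomb n b a \<oplus>\<^bsub>V\<^esub> lincomb n b a'"
proof -
  have "lincomb n b a \<oplus>\<^bsub>V\<^esub> lincomb n b a' = (\<Oplus>\<^bsub>V\<^esub>i\<in>{..<n}. a i \<odot>\<^bsub>V\<^esub> b i \<oplus>\<^bsub>V\<^esub> a' i \<odot>\<^bsub>V\<^esub> b i)"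
    unfolding lincomb_def using assms by (intro M.finsum_addf[symmetric]) (auto simp: Pi_iff)
  also have "\<dots> = lincomb n b c"
    unfolding lincomb_def using assms
    by (intro M.finsum_cong') (auto simp: Pi_iff smult_l_distr)
  finally show ?thesis by simp
qed

lemma form_lincomb_lincomb:
  assumes h: "h \<in> {..<n} \<rightarrow> carrier V" and q: "\<And>i j. \<lbrakk>i < n; j < n\<rbrakk> \<Longrightarrow> form V (h i) (h j) = (if i = j then q i else \<zero>)"
    and a: "a \<in> {..<n} \<rightarrow> carrier R" "a' \<in> {..<n} \<rightarrow> carrier R"
  shows "form V (lincomb n h a) (lincomb n h a') = (\<Oplus>i\<in>{..<n}. a i \<otimes> (a' i \<otimes> q i))"
proof -
  have l: "lincomb n h a' \<in> carrier V"
    using h a by (rule_tac lincomb_closed)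
  have hi: "h i \<in> carrier V" "a i \<in> carrier R" "a' i \<in> carrier R" "q i \<in> carrier R" if "i < n" for i
    using h a that q[of i i] form_closed[of "h i" "h i"] by (auto simp: Pi_iff)
  have "form V (h i) (lincomb n h a') = a' i \<otimes> q i" if i: "i < n" for i
  proof -
    have "form V (lincomb n h a') (h i) = form V (a' i \<odot>\<^bsub>V\<^esub> h i) (h i)"
      unfolding lincomb_def using hi q i by (intro form_finsum_single) (auto simp: form_smult)
    then show ?thesis
      using hi[OF i] q[OF i i] form_sym[OF l hi(1)[OF i]] by (simp add: form_smult)
  qed
  then have "form V (a i \<odot>\<^bsub>V\<^esub> h i) (lincomb n h a') = a i \<otimes> (a' i \<otimes> q i)" if "i < n" for i
    using hi[OF that] that l by (simp add: form_smult)
  moreover have "form V (lincomb n h a) (lincomb n h a') = (\<Oplus>i\<in>{..<n}. form V (a i \<odot>\<^bsub>V\<^esub> h i) (lincomb n h a'))"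
    unfolding lincomb_def[of n h a] using hi l by (intro form_finsum_left) auto
  moreover have "(\<Oplus>i\<in>{..<n}. form V (a i \<odot>\<^bsub>V\<^esub> h i) (lincomb n h a')) = (\<Oplus>i\<in>{..<n}. a i \<otimes> (a' i \<otimes> q i))"
    using hi calculation by (intro R.finsum_cong') auto
  ultimately show ?thesis
    by simp
qed

lemma form_nth_cases:
  "\<lbrakk>orth_list R V bs; i < length bs; j < length bs\<rbrakk> \<Longrightarrow>
    form V (bs ! i) (bs ! j) = (if i = j then form V (bs ! i) (bs ! i) else \<zero>)"
  by (simp add: orth_list_orth)

lemma coord_add:
  "\<lbrakk>orth_list R V bs; v \<in> carrier V; w \<in> carrier V; i < length bs\<rbrakk> \<Longrightarrow>
    coord bs (v \<oplus>\<^bsub>V\<^esub> w) i = coord bs v i \<oplus> coord bs w i"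
  by (simp add: coord_def form_add orth_list_nth R.l_distr form_closed)

lemma coord_smult:
  "\<lbrakk>orth_list R V bs; v \<in> carrier V; a \<in> carrier R; i < length bs\<rbrakk> \<Longrightarrow>
    coord bs (a \<odot>\<^bsub>V\<^esub> v) i = a \<otimes> coord bs v i"
  by (simp add: coord_def form_smult orth_list_nth R.m_assoc form_closed)

end

lemma isometriesD:
  assumes "f \<in> isometries R V W"
  shows "f \<in> linear_maps R V W" "\<And>v. v \<in> carrier V \<Longrightarrow> f v \<in> carrier W"
    "\<And>v w. \<lbrakk>v \<in> carrier V; w \<in> carrier V\<rbrakk> \<Longrightarrow> form W (f v) (f w) = form V v w"
  using assms by (auto simp: isometries_def linear_maps_def)

section \<open>Isometries prescribed on a frame\<close>

locale finite_orthogonal_pair = V: finite_orthogonal_module R V + W: finite_orthogonal_module R W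
  for R :: "('r, 's) ring_scheme" (structure) and V :: "('r, 'v) orth_module"
    and W :: "('r, 'w) orth_module"
begin

lemma linear_map_lincomb:
  assumes f: "f \<in> linear_maps R V W" and "b \<in> {..<n} \<rightarrow> carrier V" "a \<in> {..<n} \<rightarrow> carrier R"
  shows "f (V.lincomb n b a) = W.lincomb n (\<lambda>i. f (b i)) a"
  using assms(2,3)
proof (induction n)
  case 0
  have "f (\<zero> \<odot>\<^bsub>V\<^esub> \<zero>\<^bsub>V\<^esub>) = \<zero> \<odot>\<^bsub>W\<^esub> f \<zero>\<^bsub>V\<^esub>"
    by (rule linear_mapsD(3)[OF f]) auto
  then have "f \<zero>\<^bsub>V\<^esub> = \<zero>\<^bsub>W\<^esub>"
    using linear_mapsD(1)[OF f] by simp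
  then show ?case
    by (simp add: V.lincomb_def W.lincomb_def)
next
  case (Suc n)
  then have c: "b \<in> {..<n} \<rightarrow> carrier V" "a \<in> {..<n} \<rightarrow> carrier R" "b n \<in> carrier V" "a n \<in> carrier R"
    by auto
  have "V.lincomb (Suc n) b a = a n \<odot>\<^bsub>V\<^esub> b n \<oplus>\<^bsub>V\<^esub> V.lincomb n b a"
    unfolding V.lincomb_def lessThan_Suc using c
    by (intro V.M.finsum_insert) (auto simp: Pi_iff)
  moreover have "W.lincomb (Suc n) (\<lambda>i. f (b i)) a = a n \<odot>\<^bsub>W\<^esub> f (b n) \<oplus>\<^bsub>W\<^esub> W.lincomb n (\<lambda>i. f (b i)) a"
    unfolding W.lincomb_def lessThan_Suc using c linear_mapsD(1)[OF f]
    by (intro W.M.finsum_insert) (auto simp: Pi_iff)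
  ultimately show ?case
    using Suc.IH[OF c(1,2)] c V.lincomb_closed[OF c(1,2)] linear_mapsD[OF f] by simp
qed

lemma isometry_orth_list:
  assumes f: "f \<in> isometries R V W" and bs: "orth_list R V bs"
  shows "orth_list R W (map f bs)"
  using bs isometriesD[OF f] V.orth_list_nth[OF bs] unfolding orth_list_def by auto

lemma frame_isometry:
  assumes bs: "orth_list R V bs" and len: "length bs = rk R V"
    and h: "h \<in> {..<length bs} \<rightarrow> carrier W"
    and q: "\<And>i j. \<lbrakk>i < length bs; j < length bs\<rbrakk> \<Longrightarrow>
      form W (h i) (h j) = (if i = j then form V (bs ! i) (bs ! i) else \<zero>)"
  defines "\<phi> \<equiv> \<lambda>v\<in>carrier V. W.lincomb (length bs) h (V.coord bs v)"
  shows "\<phi> \<in> isometries R V W" "\<And>i. i < length bs \<Longrightarrow> \<phi> (bs ! i) = h i"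
proof -
  let ?n = "length bs"
  note co = V.coord_closed[OF bs]
  have "form W (\<phi> v) (\<phi> w) = form V v w" if v: "v \<in> carrier V" "w \<in> carrier V" for v w
  proof -
    have b: "(!) bs \<in> {..<?n} \<rightarrow> carrier V"
      using V.orth_list_nth[OF bs] by auto
    have "form V v w = form V (V.lincomb ?n ((!) bs) (V.coord bs v)) (V.lincomb ?n ((!) bs) (V.coord bs w))"
      using V.frame_expand[OF bs len] v by simp
    also have "\<dots> = (\<Oplus>i\<in>{..<?n}. V.coord bs v i \<otimes> (V.coord bs w i \<otimes> form V (bs ! i) (bs ! i)))"
      by (rule V.form_lincomb_lincomb[OF b V.form_nth_cases[OF bs] co[OF v(1)] co[OF v(2)]])
    also have "\<dots> = form W (W.lincomb ?n h (V.coord bs v)) (W.lincomb ?n h (V.coord bs w))"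
      by (rule W.form_lincomb_lincomb[OF h q co[OF v(1)] co[OF v(2)], symmetric])
    finally show ?thesis
      using v by (simp add: \<phi>_def)
  qed
  moreover have "\<phi> \<in> carrier V \<rightarrow>\<^sub>E carrier W"
    using W.lincomb_closed[OF h co] by (auto simp: \<phi>_def)
  moreover have "\<phi> (v \<oplus>\<^bsub>V\<^esub> w) = \<phi> v \<oplus>\<^bsub>W\<^esub> \<phi> w" if "v \<in> carrier V" "w \<in> carrier V" for v w
    using that W.lincomb_add[OF h co co V.coord_add[OF bs]] by (simp add: \<phi>_def)
  moreover have "\<phi> (a \<odot>\<^bsub>V\<^esub> v) = a \<odot>\<^bsub>W\<^esub> \<phi> v" if "a \<in> carrier R" "v \<in> carrier V" for a v
    using that W.lincomb_smult[OF h co _ V.coord_smult[OF bs]] by (simp add: \<phi>_def)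
  ultimately show "\<phi> \<in> isometries R V W"
    by (auto simp: isometries_def linear_maps_def)
  fix i assume i: "i < ?n"
  have "V.coord bs (bs ! i) j = (if j = i then \<one> else \<zero>)" if "j < ?n" for j
    using V.orth_list_nth[OF bs] V.orth_list_orth[OF bs i that] that i
    by (auto simp: V.coord_def)
  then have "W.lincomb ?n h (V.coord bs (bs ! i)) = (\<Oplus>\<^bsub>W\<^esub>j\<in>{..<?n}. if i = j then h j else \<zero>\<^bsub>W\<^esub>)"
    unfolding W.lincomb_def using h by (intro W.M.finsum_cong') (auto simp: Pi_iff)
  also have "\<dots> = h i"
    using h i by (intro W.M.finsum_singleton) auto
  finally show "\<phi> (bs ! i) = h i"
    using V.orth_list_nth(1)[OF bs i] by (simp add: \<phi>_def)
qed

lemma frame_ext: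
  assumes bs: "orth_list R V bs" and len: "length bs = rk R V"
    and f: "f \<in> linear_maps R V W" and g: "g \<in> linear_maps R V W"
    and eq: "\<And>i. i < length bs \<Longrightarrow> f (bs ! i) = g (bs ! i)"
  shows "f = g"
proof (rule extensionalityI)
  fix v assume v: "v \<in> carrier V"
  have b: "(!) bs \<in> {..<length bs} \<rightarrow> carrier V"
    using V.orth_list_nth[OF bs] by auto
  have "W.lincomb (length bs) (\<lambda>i. f (bs ! i)) (V.coord bs v) = W.lincomb (length bs) (\<lambda>i. g (bs ! i)) (V.coord bs v)"
    unfolding W.lincomb_def using eq linear_mapsD(1)[OF g] b V.coord_closed[OF bs v]
    by (intro W.M.finsum_cong') (auto simp: Pi_iff)
  then have "f (V.lincomb (length bs) ((!) bs) (V.coord bs v)) = g (V.lincomb (length bs) ((!) bs) (V.coord bs v))"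
    using linear_map_lincomb[OF f b V.coord_closed[OF bs v]]
      linear_map_lincomb[OF g b V.coord_closed[OF bs v]] by simp
  then show "f v = g v"
    using V.frame_expand[OF bs len v] by simp
qed (use linear_mapsD(4)[OF f] linear_mapsD(4)[OF g] in auto)

text \<open>The map sends \<open>bs ! j\<close> to the sum \<open>h j\<close> of the
  \<open>cs ! k\<close> in the fibre over \<open>j\<close>. Distinct fibres are disjoint, so the
  \<open>h j\<close> are orthogonal, and \<open>h j\<close> has norm \<open>card (A j)\<close> times
  the norm of \<open>bs ! j\<close>, which is that norm again by the congruence. Pairing with
  \<open>cs ! k\<close> sees only the summand over \<open>p k\<close>; since the norms match, the
  result is the pairing with \<open>bs ! p k\<close> itself. This is the reason for recording
  pairings rather than coordinates in words.\<close>

lemma pullback_isometry: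
  assumes bs: "orth_list R V bs" and len: "length bs = rk R V" and cs: "orth_list R W cs"
    and p: "\<And>k. k < length cs \<Longrightarrow> p k < length bs"
    and norm: "\<And>k. k < length cs \<Longrightarrow> form W (cs ! k) (cs ! k) = form V (bs ! p k) (bs ! p k)"
    and fib: "\<And>j. j < length bs \<Longrightarrow>
      card {k. k < length cs \<and> p k = j} mod card (carrier R) = 1 mod card (carrier R)"
  shows "\<exists>\<phi>\<in>isometries R V W. \<forall>v\<in>carrier V. \<forall>k<length cs. form W (\<phi> v) (cs ! k) = form V v (bs ! p k)"
proof -
  define A where "A j = {k. k < length cs \<and> p k = j}" for j
  define h where "h j = (\<Oplus>\<^bsub>W\<^esub>k\<in>A j. cs ! k)" for j
  have A: "A j \<subseteq> {..<length cs}" for j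
    by (auto simp: A_def)
  have h: "h \<in> {..<length bs} \<rightarrow> carrier W"
    using W.sum_closed[OF cs A] by (auto simp: h_def)
  have q: "form W (h i) (h j) = (if i = j then form V (bs ! i) (bs ! i) else \<zero>)"
    if ij: "i < length bs" "j < length bs" for i j
  proof (cases "i = j")
    case True
    have qi: "form V (bs ! i) (bs ! i) \<in> carrier R"
      using V.orth_list_nth(3)[OF bs ij(1)] .
    have "form W (h i) (h i) = [card (A i)] \<cdot> form V (bs ! i) (bs ! i)"
      unfolding h_def using norm qi by (intro W.form_sum_sum(2)[OF cs A A]) (auto simp: A_def)
    also have "\<dots> = form V (bs ! i) (bs ! i)"
      using fib[OF ij(1)] qi by (intro V.add_pow_mod_card) (auto simp: A_def)
    finally show ?thesis
      using True by simp
  next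
    case False
    then have "A i \<inter> A j = {}"
      by (auto simp: A_def)
    with False show ?thesis
      using W.form_sum_sum(1)[OF cs A A] by (simp add: h_def)
  qed
  let ?\<phi> = "\<lambda>v\<in>carrier V. W.lincomb (length bs) h (V.coord bs v)"
  have "form W (?\<phi> v) (cs ! k) = form V v (bs ! p k)" if v: "v \<in> carrier V" and k: "k < length cs" for v k
  proof -
    note co = V.coord_closed[OF bs v]
    have cj: "V.coord bs v j \<in> carrier R" "h j \<in> carrier W" if "j < length bs" for j
      using co h that by auto
    have hk: "form W (h j) (cs ! k) = (if j = p k then form W (cs ! k) (cs ! k) else \<zero>)" for j
      using W.form_sum_nth[OF cs A k] k by (auto simp: h_def A_def)
    have ck: "cs ! k \<in> carrier W" "form W (cs ! k) (cs ! k) \<in> carrier R"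
      using W.orth_list_nth[OF cs k] by auto
    have "form W (?\<phi> v) (cs ! k) = form W (V.coord bs v (p k) \<odot>\<^bsub>W\<^esub> h (p k)) (cs ! k)"
      using v cj ck p[OF k] hk unfolding W.lincomb_def
      by (simp, intro W.form_finsum_single) (auto simp: W.form_smult)
    also have "\<dots> = V.coord bs v (p k) \<otimes> form V (bs ! p k) (bs ! p k)"
      using cj[OF p[OF k]] ck hk norm[OF k] by (simp add: W.form_smult)
    also have "\<dots> = form V v (bs ! p k)"
      using V.orth_list_nth[OF bs p[OF k]] v by (simp add: V.coord_def V.R.m_assoc V.form_closed)
    finally show ?thesis .
  qed
  with frame_isometry(1)[OF bs len h q] show ?thesis
    by blast
qed

end

lemma isometries_compose:
  assumes f: "f \<in> isometries R U V" and g: "g \<in> isometries R V W"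
    and "\<And>v w. \<lbrakk>v \<in> carrier U; w \<in> carrier U\<rbrakk> \<Longrightarrow> v \<oplus>\<^bsub>U\<^esub> w \<in> carrier U"
    and "\<And>a v. \<lbrakk>a \<in> carrier R; v \<in> carrier U\<rbrakk> \<Longrightarrow> a \<odot>\<^bsub>U\<^esub> v \<in> carrier U"
  shows "compose (carrier U) g f \<in> isometries R U W"
  using assms(3,4) isometriesD(2,3)[OF f] isometriesD(2,3)[OF g]
    linear_mapsD(2,3)[OF isometriesD(1)[OF f]] linear_mapsD(2,3)[OF isometriesD(1)[OF g]]
  by (auto simp: isometries_def linear_maps_def compose_def)

text \<open>The image under \<open>f\<close> of a frame of \<open>V\<close> is extended to a frame
  of \<open>W\<close>. In the complement of the image under \<open>g\<close> there is room for
  orthogonal vectors with the norms of the added ones, and matching the two lists defines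
  \<open>h\<close>.\<close>

lemma isometry_factor:
  assumes "finite_orthogonal_module R V" "finite_orthogonal_module R W" "finite_orthogonal_module R W'"
    and f: "f \<in> isometries R V W" and g: "g \<in> isometries R V W'"
    and large: "card (carrier R) * card (carrier R) + rk R W \<le> rk R W'"
  shows "\<exists>h\<in>isometries R W W'. compose (carrier V) h f = g"
proof -
  interpret VW: finite_orthogonal_pair R V W
    using assms by (simp add: finite_orthogonal_pair_def)
  interpret VW': finite_orthogonal_pair R V W'
    using assms by (simp add: finite_orthogonal_pair_def)
  interpret WW': finite_orthogonal_pair R W W'
    using assms by (simp add: finite_orthogonal_pair_def)
  obtain vs where vs: "orth_list R V vs" "length vs = rk R V"
    using VW.V.orth_list_extend[of "[]"] by (auto simp: orth_list_def)
  obtain cs where cs: "orth_list R W (map f vs @ cs)" "length (map f vs @ cs) = rk R W"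
    using VW.W.orth_list_extend[OF VW.isometry_orth_list[OF f vs(1)]] by blast
  define ws where "ws = map f vs @ cs"
  note cs = cs[folded ws_def]
  define us where "us = map (\<lambda>c. form W c c) cs"
  have ws_cs: "ws ! (length vs + i) = cs ! i" "length vs + i < length ws" if "i < length cs" for i
    using that by (auto simp: ws_def nth_append)
  have "set us \<subseteq> Units R"
  proof
    fix u assume "u \<in> set us"
    then obtain i where "i < length cs" "u = form W (cs ! i) (cs ! i)"
      by (auto simp: us_def in_set_conv_nth)
    then show "u \<in> Units R"
      using VW.W.orth_list_nth(2)[OF cs(1) ws_cs(2)] ws_cs(1) by simp
  qed
  \<comment> \<open>The vectors of \<open>vs\<close> and the norms \<open>us\<close> together number
    \<open>rk R W\<close>, so the bound in \<open>large\<close> is exactly what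
    \<open>represent_units\<close> asks for.\<close>
  moreover have "length (map g vs) + card (carrier R) * card (carrier R) + length us \<le> rk R W'"
    using large cs(2) by (simp add: us_def ws_def)
  ultimately obtain zs where zs: "length zs = length us" "orth_list R W' (map g vs @ zs)"
    "\<And>i. i < length us \<Longrightarrow> form W' (zs ! i) (zs ! i) = us ! i"
    using VW'.W.represent_units[OF VW'.isometry_orth_list[OF g vs(1)]] by blast
  define ys where "ys = map g vs @ zs"
  note zs = zs(1) zs(2)[folded ys_def] zs(3)
  have len: "length ys = length ws"
    using zs(1) by (simp add: ys_def ws_def us_def)
  have norm: "form W' (ys ! i) (ys ! i) = form W (ws ! i) (ws ! i)" if "i < length ws" for i
  proof (cases "i < length vs")
    case True
    then show ?thesis
      using isometriesD(3)[OF f] isometriesD(3)[OF g] VW.V.orth_list_nth(1)[OF vs(1)]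
      by (simp add: ys_def ws_def nth_append)
  next
    case False
    with that zs(3)[of "i - length vs"] show ?thesis
      by (simp add: ys_def ws_def us_def nth_append)
  qed
  have h: "(!) ys \<in> {..<length ws} \<rightarrow> carrier W'"
    using VW'.W.orth_list_nth(1)[OF zs(2)] len by auto
  have q: "form W' (ys ! i) (ys ! j) = (if i = j then form W (ws ! i) (ws ! i) else \<zero>\<^bsub>R\<^esub>)"
    if "i < length ws" "j < length ws" for i j
    using VW'.W.orth_list_orth[OF zs(2), of i j] norm[of i] that len by auto
  define \<phi> where "\<phi> = (\<lambda>v\<in>carrier W. VW'.W.lincomb (length ws) ((!) ys) (VW.W.coord ws v))"
  have \<phi>: "\<phi> \<in> isometries R W W'" "\<And>i. i < length ws \<Longrightarrow> \<phi> (ws ! i) = ys ! i"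
    unfolding \<phi>_def using WW'.frame_isometry[OF cs h q] by blast+
  have comp: "compose (carrier V) \<phi> f \<in> isometries R V W'"
    by (rule isometries_compose[OF f \<phi>(1)]) auto
  have "compose (carrier V) \<phi> f = g"
  proof (rule VW'.frame_ext[OF vs isometriesD(1)[OF comp] isometriesD(1)[OF g]])
    fix i assume i: "i < length vs"
    then have "\<phi> (ws ! i) = ys ! i"
      by (intro \<phi>(2)) (simp add: ws_def)
    then show "compose (carrier V) \<phi> f (vs ! i) = g (vs ! i)"
      using i VW.V.orth_list_nth(1)[OF vs(1) i] by (simp add: compose_def ws_def ys_def nth_append)
  qed
  with \<phi>(1) show ?thesis
    by blast
qed

section \<open>Torsion of finitely generated modules\<close>

text \<open>This disposes of the zero ring, where the counting arguments break down: every module is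
  zero, and the least admissible rank is 0.\<close>

lemma rk_zero_ring:
  assumes "orthogonal_module R V" and "\<one>\<^bsub>R\<^esub> = \<zero>\<^bsub>R\<^esub>"
  shows "rk R V = 0"
proof -
  interpret orthogonal_module R V by fact
  have "v = \<zero>\<^bsub>V\<^esub>" if "v \<in> carrier V" for v
    using smult_one[OF that] smult_l_null[OF that] assms(2) by simp
  then have "free_of_rank R V 0"
    by (auto simp: free_of_rank_def)
  then show ?thesis
    unfolding rk_def by (intro Least_eq_0)
qed

locale finite_OrI_module = OrI_module R K Fo Fm
  for R :: "('r, 's) ring_scheme" and K :: "('k, 't) ring_scheme"
    and Fo :: "('r, 'v) orth_module \<Rightarrow> ('k, 'm) module"
    and Fm :: "('r, 'v) orth_module \<Rightarrow> ('r, 'v) orth_module \<Rightarrow> ('v \<Rightarrow> 'v) \<Rightarrow> 'm \<Rightarrow> 'm" +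
  assumes finite_R: "finite (carrier R)" and one_not_zero: "\<one>\<^bsub>R\<^esub> \<noteq> \<zero>\<^bsub>R\<^esub>"
    and two_unit: "\<one>\<^bsub>R\<^esub> \<oplus>\<^bsub>R\<^esub> \<one>\<^bsub>R\<^esub> \<in> Units R"
begin

lemma finite_orthogonal:
  "orthogonal_module R V \<Longrightarrow> finite_orthogonal_module R V"
  using finite_R one_not_zero two_unit
  by (simp add: finite_orthogonal_module_def finite_orthogonal_module_axioms_def)

lemma compose_isometry:
  assumes "orthogonal_module R U" "f \<in> isometries R U V" "g \<in> isometries R V W"
  shows "compose (carrier U) g f \<in> isometries R U W"
proof -
  interpret U: orthogonal_module R U by fact
  show ?thesis
    by (rule isometries_compose[OF assms(2,3)]) auto
qed

lemma mor_compose: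
  assumes "orthogonal_module R U" "orthogonal_module R V" "orthogonal_module R W"
    "f \<in> isometries R U V" "g \<in> isometries R V W" "x \<in> carrier (Fo U)"
  shows "Fm V W g (Fm U V f x) = Fm U W (compose (carrier U) g f) x"
  using mor_comp[OF assms(1-5)] assms(6) by (simp add: compose_def)

text \<open>Requiring that all maps to objects of large rank kill \<open>x\<close>, rather than some map, makes it
  evident that such elements form a submodule, without forming pushouts.\<close>

definition torsion :: "('r, 'v) orth_module \<Rightarrow> 'm set" where
  "torsion V = {x \<in> carrier (Fo V). \<exists>n. \<forall>W f. orthogonal_module R W \<longrightarrow> f \<in> isometries R V W \<longrightarrow>
     n \<le> rk R W \<longrightarrow> Fm V W f x = \<zero>\<^bsub>Fo W\<^esub>}"

lemma torsion_submodule: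
  assumes V: "orthogonal_module R V"
  shows "submodule (torsion V) K (Fo V)"
proof -
  interpret M: left_module K "Fo V" by (rule obj[OF V])
  note lin = linear_mapsD(2,3)[OF mor[OF V]]
  show ?thesis
  proof (rule M.submoduleI)
    show "torsion V \<subseteq> carrier (Fo V)"
      by (auto simp: torsion_def)
    show "\<zero>\<^bsub>Fo V\<^esub> \<in> torsion V"
      using linear_map_zero[OF obj[OF V] obj mor[OF V]] by (auto simp: torsion_def)
  next
    fix x y assume "x \<in> torsion V" "y \<in> torsion V"
    then obtain n n' :: nat where *: "x \<in> carrier (Fo V)" "y \<in> carrier (Fo V)"
      "\<And>W f. \<lbrakk>orthogonal_module R W; f \<in> isometries R V W; n \<le> rk R W\<rbrakk> \<Longrightarrow> Fm V W f x = \<zero>\<^bsub>Fo W\<^esub>"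
      "\<And>W f. \<lbrakk>orthogonal_module R W; f \<in> isometries R V W; n' \<le> rk R W\<rbrakk> \<Longrightarrow> Fm V W f y = \<zero>\<^bsub>Fo W\<^esub>"
      unfolding torsion_def by blast
    have "Fm V W f (x \<oplus>\<^bsub>Fo V\<^esub> y) = \<zero>\<^bsub>Fo W\<^esub>"
      if W: "orthogonal_module R W" "f \<in> isometries R V W" "max n n' \<le> rk R W" for W f
    proof -
      interpret N: left_module K "Fo W" by (rule obj[OF W(1)])
      show ?thesis
        using lin(1)[OF W(1,2) *(1,2)] *(3,4)[OF W(1,2)] W(3) by simp
    qed
    then show "x \<oplus>\<^bsub>Fo V\<^esub> y \<in> torsion V"
      using *(1,2) unfolding torsion_def by blast
  next
    fix a x assume a: "a \<in> carrier K" and "x \<in> torsion V"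
    then obtain n where *: "x \<in> carrier (Fo V)"
      "\<And>W f. \<lbrakk>orthogonal_module R W; f \<in> isometries R V W; n \<le> rk R W\<rbrakk> \<Longrightarrow> Fm V W f x = \<zero>\<^bsub>Fo W\<^esub>"
      by (auto simp: torsion_def)
    have "Fm V W f (a \<odot>\<^bsub>Fo V\<^esub> x) = \<zero>\<^bsub>Fo W\<^esub>"
      if W: "orthogonal_module R W" "f \<in> isometries R V W" "n \<le> rk R W" for W f
      using lin(2)[OF W(1,2) a *(1)] *(2)[OF W] left_module.smult_r_null[OF obj[OF W(1)] a] by simp
    then show "a \<odot>\<^bsub>Fo V\<^esub> x \<in> torsion V"
      using a *(1) M.smult_closed unfolding torsion_def by blast
  qed
qed

lemma torsion_map:
  assumes V: "orthogonal_module R V" and W: "orthogonal_module R W" and f: "f \<in> isometries R V W"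
    and x: "x \<in> torsion V"
  shows "Fm V W f x \<in> torsion W"
proof -
  obtain n where *: "x \<in> carrier (Fo V)"
    "\<And>W f. \<lbrakk>orthogonal_module R W; f \<in> isometries R V W; n \<le> rk R W\<rbrakk> \<Longrightarrow> Fm V W f x = \<zero>\<^bsub>Fo W\<^esub>"
    using x by (auto simp: torsion_def)
  have "Fm W X g (Fm V W f x) = \<zero>\<^bsub>Fo X\<^esub>"
    if X: "orthogonal_module R X" "g \<in> isometries R W X" "n \<le> rk R X" for X g
    using mor_compose[OF V W X(1) f X(2) *(1)] *(2)[OF X(1) compose_isometry[OF V f X(2)] X(3)] by simp
  then show ?thesis
    using linear_mapsD(1)[OF mor[OF V W f] *(1)] unfolding torsion_def by blast
qed

text \<open>Every isometry from \<open>V\<close> to an object of rank at least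
  \<open>card (carrier R) * card (carrier R) + rk R W\<close> factors through \<open>f\<close>, so
  it kills whatever \<open>f\<close> kills.\<close>

lemma kernel_torsion:
  assumes V: "orthogonal_module R V" and W: "orthogonal_module R W" and f: "f \<in> isometries R V W"
    and x: "x \<in> carrier (Fo V)" and 0: "Fm V W f x = \<zero>\<^bsub>Fo W\<^esub>"
  shows "x \<in> torsion V"
proof -
  have "Fm V X g x = \<zero>\<^bsub>Fo X\<^esub>"
    if X: "orthogonal_module R X" "g \<in> isometries R V X"
      "card (carrier R) * card (carrier R) + rk R W \<le> rk R X" for X g
  proof -
    obtain h where h: "h \<in> isometries R W X" "compose (carrier V) h f = g"
      using isometry_factor[OF finite_orthogonal[OF V] finite_orthogonal[OF W] finite_orthogonal[OF X(1)] f X(2,3)]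
      by blast
    then have "Fm V X g x = Fm W X h (Fm V W f x)"
      using mor_compose[OF V W X(1) f h(1) x] by simp
    then show ?thesis
      using 0 linear_map_zero[OF obj[OF W] obj[OF X(1)] mor[OF W X(1) h(1)]] by simp
  qed
  then show ?thesis
    using x unfolding torsion_def by blast
qed

text \<open>The spans on the right-hand side form a submodule of the functor, since postcomposition
  permits only further isometries out of the same generators; it contains the generators by way of
  the identities.\<close>

lemma generators_span:
  fixes S :: "(('r, 'v) orth_module \<times> 'm) set" and W :: "('r, 'v) orth_module"
  assumes gens: "\<forall>(V, x)\<in>S. orthogonal_module R V \<and> x \<in> carrier (Fo V)"
    and gen: "\<forall>N. OrI_submodule R K Fo Fm N \<and> (\<forall>(V, x)\<in>S. x \<in> N V) \<longrightarrow>
      (\<forall>V. orthogonal_module R V \<longrightarrow> N V = carrier (Fo V))"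
    and W: "orthogonal_module R W"
  shows "carrier (Fo W) \<subseteq> mspan K (Fo W) {Fm V W g x | V g x. (V, x) \<in> S \<and> g \<in> isometries R V W}"
proof -
  have S: "orthogonal_module R V \<and> x \<in> carrier (Fo V)" if "(V, x) \<in> S" for V x
    using gens that by auto
  define E where "E W = {Fm V W g x | V g x. (V, x) \<in> S \<and> g \<in> isometries R V W}"
    for W :: "('r, 'v) orth_module"
  define N where "N W = mspan K (Fo W) (E W)" for W :: "('r, 'v) orth_module"
  have E: "E W \<subseteq> carrier (Fo W)" if "orthogonal_module R W" for W :: "('r, 'v) orth_module"
    using S linear_mapsD(1)[OF mor] that by (auto simp: E_def)
  have "OrI_submodule R K Fo Fm N"
    unfolding OrI_submodule_def
  proof (intro conjI allI impI)
    fix V W :: "('r, 'v) orth_module" and f assume *: "orthogonal_module R V \<and> orthogonal_module R W \<and> f \<in> isometries R V W"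
    then have V: "orthogonal_module R V" and W: "orthogonal_module R W" and f: "f \<in> isometries R V W"
      by auto
    have "Fm V W f ` E V \<subseteq> E W"
    proof
      fix y assume "y \<in> Fm V W f ` E V"
      then obtain U g x where *: "(U, x) \<in> S" "g \<in> isometries R U V" "y = Fm V W f (Fm U V g x)"
        by (auto simp: E_def)
      then have "y = Fm U W (compose (carrier U) f g) x" "compose (carrier U) f g \<in> isometries R U W"
        using mor_compose[OF _ V W _ f] compose_isometry[OF _ _ f] S by blast+
      with *(1) show "y \<in> E W"
        unfolding E_def by blast
    qed
    also have "E W \<subseteq> N W"
      unfolding N_def by (rule mspan_superset[OF E[OF W]])
    finally show "Fm V W f ` N V \<subseteq> N W"
      using linear_map_mspan[OF obj[OF V] obj[OF W] mor[OF V W f] E[OF V]] unfolding N_def by blast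
  qed (simp add: N_def left_module.mspan_submodule obj)
  moreover have "x \<in> N V" if "(V, x) \<in> S" for V :: "('r, 'v) orth_module" and x
  proof -
    have V: "orthogonal_module R V" "x \<in> carrier (Fo V)"
      using S[OF that] by auto
    interpret V: orthogonal_module R V by (rule V)
    have "(\<lambda>v\<in>carrier V. v) \<in> isometries R V V"
      by (auto simp: isometries_def linear_maps_def)
    moreover have "Fm V V (\<lambda>v\<in>carrier V. v) x = x"
      using mor_id[OF V(1)] V(2) by simp
    ultimately have "x \<in> E V"
      using that unfolding E_def by (auto intro!: exI[of _ V] exI[of _ "\<lambda>v\<in>carrier V. v"] exI[of _ x])
    then show ?thesis
      using mspan_superset[OF E[OF V(1)]] by (auto simp: N_def)
  qed
  ultimately have "N W = carrier (Fo W)"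
    using gen[rule_format, of N W] W by blast
  then show ?thesis
    by (simp add: N_def E_def)
qed

end

text \<open>The first letter records the generator. The other letters record, for each vector \<open>b\<close> of
  the frame \<open>bs\<close> of \<open>W\<close>, its norm and the \<open>b\<close>-coordinate of the isometry \<open>g\<close>.\<close>

definition word ::
  "('r, 'w) orth_module \<Rightarrow> 'w list \<Rightarrow> ('r, 'v) orth_module \<times> 'm \<Rightarrow> ('v \<Rightarrow> 'w)
    \<Rightarrow> (('r, 'v) orth_module \<times> 'm + 'r \<times> ('v \<Rightarrow> 'r)) list" where
  "word W bs s g =
     Inl s # map (\<lambda>b. Inr (form W b b, \<lambda>v\<in>carrier (fst s). form W (g v) b)) bs"

text \<open>The functionals are those on the modules where the finitely many generators live. Hence
  this alphabet is finite and serves all objects and all frames at once.\<close>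

definition letters ::
  "('r, 's) ring_scheme \<Rightarrow> (('r, 'v) orth_module \<times> 'm) set
    \<Rightarrow> (('r, 'v) orth_module \<times> 'm + 'r \<times> ('v \<Rightarrow> 'r)) set" where
  "letters R S = Inl ` S \<union> Inr ` (carrier R \<times> (\<Union>s\<in>S. carrier (fst s) \<rightarrow>\<^sub>E carrier R))"

lemma length_word [simp]: "length (word W bs s g) = Suc (length bs)"
  by (simp add: word_def)

lemma word_nth_0 [simp]: "word W bs s g ! 0 = Inl s"
  by (simp add: word_def)

lemma word_nth_Suc:
  "k < length bs \<Longrightarrow>
    word W bs s g ! Suc k = Inr (form W (bs ! k) (bs ! k), \<lambda>v\<in>carrier (fst s). form W (g v) (bs ! k))"
  by (simp add: word_def)

lemma (in finite_orthogonal_module) set_word: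
  assumes bs: "orth_list R V bs" and s: "s \<in> S" and g: "g \<in> isometries R (fst s) V"
  shows "set (word V bs s g) \<subseteq> letters R S"
proof -
  have "(form V b b, \<lambda>v\<in>carrier (fst s). form V (g v) b)
      \<in> carrier R \<times> (\<Union>s\<in>S. carrier (fst s) \<rightarrow>\<^sub>E carrier R)" if "b \<in> set bs" for b
  proof -
    have b: "b \<in> carrier V"
      using that bs by (auto simp: orth_list_def)
    then have "(\<lambda>v\<in>carrier (fst s). form V (g v) b) \<in> carrier (fst s) \<rightarrow>\<^sub>E carrier R"
      using isometriesD(2)[OF g] form_closed by (intro restrict_PiE_iff[THEN iffD2]) auto
    with b s show ?thesis
      using form_closed by blast
  qed
  then show ?thesis
    using s by (force simp: word_def letters_def)
qed

text \<open>The pairings with a frame determine the coordinates of \<open>g v\<close> and thereby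
  \<open>g v\<close>.\<close>

lemma (in finite_orthogonal_module) word_inj:
  assumes bs: "orth_list R V bs" and len: "length bs = rk R V"
    and g: "g \<in> isometries R (fst s) V" and g': "g' \<in> isometries R (fst s') V"
    and eq: "word V bs s g = word V bs s' g'"
  shows "s = s' \<and> g = g'"
proof -
  have s: "s = s'"
    using eq by (simp add: word_def)
  have "g v = g' v" if v: "v \<in> carrier (fst s)" for v
  proof -
    have gv: "g v \<in> carrier V" "g' v \<in> carrier V"
      using isometriesD(2)[OF g] isometriesD(2)[OF g'] v s by auto
    have "form V (g v) (bs ! i) = form V (g' v) (bs ! i)" if i: "i < length bs" for i
    proof -
      have "word V bs s g ! Suc i = word V bs s' g' ! Suc i"
        by (simp only: eq)
      then have "(\<lambda>v\<in>carrier (fst s). form V (g v) (bs ! i)) = (\<lambda>v\<in>carrier (fst s). form V (g' v) (bs ! i))"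
        using i s by (simp add: word_nth_Suc)
      from fun_cong[OF this, of v] show ?thesis
        using v by simp
    qed
    then have "lincomb (length bs) ((!) bs) (coord bs (g v)) = lincomb (length bs) ((!) bs) (coord bs (g' v))"
      unfolding lincomb_def using orth_list_nth[OF bs] coord_closed[OF bs gv(2)]
      by (intro M.finsum_cong') (auto simp: coord_def Pi_iff)
    then show ?thesis
      using frame_expand[OF bs len gv(1)] frame_expand[OF bs len gv(2)] by simp
  qed
  then have "g = g'"
    using linear_mapsD(4)[OF isometriesD(1)[OF g]] linear_mapsD(4)[OF isometriesD(1)[OF g']] s
    by (intro extensionalityI) auto
  with s show ?thesis ..
qed

text \<open>The isometry depends only on \<open>p\<close> and the two frames, so one
  \<open>\<phi>\<close> pulls back the words of all generators and all isometries into
  \<open>V\<close>. This uniformity is essential: the same map must move the leading term and every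
  smaller term.\<close>

lemma (in finite_orthogonal_pair) word_pullback:
  fixes s s' :: "('r, 'u) orth_module \<times> 'm"
  assumes bs: "orth_list R V bs" and len: "length bs = rk R V" and cs: "orth_list R W cs"
    and p: "pullback_on (card (carrier R)) (Suc (length bs)) (Suc (length cs)) p"
    and eq: "word W cs s' g' = map (\<lambda>k. word V bs s g ! p k) [0..<Suc (length cs)]"
  shows "s' = s"
    and "\<exists>\<phi>\<in>isometries R V W. \<forall>(t :: ('r, 'u) orth_module \<times> 'm) f. f \<in> carrier (fst t) \<rightarrow> carrier V \<longrightarrow>
      word W cs t (compose (carrier (fst t)) \<phi> f) = map (\<lambda>k. word V bs t f ! p k) [0..<Suc (length cs)]"
proof -
  have eq_nth: "word W cs s' g' ! k = word V bs s g ! p k" if "k < Suc (length cs)" for k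
    using that unfolding eq by (simp del: upt_Suc)
  have p0: "p 0 = 0"
    using p by (auto simp: pullback_on_def)
  show "s' = s"
    using eq_nth[of 0] p0 by simp
  \<comment> \<open>Only position 0 carries an \<open>Inl\<close> letter, so equality of the words
    prevents \<open>p\<close> from sending a frame position there. Shifted by one, \<open>p\<close>
    becomes the map \<open>r\<close> between frame positions.\<close>
  have pS: "p (Suc k) = Suc (p (Suc k) - 1)" "p (Suc k) - 1 < length bs" if "k < length cs" for k
  proof -
    have "p (Suc k) \<noteq> 0"
    proof
      assume "p (Suc k) = 0"
      then have "word W cs s' g' ! Suc k = Inl s"
        using eq_nth[of "Suc k"] that by simp
      then show False
        using that by (simp add: word_nth_Suc)
    qed
    moreover have "p (Suc k) < Suc (length bs)"
      using p that by (auto simp: pullback_on_def)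
    ultimately show "p (Suc k) = Suc (p (Suc k) - 1)" "p (Suc k) - 1 < length bs"
      by auto
  qed
  define r where "r k = p (Suc k) - 1" for k
  have r: "p (Suc k) = Suc (r k)" "r k < length bs" if "k < length cs" for k
    using pS[OF that] by (simp_all add: r_def)
  have "card {k. k < length cs \<and> r k = j} mod card (carrier R) = 1 mod card (carrier R)"
    if "j < length bs" for j
  proof -
    have "{k. k < Suc (length cs) \<and> p k = Suc j} = Suc ` {k. k < length cs \<and> r k = j}"
    proof (intro equalityI subsetI)
      fix k assume k: "k \<in> {k. k < Suc (length cs) \<and> p k = Suc j}"
      then obtain k' where "k = Suc k'"
        using p0 by (cases k) auto
      with k r show "k \<in> Suc ` {k. k < length cs \<and> r k = j}"
        by auto
    qed (use r in auto)
    then show ?thesis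
      using p that by (auto simp: pullback_on_def card_image)
  qed
  moreover have norm: "form W (cs ! k) (cs ! k) = form V (bs ! r k) (bs ! r k)" if "k < length cs" for k
    using eq_nth[of "Suc k"] that r[OF that] by (simp add: word_nth_Suc)
  ultimately obtain \<phi> where \<phi>: "\<phi> \<in> isometries R V W"
    "\<And>v k. \<lbrakk>v \<in> carrier V; k < length cs\<rbrakk> \<Longrightarrow> form W (\<phi> v) (cs ! k) = form V v (bs ! r k)"
    using pullback_isometry[OF bs len cs, of r] r(2) by blast
  have "word W cs t (compose (carrier (fst t)) \<phi> f) = map (\<lambda>k. word V bs t f ! p k) [0..<Suc (length cs)]"
    if f: "f \<in> carrier (fst t) \<rightarrow> carrier V" for t :: "('r, 'u) orth_module \<times> 'm" and f
  proof (rule nth_equalityI)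
    fix k assume "k < length (word W cs t (compose (carrier (fst t)) \<phi> f))"
    then have k: "k < Suc (length cs)"
      by simp
    have "word W cs t (compose (carrier (fst t)) \<phi> f) ! k = word V bs t f ! p k"
    proof (cases k)
      case 0
      then show ?thesis
        using p0 by simp
    next
      case (Suc l)
      with k have l: "l < length cs"
        by simp
      have "(\<lambda>v\<in>carrier (fst t). form W (compose (carrier (fst t)) \<phi> f v) (cs ! l)) =
          (\<lambda>v\<in>carrier (fst t). form V (f v) (bs ! r l))"
        using f \<phi>(2)[OF _ l] by (intro restrict_ext) (auto simp: compose_def)
      then show ?thesis
        using l r[OF l] norm[OF l] by (simp add: Suc word_nth_Suc)
    qed
    then show "word W cs t (compose (carrier (fst t)) \<phi> f) ! k = map (\<lambda>k. word V bs t f ! p k) [0..<Suc (length cs)] ! k"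
      using k by (simp del: upt_Suc)
  qed simp
  with \<phi>(1) show "\<exists>\<phi>\<in>isometries R V W. \<forall>(t :: ('r, 'u) orth_module \<times> 'm) f. f \<in> carrier (fst t) \<rightarrow> carrier V \<longrightarrow>
      word W cs t (compose (carrier (fst t)) \<phi> f) = map (\<lambda>k. word V bs t f ! p k) [0..<Suc (length cs)]"
    by blast
qed

lemma (in finite_OrI_module) torsion_vanishes:
  assumes noeth: "left_noetherian_ring K" and fg: "OrI_finitely_generated R K Fo Fm"
  shows "\<exists>N. \<forall>V. orthogonal_module R V \<longrightarrow> N \<le> rk R V \<longrightarrow> torsion V \<subseteq> {\<zero>\<^bsub>Fo V\<^esub>}"
proof -
  interpret noeth: left_noetherian_ring K by fact
  obtain S where finS: "finite S"
    and gens: "\<forall>(V, x)\<in>S. orthogonal_module R V \<and> x \<in> carrier (Fo V)"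
    and gen: "\<forall>N. OrI_submodule R K Fo Fm N \<and> (\<forall>(V, x)\<in>S. x \<in> N V) \<longrightarrow>
      (\<forall>V. orthogonal_module R V \<longrightarrow> N V = carrier (Fo V))"
    using fg unfolding OrI_finitely_generated_def by (elim exE conjE)
  have S: "orthogonal_module R V \<and> x \<in> carrier (Fo V)" if "(V, x) \<in> S" for V x
    using gens that by auto
  have finV: "finite (carrier (fst s))" if "s \<in> S" for s
    using S[of "fst s" "snd s"] that finite_orthogonal finite_orthogonal_module.finite_carrier by fastforce
  have "finite (letters R S)"
    unfolding letters_def using finS finV finite_R
    by (intro finite_UnI finite_imageI finite_cartesian_product finite_UN_I finite_PiE) auto
  \<comment> \<open>Any injective numbering of the alphabet will do: its sole purpose is a linear
    order on words that depends on the letters alone and not on the object.\<close>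
  then obtain code :: "_ \<Rightarrow> nat" where code: "inj_on code (letters R S)"
    using finite_imp_inj_to_nat_seg by blast
  \<comment> \<open>The Groebner argument runs over objects with a chosen frame, as the word of an
    isometry depends on the frame of its target. The modules and the torsion depend only on the
    first component.\<close>
  define Ob :: "(('r, 'v) orth_module \<times> 'v list) set" where "Ob = {(W, bs). orthogonal_module R W \<and> orth_list R W bs \<and> length bs = rk R W}"
  define T where "T a = {(s, g). s \<in> S \<and> g \<in> isometries R (fst s) (fst a)}" for a :: "('r, 'v) orth_module \<times> 'v list"
  define key where "key a t = map code (word (fst a) (snd a) (fst t) (snd t))"
    for a :: "('r, 'v) orth_module \<times> 'v list" and t :: "(('r, 'v) orth_module \<times> 'm) \<times> ('v \<Rightarrow> 'v)"
  define e where "e a t = Fm (fst (fst t)) (fst a) (snd t) (snd (fst t))"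
    for a :: "('r, 'v) orth_module \<times> 'v list" and t :: "(('r, 'v) orth_module \<times> 'm) \<times> ('v \<Rightarrow> 'v)"
  define H where "H a b = Fm (fst a) (fst b) ` isometries R (fst a) (fst b)"
    for a b :: "('r, 'v) orth_module \<times> 'v list"
  define P where "P x y \<longleftrightarrow> (\<exists>p. pullback_on (card (carrier R)) (length (case_prod key x)) (length (case_prod key y)) p \<and>
      case_prod key y = map (\<lambda>k. case_prod key x ! p k) [0..<length (case_prod key y)])" for x y
  have ObD: "orthogonal_module R (fst a)" "finite_orthogonal_module R (fst a)" "orth_list R (fst a) (snd a)"
    "length (snd a) = rk R (fst a)" if "a \<in> Ob" for a
    using that finite_orthogonal by (auto simp: Ob_def)
  have TD: "fst t \<in> S" "snd t \<in> isometries R (fst (fst t)) (fst a)" "orthogonal_module R (fst (fst t))"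
    "snd (fst t) \<in> carrier (Fo (fst (fst t)))" if "t \<in> T a" for t a
    using that S[of "fst (fst t)" "snd (fst t)"] by (auto simp: T_def)
  have letters: "set (word (fst a) (snd a) (fst t) (snd t)) \<subseteq> letters R S" if "a \<in> Ob" "t \<in> T a" for a t
    using finite_orthogonal_module.set_word[OF ObD(2,3)[OF that(1)] TD(1,2)[OF that(2)]] .
  have word_eq: "word (fst a) (snd a) (fst t) (snd t) = w"
    if "a \<in> Ob" "t \<in> T a" "set w \<subseteq> letters R S" "key a t = map code w" for a t w
  proof (rule map_inj_on)
    show "map code (word (fst a) (snd a) (fst t) (snd t)) = map code w"
      using that(4) by (simp add: key_def)
    show "inj_on code (set (word (fst a) (snd a) (fst t) (snd t)) \<union> set w)"
      by (rule inj_on_subset[OF code]) (use letters[OF that(1,2)] that(3) in blast)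
  qed
  have inj: "inj_on (key a) (T a)" if a: "a \<in> Ob" for a
  proof (rule inj_onI)
    fix t t' assume t: "t \<in> T a" "t' \<in> T a" "key a t = key a t'"
    then have "word (fst a) (snd a) (fst t) (snd t) = word (fst a) (snd a) (fst t') (snd t')"
      using word_eq[OF a t(1) letters[OF a t(2)]] by (simp add: key_def)
    from finite_orthogonal_module.word_inj[OF ObD(2-4)[OF a] TD(2)[OF t(1)] TD(2)[OF t(2)] this]
    show "t = t'"
      by (simp add: prod_eq_iff)
  qed
  have transfer: "\<exists>h\<in>H a a'. h \<in> linear_maps K (Fo (fst a)) (Fo (fst a')) \<and> h ` torsion (fst a) \<subseteq> torsion (fst a') \<and>
      h (e a t) = e a' t' \<and>
      (\<forall>u\<in>T a. key a u < key a t \<longrightarrow> (\<exists>u'\<in>T a'. key a' u' < key a' t' \<and> h (e a u) = e a' u'))"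
    if a: "a \<in> Ob" "a' \<in> Ob" and t: "t \<in> T a" "t' \<in> T a'" and P: "P (a, t) (a', t')" for a a' t t'
  proof -
    obtain V bs W cs where a_eq: "a = (V, bs)" "a' = (W, cs)"
      by (cases a, cases a')
    interpret finite_orthogonal_pair R V W
      using ObD(2)[OF a(1)] ObD(2)[OF a(2)] by (simp add: finite_orthogonal_pair_def a_eq)
    have V: "orthogonal_module R V" "orth_list R V bs" "length bs = rk R V"
      and W: "orthogonal_module R W" "orth_list R W cs" "length cs = rk R W"
      using ObD[OF a(1)] ObD[OF a(2)] by (simp_all add: a_eq)
    obtain p where p: "pullback_on (card (carrier R)) (Suc (length bs)) (Suc (length cs)) p"
      and keq: "key a' t' = map (\<lambda>k. key a t ! p k) [0..<Suc (length cs)]"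
      using P by (auto simp: P_def key_def a_eq)
    have pk: "p k < Suc (length bs)" if "k < Suc (length cs)" for k
      using p that by (auto simp: pullback_on_def)
    have key_pull: "map (\<lambda>k. key a u ! p k) [0..<Suc (length cs)] =
        map code (map (\<lambda>k. word V bs (fst u) (snd u) ! p k) [0..<Suc (length cs)])" for u
      using pk by (auto simp: key_def a_eq simp del: upt_Suc)
    have "set (map (\<lambda>k. word V bs (fst t) (snd t) ! p k) [0..<Suc (length cs)]) \<subseteq> letters R S"
    proof
      fix l assume "l \<in> set (map (\<lambda>k. word V bs (fst t) (snd t) ! p k) [0..<Suc (length cs)])"
      then obtain k where "k < Suc (length cs)" "l = word V bs (fst t) (snd t) ! p k"
        by (auto simp del: upt_Suc)
      then have "l \<in> set (word V bs (fst t) (snd t))"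
        using pk by simp
      then show "l \<in> letters R S"
        using letters[OF a(1) t(1)] by (auto simp: a_eq)
    qed
    then have weq: "word W cs (fst t') (snd t') = map (\<lambda>k. word V bs (fst t) (snd t) ! p k) [0..<Suc (length cs)]"
      using word_eq[OF a(2) t(2)] keq key_pull by (simp add: a_eq)
    from word_pullback(2)[OF V(2,3) W(2) p weq]
    obtain \<phi> where \<phi>: "\<phi> \<in> isometries R V W"
      and pull: "\<forall>(s :: ('r, 'v) orth_module \<times> 'm) f. f \<in> carrier (fst s) \<rightarrow> carrier V \<longrightarrow>
        word W cs s (compose (carrier (fst s)) \<phi> f) = map (\<lambda>k. word V bs s f ! p k) [0..<Suc (length cs)]"
      by (elim bexE)
    define push where "push u = (fst u, compose (carrier (fst (fst u))) \<phi> (snd u))"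
      for u :: "(('r, 'v) orth_module \<times> 'm) \<times> ('v \<Rightarrow> 'v)"
    have push: "push u \<in> T a'" "key a' (push u) = map (\<lambda>k. key a u ! p k) [0..<Suc (length cs)]"
      "Fm V W \<phi> (e a u) = e a' (push u)" if u: "u \<in> T a" for u
    proof -
      note u' = TD[OF u, unfolded a_eq fst_conv]
      show "push u \<in> T a'"
        using u'(1) compose_isometry[OF u'(3,2) \<phi>] by (simp add: T_def push_def a_eq)
      have "word W cs (fst u) (compose (carrier (fst (fst u))) \<phi> (snd u)) =
          map (\<lambda>k. word V bs (fst u) (snd u) ! p k) [0..<Suc (length cs)]"
        using isometriesD(2)[OF u'(2)] by (intro pull[rule_format]) auto
      then show "key a' (push u) = map (\<lambda>k. key a u ! p k) [0..<Suc (length cs)]"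
        unfolding key_pull by (simp add: key_def push_def a_eq)
      show "Fm V W \<phi> (e a u) = e a' (push u)"
        using mor_compose[OF u'(3) V(1) W(1) u'(2) \<phi> u'(4)] by (simp add: e_def push_def a_eq)
    qed
    \<comment> \<open>Both have the key of \<open>t\<close> pulled back along \<open>p\<close>, and
      keys determine terms.\<close>
    have "push t = t'"
      using inj_onD[OF inj[OF a(2)] _ push(1)[OF t(1)] t(2)] push(2)[OF t(1)] keq by simp
    moreover have "key a' (push u) < key a' t'" if "u \<in> T a" "key a u < key a t" for u
      unfolding push(2)[OF that(1)] keq using that(2)
      by (intro pullback_strict_mono[OF p]) (auto simp: key_def a_eq)
    moreover have "Fm V W \<phi> ` torsion V \<subseteq> torsion W"
      using torsion_map[OF V(1) W(1) \<phi>] by blast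
    ultimately show ?thesis
      using \<phi> mor[OF V(1) W(1) \<phi>] push(1,3) t(1) unfolding H_def a_eq fst_conv by blast
  qed
  have good: "\<exists>i j. i < j \<and> P (f i) (f j)" if f: "range f \<subseteq> Sigma Ob T" for f :: "nat \<Rightarrow> _"
  proof -
    have sub: "set (case_prod key (f i)) \<subseteq> code ` letters R S" for i
    proof -
      obtain a t where at: "f i = (a, t)" by (cases "f i")
      with f have "(a, t) \<in> Sigma Ob T"
        by (metis rangeI subsetD)
      then show ?thesis
        using letters[of a t] by (auto simp: key_def at)
    qed
    have "0 < card (carrier R)"
      using finite_R R.one_closed by (auto simp: card_gt_0_iff)
    from higman_pullback[OF finite_imageI[OF \<open>finite (letters R S)\<close>] sub this]
    show ?thesis
      unfolding P_def by blast
  qed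
  have groebner: "\<exists>G. finite G \<and> (\<forall>(a, q)\<in>G. a \<in> Ob \<and> q \<in> torsion (fst a)) \<and>
     (\<forall>a'\<in>Ob. \<forall>D. submodule D K (Fo (fst a')) \<longrightarrow> (\<forall>(a, q)\<in>G. \<forall>h\<in>H a a'. h q \<in> D) \<longrightarrow> torsion (fst a') \<subseteq> D)"
  proof (rule noeth.finite_groebner_basis[where Md = "\<lambda>a. Fo (fst a)" and T = T and e = e and key = key and P = P])
    show "left_module K (Fo (fst a))" if "a \<in> Ob" for a
      using ObD(1)[OF that] by (rule obj)
    show "submodule (torsion (fst a)) K (Fo (fst a))" if "a \<in> Ob" for a
      using ObD(1)[OF that] by (rule torsion_submodule)
    show "e a t \<in> carrier (Fo (fst a))" if "a \<in> Ob" "t \<in> T a" for a t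
      unfolding e_def using linear_mapsD(1)[OF mor[OF TD(3)[OF that(2)] ObD(1)[OF that(1)] TD(2)[OF that(2)]]]
        TD(4)[OF that(2)] .
    show "finite (T a)" if a: "a \<in> Ob" for a
    proof -
      interpret W: finite_orthogonal_module R "fst a" by (rule ObD(2)[OF a])
      have "T a \<subseteq> (SIGMA s:S. carrier (fst s) \<rightarrow>\<^sub>E carrier (fst a))"
        by (auto simp: T_def isometries_def linear_maps_def)
      moreover have "finite (SIGMA s:S. carrier (fst s) \<rightarrow>\<^sub>E carrier (fst a))"
        using finS finV W.finite_carrier by (intro finite_SigmaI finite_PiE)
      ultimately show ?thesis
        by (rule finite_subset)
    qed
    show "carrier (Fo (fst a)) \<subseteq> mspan K (Fo (fst a)) (e a ` T a)" if a: "a \<in> Ob" for a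
    proof -
      have "{Fm V (fst a) g x | V g x. (V, x) \<in> S \<and> g \<in> isometries R V (fst a)} = e a ` T a"
        by (force simp: e_def T_def)
      then show ?thesis
        using generators_span[OF gens gen ObD(1)[OF a]] by simp
    qed
  qed (use inj good transfer in blast)+
  then obtain G where finG: "finite G" and G: "\<forall>(a, q)\<in>G. a \<in> Ob \<and> q \<in> torsion (fst a)"
    and GQ: "\<forall>a'\<in>Ob. \<forall>D. submodule D K (Fo (fst a')) \<longrightarrow> (\<forall>(a, q)\<in>G. \<forall>h\<in>H a a'. h q \<in> D) \<longrightarrow> torsion (fst a') \<subseteq> D"
    by (elim exE conjE)
  have "\<forall>z\<in>G. \<exists>n. \<forall>W f. orthogonal_module R W \<longrightarrow> f \<in> isometries R (fst (fst z)) W \<longrightarrow>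
     n \<le> rk R W \<longrightarrow> Fm (fst (fst z)) W f (snd z) = \<zero>\<^bsub>Fo W\<^esub>"
    using G by (fastforce simp: torsion_def)
  then obtain n where n: "\<And>z W f. \<lbrakk>z \<in> G; orthogonal_module R W; f \<in> isometries R (fst (fst z)) W;
     n z \<le> rk R W\<rbrakk> \<Longrightarrow> Fm (fst (fst z)) W f (snd z) = \<zero>\<^bsub>Fo W\<^esub>"
    by metis
  \<comment> \<open>The sum bounds each single \<open>n z\<close> and also makes sense for empty
    \<open>G\<close>.\<close>
  have "torsion V \<subseteq> {\<zero>\<^bsub>Fo V\<^esub>}" if V: "orthogonal_module R V" and rk: "(\<Sum>z\<in>G. n z) \<le> rk R V" for V
  proof -
    interpret V: finite_orthogonal_module R V by (rule finite_orthogonal[OF V])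
    interpret M: left_module K "Fo V" by (rule obj[OF V])
    obtain bs where bs: "orth_list R V bs" "length bs = rk R V"
      using V.orth_list_extend[of "[]"] by (auto simp: orth_list_def)
    \<comment> \<open>The Groebner basis is tested against the zero submodule: in this rank every
      isometry into \<open>V\<close> kills every element of \<open>G\<close>.\<close>
    have "torsion (fst (V, bs)) \<subseteq> {\<zero>\<^bsub>Fo V\<^esub>}"
    proof (rule GQ[rule_format])
      show "(V, bs) \<in> Ob"
        using V bs by (simp add: Ob_def)
      show "submodule {\<zero>\<^bsub>Fo V\<^esub>} K (Fo (fst (V, bs)))"
        unfolding fst_conv by (rule M.submoduleI) (auto simp: M.smult_r_null)
      have "h q \<in> {\<zero>\<^bsub>Fo V\<^esub>}" if "(a, q) \<in> G" "h \<in> H a (V, bs)" for a q h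
      proof -
        have "n (a, q) \<le> rk R V"
          using rk member_le_sum[OF that(1), of n] finG by simp
        then show ?thesis
          using n[OF that(1) V] that(2) by (auto simp: H_def)
      qed
      then show "case z of (a, q) \<Rightarrow> \<forall>h\<in>H a (V, bs). h q \<in> {\<zero>\<^bsub>Fo V\<^esub>}" if "z \<in> G" for z
        using that by auto
    qed
    then show ?thesis
      by simp
  qed
  then show ?thesis
    by blast
qed

theorem corollary4p9:
  fixes R :: "('r, 's) ring_scheme"
    and K :: "('k, 't) ring_scheme"
    and Fo :: "('r, 'v) orth_module \<Rightarrow> ('k, 'm) module"
    and Fm :: "('r, 'v) orth_module \<Rightarrow> ('r, 'v) orth_module \<Rightarrow> ('v \<Rightarrow> 'v) \<Rightarrow> 'm \<Rightarrow> 'm"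
  assumes "infinite (UNIV :: 'v set)"
    and "cring R" and "finite (carrier R)" and "\<one>\<^bsub>R\<^esub> \<oplus>\<^bsub>R\<^esub> \<one>\<^bsub>R\<^esub> \<in> Units R"
    and "left_noetherian_ring K"
    and "OrI_module R K Fo Fm" and "OrI_finitely_generated R K Fo Fm"
  shows "\<exists>N::nat. \<forall>V W f.
           orthogonal_module R V \<longrightarrow> orthogonal_module R W \<longrightarrow> f \<in> isometries R V W \<longrightarrow>
           N \<le> rk R V \<longrightarrow> inj_on (Fm V W f) (carrier (Fo V))"
proof (cases "\<one>\<^bsub>R\<^esub> = \<zero>\<^bsub>R\<^esub>")
  case True
  \<comment> \<open>All ranks are 0 here, so with the bound 1 there is nothing to prove.\<close>
  then show ?thesis
    using rk_zero_ring[of R] by (intro exI[of _ 1]) force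
next
  case False
  then interpret finite_OrI_module R K Fo Fm
    using assms by (simp add: finite_OrI_module_def finite_OrI_module_axioms_def)
  obtain N where N: "\<And>V. \<lbrakk>orthogonal_module R V; N \<le> rk R V\<rbrakk> \<Longrightarrow> torsion V \<subseteq> {\<zero>\<^bsub>Fo V\<^esub>}"
    using torsion_vanishes[OF assms(5,7)] by blast
  have "inj_on (Fm V W f) (carrier (Fo V))"
    if V: "orthogonal_module R V" and W: "orthogonal_module R W" and f: "f \<in> isometries R V W"
      and rk: "N \<le> rk R V" for V W f
  proof (rule inj_onI)
    interpret M: left_module K "Fo V" by (rule obj[OF V])
    interpret M': left_module K "Fo W" by (rule obj[OF W])
    note lin = linear_mapsD(1-3)[OF mor[OF V W f]]
    fix x y assume xy: "x \<in> carrier (Fo V)" "y \<in> carrier (Fo V)" "Fm V W f x = Fm V W f y"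
    have "Fm V W f (\<ominus>\<^bsub>Fo V\<^esub> y) = \<ominus>\<^bsub>Fo W\<^esub> Fm V W f y"
      using lin(3)[of "\<ominus>\<^bsub>K\<^esub> \<one>\<^bsub>K\<^esub>" y] lin(1) xy(2) by (simp add: M.smult_minus_one M'.smult_minus_one)
    then have "Fm V W f (x \<oplus>\<^bsub>Fo V\<^esub> \<ominus>\<^bsub>Fo V\<^esub> y) = \<zero>\<^bsub>Fo W\<^esub>"
      using lin(1,2) xy by (simp add: M'.M.r_neg)
    then have "x \<oplus>\<^bsub>Fo V\<^esub> \<ominus>\<^bsub>Fo V\<^esub> y \<in> torsion V"
      using xy by (intro kernel_torsion[OF V W f]) auto
    then have "x \<oplus>\<^bsub>Fo V\<^esub> \<ominus>\<^bsub>Fo V\<^esub> y = \<zero>\<^bsub>Fo V\<^esub>"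
      using N[OF V rk] by blast
    then show "x = y"
      using xy by (metis M.M.minus_equality M.M.minus_minus M.M.a_inv_closed)
  qed
  then show ?thesis
    by blast
qed

end
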